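(* Let $L>0$, $T>0$ and $\varepsilon>0$. If the solution $u$ of $(S_0)$ with initial datum $u_0\in X$ satisfies $u(\cdot,-L)=0$ on $(0,T)$, then $u_0\equiv0$. However, there is no constant $C>0$ such that the estimate $$\|u_0\|_X\le C\,\|u(\cdot,-L)\|_{L^2(0,T)}\qquad\text{for all }u_0\in X$$ holds, where $u$ denotes the solution of $(S_0)$ with initial datum $u_0$.
   Context: Let $\Omega=(-L,0)$. The outward normal derivative $\partial_\nu$ is $\partial_x$ at $x=0$ and $-\partial_x$ at $x=-L$. $X$ is the closure (Hilbert space completion) of $\mathcal C^\infty(\overline\Omega)$ for the norm $\|u\|_X=\big(\|u\|_{L^2(\Omega)}^2+\varepsilon(|u(0)|^2+|u(-L)|^2)\big)^{1/2}$, with the associated scalar product $\langle\cdot,\cdot\rangle_X$; elements of $X$ thus carry boundary values at $0$ and $-L$. System $(S_0)$: $u_t+u_x-\varepsilon u_{xx}=0$ in $(0,T)\times(-L,0)$; $\varepsilon(u_t+\partial_\nu u)=0$ at $x=0$; $\varepsilon(u_t+\partial_\nu u)+u=0$ at $x=-L$; $u(0,\cdot)=u_0$. Its (weak) solution for $u_0\in X$ is $u(t)=e^{t\mathcal A}u_0\in\mathcal C([0,T],X)$, where $\mathcal A$ is the following generator. Let $a(u_1,u_2)=\varepsilon\int_\Omega \partial_xu_1\,\partial_xu_2+\int_\Omega \partial_xu_1\,u_2+u_1(-L)u_2(-L)$; for $u_1\in X$, $u_2\in\mathcal C^\infty(\overline\Omega)$ it is defined through integration by parts, i.e. $a(u_1,u_2)=-\varepsilon\int_\Omega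 u_1\partial_x^2u_2+\varepsilon[u_1\partial_xu_2]_{x=-L}^{x=0}-\int_\Omega u_1\partial_xu_2+u_1(0)u_2(0)$. $\mathcal D(\mathcal A)$ is the set of $u_1\in X$ such that $\sup\{|a(u_1,u_2)|:u_2\in\mathcal C^\infty(\overline\Omega),\|u_2\|_X\le1\}<\infty$, and $\mathcal A u_1\in X$ is defined by $\langle-\mathcal A u_1,u_2\rangle_X=a(u_1,u_2)$ (extended by continuity to $u_2\in X$). *)

theory Defs
  imports "HOL-Analysis.Analysis"
begin

definition L2_space :: "real set \<Rightarrow> (real \<Rightarrow> real) set" where
  "L2_space I = {f. f \<in> borel_measurable (lebesgue_on I) \<and> integrable (lebesgue_on I) (\<lambda>x. (f x)\<^sup>2)}"

definition L2_norm :: "real set \<Rightarrow> (real \<Rightarrow> real) \<Rightarrow> real" where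
  "L2_norm I f = sqrt (\<integral>x. (f x)\<^sup>2 \<partial>lebesgue_on I)"

text \<open>The derivative is one-sided at the end points of \<open>[-L, 0]\<close>. Only values at points of
  \<open>[-L, 0]\<close> are meaningful.\<close>

definition dx :: "real \<Rightarrow> (real \<Rightarrow> real) \<Rightarrow> real \<Rightarrow> real" where
  "dx L f x = vector_derivative f (at x within {-L..0})"

definition C_infinity :: "real \<Rightarrow> (real \<Rightarrow> real) set" where
  "C_infinity L = {f. \<forall>k. (dx L ^^ k) f differentiable_on {-L..0}}"

text \<open>An element of the Hilbert space \<open>X\<close> is an \<open>L\<^sup>2\<close> class on \<open>(-L, 0)\<close> together with two
  boundary values. It is represented by a function \<open>u\<close> whose point values \<open>u 0\<close> and \<open>u (-L)\<close> are
  these boundary values; as the end points are null sets, they are independent of the \<open>L\<^sup>2\<close> class.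
  Two functions represent the same element of \<open>X\<close> iff they are related by \<open>X_eq\<close>.\<close>

definition X_inner :: "real \<Rightarrow> real \<Rightarrow> (real \<Rightarrow> real) \<Rightarrow> (real \<Rightarrow> real) \<Rightarrow> real" where
  "X_inner \<epsilon> L u v =
     (\<integral>x. u x * v x \<partial>lebesgue_on {-L<..<0}) + \<epsilon> * (u 0 * v 0 + u (-L) * v (-L))"

definition X_norm :: "real \<Rightarrow> real \<Rightarrow> (real \<Rightarrow> real) \<Rightarrow> real" where
  "X_norm \<epsilon> L u = sqrt ((L2_norm {-L<..<0} u)\<^sup>2 + \<epsilon> * (\<bar>u 0\<bar>\<^sup>2 + \<bar>u (-L)\<bar>\<^sup>2))"

definition X_eq :: "real \<Rightarrow> real \<Rightarrow> (real \<Rightarrow> real) \<Rightarrow> (real \<Rightarrow> real) \<Rightarrow> bool" where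
  "X_eq \<epsilon> L u v \<longleftrightarrow> X_norm \<epsilon> L (\<lambda>x. u x - v x) = 0"

text \<open>The completion of \<open>C_infinity L\<close> for \<open>X_norm\<close>, realised as its closure in the complete space
  \<open>L\<^sup>2(-L, 0) \<times> \<real> \<times> \<real>\<close>.\<close>

definition X_space :: "real \<Rightarrow> real \<Rightarrow> (real \<Rightarrow> real) set" where
  "X_space \<epsilon> L = {u \<in> L2_space {-L<..<0}.
     \<exists>\<phi> :: nat \<Rightarrow> real \<Rightarrow> real. (\<forall>n. \<phi> n \<in> C_infinity L) \<and>
       (\<lambda>n. X_norm \<epsilon> L (\<lambda>x. \<phi> n x - u x)) \<longlonglongrightarrow> 0}"

text \<open>For \<open>u\<close> and \<open>\<phi>\<close> smooth, integration by parts turns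
  \<open>\<epsilon> \<integral> u' \<phi>' + \<integral> u' \<phi> + u(-L) \<phi>(-L)\<close> into the expression below (the terms in \<open>u(-L) \<phi>(-L)\<close>
  cancel), which makes sense for \<open>u\<close> in \<open>X\<close> and \<open>\<phi>\<close> smooth.\<close>

definition a_form :: "real \<Rightarrow> real \<Rightarrow> (real \<Rightarrow> real) \<Rightarrow> (real \<Rightarrow> real) \<Rightarrow> real" where
  "a_form \<epsilon> L u \<phi> =
     - \<epsilon> * (\<integral>x. u x * dx L (dx L \<phi>) x \<partial>lebesgue_on {-L<..<0})
     + \<epsilon> * (u 0 * dx L \<phi> 0 - u (-L) * dx L \<phi> (-L))
     - (\<integral>x. u x * dx L \<phi> x \<partial>lebesgue_on {-L<..<0})
     + u 0 * \<phi> 0"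

definition dom_A :: "real \<Rightarrow> real \<Rightarrow> (real \<Rightarrow> real) set" where
  "dom_A \<epsilon> L = {u \<in> X_space \<epsilon> L.
     bdd_above {\<bar>a_form \<epsilon> L u \<phi>\<bar> | \<phi>. \<phi> \<in> C_infinity L \<and> X_norm \<epsilon> L \<phi> \<le> 1}}"

text \<open>For \<open>u \<in> dom_A \<epsilon> L\<close> such a \<open>w\<close> exists by the Riesz representation theorem and, smooth
  functions being dense, it is unique up to \<open>X_eq\<close>.\<close>

definition op_A :: "real \<Rightarrow> real \<Rightarrow> (real \<Rightarrow> real) \<Rightarrow> (real \<Rightarrow> real)" where
  "op_A \<epsilon> L u = (SOME w. w \<in> X_space \<epsilon> L \<and>
     (\<forall>\<phi>\<in>C_infinity L. X_inner \<epsilon> L (\<lambda>x. - w x) \<phi> = a_form \<epsilon> L u \<phi>))"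

definition C0_semigroup ::
  "real \<Rightarrow> real \<Rightarrow> (real \<Rightarrow> (real \<Rightarrow> real) \<Rightarrow> (real \<Rightarrow> real)) \<Rightarrow> bool" where
  "C0_semigroup \<epsilon> L S \<longleftrightarrow>
     (\<forall>t\<ge>0. \<forall>u\<in>X_space \<epsilon> L. S t u \<in> X_space \<epsilon> L) \<and>
     (\<forall>t\<ge>0. \<forall>u\<in>X_space \<epsilon> L. \<forall>v\<in>X_space \<epsilon> L. \<forall>a b.
        X_eq \<epsilon> L (S t (\<lambda>x. a * u x + b * v x)) (\<lambda>x. a * S t u x + b * S t v x)) \<and>
     (\<forall>t\<ge>0. \<exists>M. \<forall>u\<in>X_space \<epsilon> L. X_norm \<epsilon> L (S t u) \<le> M * X_norm \<epsilon> L u) \<and>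
     (\<forall>u\<in>X_space \<epsilon> L. X_eq \<epsilon> L (S 0 u) u) \<and>
     (\<forall>s\<ge>0. \<forall>t\<ge>0. \<forall>u\<in>X_space \<epsilon> L. X_eq \<epsilon> L (S (s + t) u) (S s (S t u))) \<and>
     (\<forall>u\<in>X_space \<epsilon> L. ((\<lambda>t. X_norm \<epsilon> L (\<lambda>x. S t u x - u x)) \<longlongrightarrow> 0) (at_right 0))"

text \<open>The infinitesimal generator of \<open>S\<close>, domain included, is \<open>op_A\<close> on \<open>dom_A\<close>. This determines
  \<open>S\<close> up to \<open>X_eq\<close>.\<close>

definition generated_by_A ::
  "real \<Rightarrow> real \<Rightarrow> (real \<Rightarrow> (real \<Rightarrow> real) \<Rightarrow> (real \<Rightarrow> real)) \<Rightarrow> bool" where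
  "generated_by_A \<epsilon> L S \<longleftrightarrow> C0_semigroup \<epsilon> L S \<and>
     (\<forall>u\<in>X_space \<epsilon> L. \<forall>w\<in>X_space \<epsilon> L.
        ((\<lambda>h. X_norm \<epsilon> L (\<lambda>x. (S h u x - u x) / h - w x)) \<longlongrightarrow> 0) (at_right 0) \<longleftrightarrow>
        u \<in> dom_A \<epsilon> L \<and> X_eq \<epsilon> L w (op_A \<epsilon> L u))"

text \<open>The solution with initial datum \<open>u0\<close>, that is \<open>u t = exp (t A) u0\<close> in \<open>X\<close>; the first
  argument of \<open>u\<close> is time, the second is space.\<close>

definition is_solution ::
  "real \<Rightarrow> real \<Rightarrow> real \<Rightarrow> (real \<Rightarrow> real) \<Rightarrow> (real \<Rightarrow> real \<Rightarrow> real) \<Rightarrow> bool" where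
  "is_solution \<epsilon> L T u0 u \<longleftrightarrow>
     (\<exists>S. generated_by_A \<epsilon> L S \<and>
        (\<forall>t\<in>{0..T}. u t \<in> X_space \<epsilon> L \<and> X_eq \<epsilon> L (u t) (S t u0)))"

end

theory Submission
  imports Defs "HOL-Complex_Analysis.Great_Picard"
begin

text \<open>For the inner product with weight \<open>exp (-x / \<epsilon>)\<close> the generator is self-adjoint and negative,
  and its inverse is, up to sign, the integral operator with kernel \<open>exp (min x s / \<epsilon>)\<close>, which is
  compact. Hence \<open>X\<close> has an orthonormal basis of eigenfunctions \<open>e\<^sub>n\<close> with eigenvalues \<open>-\<mu>\<^sub>n\<close>,
  \<open>\<mu>\<^sub>n \<rightarrow> \<infinity>\<close>, and the semigroup multiplies the \<open>n\<close>-th coefficient by \<open>exp (-\<mu>\<^sub>n t)\<close>.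
  By uniqueness for the second order equation, the boundary condition at \<open>-L\<close> gives
  \<open>e\<^sub>n (-L) \<noteq> 0\<close> and simple eigenvalues. If \<open>u(t, -L) = \<Sum> c\<^sub>n e\<^sub>n (-L) exp (-\<mu>\<^sub>n t)\<close> vanishes on an
  interval, then it vanishes for all \<open>t > 0\<close> by analyticity, and comparing decay rates gives \<open>c\<^sub>n = 0\<close>.
  On the other hand the datum \<open>e\<^sub>n\<close> has norm of order one, while the observation
  \<open>exp (-\<mu>\<^sub>n t) e\<^sub>n (-L)\<close> has \<open>L\<^sup>2\<close> norm at most of order \<open>\<mu>\<^sub>n\<close> to the power \<open>-1/2\<close>.\<close>

section \<open>Semi-inner product spaces\<close>

text \<open>The weight comes from
  \<open>wt * (u' - \<epsilon> * u'') = - \<epsilon> * (wt * u')'\<close>, which puts the equation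
  in Sturm-Liouville form. Its homogeneous solutions are 1, with zero slope at 0, and
  \<open>exp (x / \<epsilon>)\<close>, which satisfies \<open>- \<epsilon> * u' + u = 0\<close> at
  \<open>-L\<close>. The Green function glues these two, and its normalisation for the weighted
  measure is exactly 1. Two obstacles shape the proof. Elements of X are functions standing for
  classes, so each space carries only a seminorm and equality means distance 0; images of the Green
  operator, however, depend on the class alone, which yields eigenfunctions as true continuous
  functions solving a differential equation. Moreover, a solution is defined through some semigroup
  with the given generator, so besides constructing one, every such semigroup has to be identified;
  this is where uniform boundedness enters. The dynamic boundary condition helps: since X contains
  the boundary values, the observation at \<open>-L\<close> is a bounded functional on X.\<close>

lemma tendsto_0_le_real:
  fixes f g :: "'b \<Rightarrow> real"
  assumes "(g \<longlongrightarrow> 0) F" "\<forall>\<^sub>F n in F. 0 \<le> f n \<and> f n \<le> g n"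
  shows "(f \<longlongrightarrow> 0) F"
  by (rule tendsto_sandwich[OF eventually_mono[OF assms(2)] eventually_mono[OF assms(2)] tendsto_const assms(1)]) auto

lemma exp_quotient_tendsto: "((\<lambda>s::real. (exp (- c * s) - 1) / s) \<longlongrightarrow> - c) (at_right 0)"
proof -
  have "((\<lambda>s. exp (- c * s)) has_field_derivative - c) (at 0)"
    by (auto intro!: derivative_eq_intros)
  then have "((\<lambda>s. (exp (- c * s) - exp (- c * 0)) / (s - 0)) \<longlongrightarrow> - c) (at_right 0)"
    unfolding has_field_derivative_iff by (rule tendsto_within_subset) simp
  then show ?thesis by simp
qed

lemma abs_mult_le_squares: "\<bar>a * b\<bar> \<le> a\<^sup>2 + b\<^sup>2" for a b :: real
proof -
  have "2 * (\<bar>a\<bar> * \<bar>b\<bar>) \<le> a\<^sup>2 + b\<^sup>2"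
    using sum_squares_bound[of "\<bar>a\<bar>" "\<bar>b\<bar>"] by simp
  moreover have "0 \<le> \<bar>a\<bar> * \<bar>b\<bar>" by simp
  ultimately show ?thesis unfolding abs_mult by linarith
qed

text \<open>Elements are functions representing classes, so \<open>ip u u = 0\<close> does not force
  \<open>u\<close> to vanish; equality of classes is expressed by \<open>dst u v = 0\<close>
  throughout.\<close>

locale semi_inner_space =
  fixes V :: "('a \<Rightarrow> real) set" and ip :: "('a \<Rightarrow> real) \<Rightarrow> ('a \<Rightarrow> real) \<Rightarrow> real"
  assumes zero_closed: "(\<lambda>_. 0) \<in> V"
    and lin_closed: "u \<in> V \<Longrightarrow> v \<in> V \<Longrightarrow> (\<lambda>x. a * u x + b * v x) \<in> V"
    and ip_commute: "u \<in> V \<Longrightarrow> v \<in> V \<Longrightarrow> ip u v = ip v u"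
    and ip_lin: "u \<in> V \<Longrightarrow> v \<in> V \<Longrightarrow> z \<in> V \<Longrightarrow>
      ip (\<lambda>x. a * u x + b * v x) z = a * ip u z + b * ip v z"
    and ip_nonneg: "u \<in> V \<Longrightarrow> 0 \<le> ip u u"
begin

definition nrm :: "('a \<Rightarrow> real) \<Rightarrow> real" where
  "nrm u = sqrt (ip u u)"

definition dst :: "('a \<Rightarrow> real) \<Rightarrow> ('a \<Rightarrow> real) \<Rightarrow> real" where
  "dst u v = nrm (\<lambda>x. u x - v x)"

lemma diff_closed: "u \<in> V \<Longrightarrow> v \<in> V \<Longrightarrow> (\<lambda>x. u x - v x) \<in> V"
  using lin_closed[of u v 1 "-1"] by simp

lemma add_closed: "u \<in> V \<Longrightarrow> v \<in> V \<Longrightarrow> (\<lambda>x. u x + v x) \<in> V"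
  using lin_closed[of u v 1 1] by simp

lemma scale_closed: "u \<in> V \<Longrightarrow> (\<lambda>x. a * u x) \<in> V"
  using lin_closed[of u u a 0] by simp

lemma sum_closed: "(\<And>i. i \<in> J \<Longrightarrow> f i \<in> V) \<Longrightarrow> (\<lambda>x. \<Sum>i\<in>J. c i * f i x) \<in> V"
proof (induction J rule: infinite_finite_induct)
  case (insert j J)
  then show ?case
    using lin_closed[of "f j" "\<lambda>x. \<Sum>i\<in>J. c i * f i x" "c j" 1] by simp
qed (auto simp: zero_closed)

lemma ip_diff_left: "u \<in> V \<Longrightarrow> v \<in> V \<Longrightarrow> z \<in> V \<Longrightarrow> ip (\<lambda>x. u x - v x) z = ip u z - ip v z"
  using ip_lin[of u v z 1 "-1"] by simp

lemma ip_add_left: "u \<in> V \<Longrightarrow> v \<in> V \<Longrightarrow> z \<in> V \<Longrightarrow> ip (\<lambda>x. u x + v x) z = ip u z + ip v z"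
  using ip_lin[of u v z 1 "1"] by simp

lemma ip_scale_left: "u \<in> V \<Longrightarrow> z \<in> V \<Longrightarrow> ip (\<lambda>x. a * u x) z = a * ip u z"
  using ip_lin[of u u z a 0] by simp

lemma ip_zero_left: "z \<in> V \<Longrightarrow> ip (\<lambda>x. 0) z = 0"
  using ip_scale_left[of "\<lambda>_. 0" z 0] zero_closed by simp

lemma ip_lin_right: "u \<in> V \<Longrightarrow> v \<in> V \<Longrightarrow> z \<in> V \<Longrightarrow>
    ip z (\<lambda>x. a * u x + b * v x) = a * ip z u + b * ip z v"
  using ip_lin[of u v z a b] by (simp add: ip_commute lin_closed)

lemma ip_diff_right: "u \<in> V \<Longrightarrow> v \<in> V \<Longrightarrow> z \<in> V \<Longrightarrow> ip z (\<lambda>x. u x - v x) = ip z u - ip z v"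
  using ip_diff_left[of u v z] by (simp add: ip_commute diff_closed)

lemma ip_add_right: "u \<in> V \<Longrightarrow> v \<in> V \<Longrightarrow> z \<in> V \<Longrightarrow> ip z (\<lambda>x. u x + v x) = ip z u + ip z v"
  using ip_add_left[of u v z] by (simp add: ip_commute add_closed)

lemma ip_scale_right: "u \<in> V \<Longrightarrow> z \<in> V \<Longrightarrow> ip z (\<lambda>x. a * u x) = a * ip z u"
  using ip_scale_left[of u z a] by (simp add: ip_commute scale_closed)

lemma ip_sum_left: "(\<And>i. i \<in> J \<Longrightarrow> f i \<in> V) \<Longrightarrow> z \<in> V \<Longrightarrow>
    ip (\<lambda>x. \<Sum>i\<in>J. c i * f i x) z = (\<Sum>i\<in>J. c i * ip (f i) z)"
proof (induction J rule: infinite_finite_induct)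
  case (insert j J)
  then show ?case
    using ip_lin[of "f j" "\<lambda>x. \<Sum>i\<in>J. c i * f i x" z "c j" 1]
    by (simp add: sum_closed)
qed (auto simp: ip_zero_left)

lemma ip_sum_right: "(\<And>i. i \<in> J \<Longrightarrow> f i \<in> V) \<Longrightarrow> z \<in> V \<Longrightarrow>
    ip z (\<lambda>x. \<Sum>i\<in>J. c i * f i x) = (\<Sum>i\<in>J. c i * ip z (f i))"
  using ip_sum_left[of J f z c] by (simp add: ip_commute sum_closed)

lemma nrm_nonneg [simp]: "u \<in> V \<Longrightarrow> 0 \<le> nrm u"
  by (simp add: nrm_def ip_nonneg)

lemma nrm_sq: "u \<in> V \<Longrightarrow> (nrm u)\<^sup>2 = ip u u"
  by (simp add: nrm_def ip_nonneg)

lemma nrm_scale: "u \<in> V \<Longrightarrow> nrm (\<lambda>x. a * u x) = \<bar>a\<bar> * nrm u"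
  by (simp add: nrm_def ip_scale_left ip_scale_right scale_closed real_sqrt_mult
      flip: mult.assoc power2_eq_square)

lemma cauchy_schwarz:
  assumes u: "u \<in> V" and v: "v \<in> V"
  shows "\<bar>ip u v\<bar> \<le> nrm u * nrm v"
proof -
  have q: "0 \<le> a * a * ip u u + 2 * a * b * ip u v + b * b * ip v v" for a b
  proof -
    have "0 \<le> ip (\<lambda>x. a * u x + b * v x) (\<lambda>x. a * u x + b * v x)"
      using u v by (intro ip_nonneg lin_closed)
    also have "\<dots> = a * a * ip u u + 2 * a * b * ip u v + b * b * ip v v"
      using u v by (simp add: ip_lin ip_lin_right lin_closed ip_commute[of v u] algebra_simps)
    finally show ?thesis .
  qed
  have "(ip u v)\<^sup>2 \<le> ip u u * ip v v"
  \<comment> \<open>For null \<open>v\<close> the form is affine in \<open>b\<close>, and an affine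
    function bounded below has slope 0. Otherwise the weights \<open>a = ip v v\<close> and
    \<open>b = - ip u v\<close> produce the Gram determinant.\<close>
  proof (cases "ip v v = 0")
    case True
    have "ip u v = 0"
    proof (rule ccontr)
      assume ne: "ip u v \<noteq> 0"
      have "0 \<le> ip u u + 2 * b * ip u v" for b
        using q[of 1 b] True by simp
      from this[of "- (ip u u + 1) / (2 * ip u v)"] ne show False
        by (simp add: field_simps)
    qed
    then show ?thesis using True by simp
  next
    case False
    then have pos: "ip v v > 0" using ip_nonneg[OF v] by simp
    have "0 \<le> ip v v * (ip u u * ip v v - (ip u v)\<^sup>2)"
      using q[of "ip v v" "- ip u v"] by (simp add: algebra_simps power2_eq_square)
    then show ?thesis using pos by (simp add: zero_le_mult_iff)
  qed
  then have "sqrt ((ip u v)\<^sup>2) \<le> sqrt (ip u u * ip v v)"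
    by (rule real_sqrt_le_mono)
  then show ?thesis by (simp add: nrm_def real_sqrt_mult)
qed

lemma nrm_add: 
  assumes u: "u \<in> V" and v: "v \<in> V"
  shows "nrm (\<lambda>x. u x + v x) \<le> nrm u + nrm v"
proof (rule power2_le_imp_le)
  have "(nrm (\<lambda>x. u x + v x))\<^sup>2 = ip u u + 2 * ip u v + ip v v"
    using u v by (simp add: nrm_sq add_closed ip_add_left ip_add_right ip_commute[of v u])
  also have "\<dots> \<le> (nrm u)\<^sup>2 + 2 * (nrm u * nrm v) + (nrm v)\<^sup>2"
    using cauchy_schwarz[OF u v] u v by (simp add: nrm_sq)
  also have "\<dots> = (nrm u + nrm v)\<^sup>2" by (simp add: power2_sum)
  finally show "(nrm (\<lambda>x. u x + v x))\<^sup>2 \<le> (nrm u + nrm v)\<^sup>2" .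
qed (use u v in simp)

lemma dst_nonneg [simp]: "u \<in> V \<Longrightarrow> v \<in> V \<Longrightarrow> 0 \<le> dst u v"
  by (simp add: dst_def diff_closed)

lemma dst_commute: "u \<in> V \<Longrightarrow> v \<in> V \<Longrightarrow> dst u v = dst v u"
  using nrm_scale[of "\<lambda>x. u x - v x" "-1"] by (simp add: dst_def diff_closed)

lemma dst_triangle: "u \<in> V \<Longrightarrow> v \<in> V \<Longrightarrow> z \<in> V \<Longrightarrow> dst u z \<le> dst u v + dst v z"
  using nrm_add[of "\<lambda>x. u x - v x" "\<lambda>x. v x - z x"] by (simp add: dst_def diff_closed)

lemma dst_self [simp]: "dst u u = 0"
  using ip_zero_left[OF zero_closed] by (simp add: dst_def nrm_def)

lemma dst_zero: "dst u (\<lambda>_. 0) = nrm u"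
  by (simp add: dst_def)

lemma nrm_zero: "nrm (\<lambda>_. 0) = 0"
  using ip_zero_left[OF zero_closed] by (simp add: nrm_def)

lemma ip_dst: "u \<in> V \<Longrightarrow> v \<in> V \<Longrightarrow> z \<in> V \<Longrightarrow> \<bar>ip u z - ip v z\<bar> \<le> dst u v * nrm z"
  using cauchy_schwarz[of "\<lambda>x. u x - v x" z] by (simp add: diff_closed ip_diff_left dst_def)

lemma ip_null: "u \<in> V \<Longrightarrow> v \<in> V \<Longrightarrow> z \<in> V \<Longrightarrow> dst u v = 0 \<Longrightarrow> ip u z = ip v z"
  using ip_dst[of u v z] by simp

lemma nrm_dst: "u \<in> V \<Longrightarrow> v \<in> V \<Longrightarrow> \<bar>nrm u - nrm v\<bar> \<le> dst u v"
  using dst_triangle[of u v "\<lambda>_. 0"] dst_triangle[of v u "\<lambda>_. 0"]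
  by (simp add: dst_zero zero_closed dst_commute[of v u] abs_le_iff)

lemma dst_scale_sq:
  assumes u: "u \<in> V" and v: "v \<in> V"
  shows "(dst u (\<lambda>x. a * v x))\<^sup>2 = (nrm u)\<^sup>2 - 2 * a * ip u v + a\<^sup>2 * (nrm v)\<^sup>2"
proof -
  have av: "(\<lambda>x. a * v x) \<in> V" using v by (rule scale_closed)
  have "(dst u (\<lambda>x. a * v x))\<^sup>2 = ip u u - 2 * a * ip u v + a * (a * ip v v)"
    using u v av unfolding dst_def
    by (simp add: nrm_sq[OF diff_closed] ip_diff_left ip_diff_right diff_closed ip_scale_left
        ip_scale_right ip_commute[OF v u])
  then show ?thesis using nrm_sq[OF u] nrm_sq[OF v] by (simp add: power2_eq_square)
qed

lemma tendsto_ip: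
  assumes "\<forall>\<^sub>F n in F. f n \<in> V" "u \<in> V" "z \<in> V" "((\<lambda>n. dst (f n) u) \<longlongrightarrow> 0) F"
  shows "((\<lambda>n. ip (f n) z) \<longlongrightarrow> ip u z) F"
proof -
  have "((\<lambda>n. dst (f n) u * nrm z) \<longlongrightarrow> 0) F"
    by (rule tendsto_mult_left_zero[OF assms(4)])
  then have "((\<lambda>n. ip (f n) z - ip u z) \<longlongrightarrow> 0) F"
    by (rule Lim_null_comparison[OF eventually_mono[OF assms(1)], rotated])
      (simp add: ip_dst[OF _ assms(2,3)])
  then show ?thesis by (rule LIM_zero_cancel)
qed

lemma tendsto_nrm:
  assumes "\<forall>\<^sub>F n in F. f n \<in> V" "u \<in> V" "((\<lambda>n. dst (f n) u) \<longlongrightarrow> 0) F"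
  shows "((\<lambda>n. nrm (f n)) \<longlongrightarrow> nrm u) F"
proof -
  have "((\<lambda>n. nrm (f n) - nrm u) \<longlongrightarrow> 0) F"
    by (rule Lim_null_comparison[OF eventually_mono[OF assms(1)] assms(3)])
      (simp add: nrm_dst[OF _ assms(2)])
  then show ?thesis by (rule LIM_zero_cancel)
qed

lemma ip_self_zero_iff: "u \<in> V \<Longrightarrow> ip u u = 0 \<longleftrightarrow> nrm u = 0"
  by (simp add: nrm_def)

end

text \<open>Working with \<open>K \<circ> K\<close>, which is positive, avoids the identity between the operator norm
  and the numerical radius of \<open>K\<close>.\<close>

lemma (in semi_inner_space) compact_symmetric_eigenvector:
  fixes K :: "('a \<Rightarrow> real) \<Rightarrow> ('a \<Rightarrow> real)"
  assumes K_closed: "\<And>u. u \<in> V \<Longrightarrow> K u \<in> V"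
    and K_lin: "\<And>u v a b. u \<in> V \<Longrightarrow> v \<in> V \<Longrightarrow> K (\<lambda>x. a * u x + b * v x) = (\<lambda>x. a * K u x + b * K v x)"
    and K_sym: "\<And>u v. u \<in> V \<Longrightarrow> v \<in> V \<Longrightarrow> ip (K u) v = ip u (K v)"
    and K_bdd: "\<And>u. u \<in> V \<Longrightarrow> nrm (K u) \<le> C * nrm u"
    and K_compact: "\<And>f. (\<And>n::nat. f n \<in> V) \<Longrightarrow> (\<And>n. nrm (f n) \<le> 1) \<Longrightarrow>
        \<exists>g\<in>V. \<exists>r. strict_mono r \<and> (\<lambda>n. dst (K (f (r n))) g) \<longlonglongrightarrow> 0"
    and K_nonzero: "u0 \<in> V" "nrm (K u0) \<noteq> 0"
  shows "\<exists>e\<in>V. \<exists>l. l \<noteq> 0 \<and> nrm e = 1 \<and> dst (K e) (\<lambda>x. l * e x) = 0"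
proof -
  have K_diff: "K (\<lambda>x. u x - v x) = (\<lambda>x. K u x - K v x)" if "u \<in> V" "v \<in> V" for u v
    using K_lin[OF that, of 1 "-1"] by simp
  have K_scale: "K (\<lambda>x. a * u x) = (\<lambda>x. a * K u x)" if "u \<in> V" for u a
    using K_lin[OF that that, of a 0] by simp
  have K_dst: "dst (K u) (K v) \<le> C * dst u v" if "u \<in> V" "v \<in> V" for u v
    using K_bdd[of "\<lambda>x. u x - v x"] that by (simp add: dst_def K_diff diff_closed)
  have K_tendsto: "(\<lambda>n. dst (K (f n)) (K u)) \<longlonglongrightarrow> 0"
    if "\<And>n::nat. f n \<in> V" "u \<in> V" "(\<lambda>n. dst (f n) u) \<longlonglongrightarrow> 0" for f u
  proof (rule tendsto_0_le_real)
    show "(\<lambda>n. C * dst (f n) u) \<longlonglongrightarrow> 0"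
      using tendsto_mult_right_zero[OF that(3)] by (simp add: mult.commute)
  qed (use that K_dst K_closed in auto)
  define R where "R = {nrm (K f) | f. f \<in> V \<and> nrm f \<le> 1}"
  define k where "k = Sup R"
  have R_bdd: "bdd_above R"
  proof (rule bdd_aboveI)
    fix r assume "r \<in> R"
    then obtain f where f: "f \<in> V" "nrm f \<le> 1" "r = nrm (K f)" by (auto simp: R_def)
    have "r \<le> C * nrm f" using K_bdd f by simp
    also have "\<dots> \<le> \<bar>C\<bar> * nrm f" using f by (intro mult_right_mono) auto
    also have "\<dots> \<le> \<bar>C\<bar> * 1" using f by (intro mult_left_mono) auto
    finally show "r \<le> \<bar>C\<bar>" by simp
  qed
  have k_upper1: "nrm (K f) \<le> k" if "f \<in> V" "nrm f \<le> 1" for f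
    unfolding k_def using that by (intro cSup_upper R_bdd) (auto simp: R_def)
  have nz: "nrm u0 \<noteq> 0"
    using K_bdd[OF K_nonzero(1)] K_nonzero nrm_nonneg[OF K_closed[OF K_nonzero(1)]] by auto
  have k_upper: "nrm (K f) \<le> k * nrm f" if f: "f \<in> V" for f
  proof (cases "nrm f = 0")
    case True
    then show ?thesis using K_bdd[OF f] by simp
  next
    case False
    then have p: "nrm f > 0" using nrm_nonneg[OF f] by simp
    have "nrm (K (\<lambda>x. (1 / nrm f) * f x)) \<le> k"
      using f p nrm_scale[OF f, of "1 / nrm f"] by (intro k_upper1 scale_closed) simp_all
    also have "nrm (K (\<lambda>x. (1 / nrm f) * f x)) = nrm (K f) / nrm f"
      using p nrm_scale[OF K_closed[OF f], of "1 / nrm f"] unfolding K_scale[OF f] by simp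
    finally show ?thesis using p by (simp add: field_simps)
  qed
  have k_pos: "k > 0"
  proof -
    have "0 < nrm (K u0)" using K_nonzero nrm_nonneg[OF K_closed[OF K_nonzero(1)]] by simp
    also have "\<dots> \<le> k * nrm u0" by (rule k_upper[OF K_nonzero(1)])
    finally show ?thesis using nrm_nonneg[OF K_nonzero(1)] by (simp add: zero_less_mult_iff)
  qed
  have R_ne: "R \<noteq> {}" using zero_closed nrm_zero by (auto simp: R_def intro!: exI[of _ "\<lambda>_. 0"])
  have "\<exists>f. f \<in> V \<and> nrm f \<le> 1 \<and> k - 1 / Suc n < nrm (K f)" for n
  proof -
    have "k - 1 / Suc n < Sup R" by (simp add: k_def)
    then obtain r where "r \<in> R" "k - 1 / Suc n < r" using less_cSup_iff[OF R_ne R_bdd] by auto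
    then show ?thesis by (auto simp: R_def)
  qed
  then obtain f where f: "\<And>n. f n \<in> V" "\<And>n. nrm (f n) \<le> 1" "\<And>n. k - 1 / Suc n < nrm (K (f n))"
    by metis
  obtain g r where g: "g \<in> V" and r: "strict_mono r" and lim: "(\<lambda>n. dst (K (f (r n))) g) \<longlonglongrightarrow> 0"
    using K_compact[of f] f by blast
  define h where "h n = f (r n)" for n
  have h: "h n \<in> V" "nrm (h n) \<le> 1" for n by (auto simp: h_def f)
  have lim: "(\<lambda>n. dst (K (h n)) g) \<longlonglongrightarrow> 0" using lim by (simp add: h_def)
  have nKh: "(\<lambda>n. nrm (K (h n))) \<longlonglongrightarrow> k"
  proof (rule tendsto_sandwich)
    have "(\<lambda>n. k - 1 / Suc n) \<longlonglongrightarrow> k - 0"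
      by (intro tendsto_diff tendsto_const LIMSEQ_Suc[OF lim_1_over_n])
    from LIMSEQ_subseq_LIMSEQ[OF this r]
    show "(\<lambda>n. k - 1 / Suc (r n)) \<longlonglongrightarrow> k" by (simp add: o_def)
    show "\<forall>\<^sub>F n in sequentially. k - 1 / Suc (r n) \<le> nrm (K (h n))"
      unfolding h_def by (intro always_eventually allI less_imp_le f(3))
    show "\<forall>\<^sub>F n in sequentially. nrm (K (h n)) \<le> k"
      using h k_upper1 by auto
  qed auto
  have nrm_g: "nrm g = k"
    by (rule LIMSEQ_unique[OF tendsto_nrm[OF _ g lim] nKh]) (simp add: h K_closed)
  \<comment> \<open>Symmetry gives \<open>ip (K (K h)) h = (nrm (K h))\<^sup>2\<close>. Together
    with \<open>nrm (K (K h)) \<le> k\<^sup>2\<close> and \<open>nrm h \<le> 1\<close>, expanding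
    the square leaves a bound that tends to 0 along a maximising sequence.\<close>
  have sq: "(dst (K (K (h n))) (\<lambda>x. k\<^sup>2 * h n x))\<^sup>2 \<le> 2 * k^4 - 2 * k\<^sup>2 * (nrm (K (h n)))\<^sup>2" for n
  proof -
    let ?h = "h n" and ?Kh = "K (h n)" and ?KKh = "K (K (h n))"
    have V: "?h \<in> V" "?Kh \<in> V" "?KKh \<in> V" using h K_closed by auto
    have "(dst ?KKh (\<lambda>x. k\<^sup>2 * ?h x))\<^sup>2
        = (nrm ?KKh)\<^sup>2 - 2 * k\<^sup>2 * ip ?KKh ?h + (k\<^sup>2)\<^sup>2 * (nrm ?h)\<^sup>2"
      using dst_scale_sq[OF V(3,1), of "k\<^sup>2"] by simp
    also have "ip ?KKh ?h = (nrm ?Kh)\<^sup>2"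
      using V K_sym[of ?Kh ?h] by (simp add: nrm_sq)
    also have "(nrm ?KKh)\<^sup>2 \<le> (k\<^sup>2)\<^sup>2"
    proof (rule power_mono)
      have "nrm ?KKh \<le> k * nrm ?Kh" using V k_upper by auto
      also have "\<dots> \<le> k * k" using k_pos k_upper1[of ?h] h by (intro mult_left_mono) auto
      finally show "nrm ?KKh \<le> k\<^sup>2" by (simp add: power2_eq_square)
    qed (use V in auto)
    also have "(k\<^sup>2)\<^sup>2 * (nrm ?h)\<^sup>2 \<le> (k\<^sup>2)\<^sup>2 * 1"
      using h(2)[of n] V by (intro mult_left_mono) (auto simp: power_le_one)
    finally show ?thesis by simp
  qed
  have KKh: "(\<lambda>n. dst (K (K (h n))) (\<lambda>x. k\<^sup>2 * h n x)) \<longlonglongrightarrow> 0"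
  proof -
    have "(\<lambda>n. 2 * k^4 - 2 * k\<^sup>2 * (nrm (K (h n)))\<^sup>2) \<longlonglongrightarrow> 2 * k^4 - 2 * k\<^sup>2 * k\<^sup>2"
      by (intro tendsto_intros nKh)
    moreover have "2 * k^4 - 2 * k\<^sup>2 * k\<^sup>2 = 0" by (simp add: power4_eq_xxxx power2_eq_square)
    ultimately have "(\<lambda>n. 2 * k^4 - 2 * k\<^sup>2 * (nrm (K (h n)))\<^sup>2) \<longlonglongrightarrow> 0" by simp
    then have "(\<lambda>n. (dst (K (K (h n))) (\<lambda>x. k\<^sup>2 * h n x))\<^sup>2) \<longlonglongrightarrow> 0"
      by (rule tendsto_0_le_real) (use sq in auto)
    then show ?thesis by simp
  qed
  have Kg: "K g \<in> V" and KKg: "K (K g) \<in> V" using g K_closed by auto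
  \<comment> \<open>Compactness controls \<open>K (h n)\<close> but not \<open>h n\<close>. Since
    \<open>K (K (h n))\<close> tends to \<open>K g\<close> and approaches
    \<open>k\<^sup>2 * h n\<close>, the latter converges too; one more application of
    \<open>K\<close> compares \<open>K (K g)\<close> with \<open>k\<^sup>2 * g\<close>.\<close>
  have "(\<lambda>n. dst (\<lambda>x. k\<^sup>2 * h n x) (K g)) \<longlonglongrightarrow> 0"
  proof (rule tendsto_0_le_real)
    have "(\<lambda>n. dst (K (K (h n))) (\<lambda>x. k\<^sup>2 * h n x) + dst (K (K (h n))) (K g)) \<longlonglongrightarrow> 0 + 0"
      by (intro tendsto_add KKh K_tendsto lim) (use h g K_closed in auto)
    then show "(\<lambda>n. dst (K (K (h n))) (\<lambda>x. k\<^sup>2 * h n x) + dst (K (K (h n))) (K g)) \<longlonglongrightarrow> 0" by simp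
    show "\<forall>\<^sub>F n in sequentially. 0 \<le> dst (\<lambda>x. k\<^sup>2 * h n x) (K g) \<and> dst (\<lambda>x. k\<^sup>2 * h n x) (K g)
        \<le> dst (K (K (h n))) (\<lambda>x. k\<^sup>2 * h n x) + dst (K (K (h n))) (K g)"
    proof (intro always_eventually allI conjI)
      fix n
      have V: "(\<lambda>x. k\<^sup>2 * h n x) \<in> V" "K (K (h n)) \<in> V"
        by (intro scale_closed K_closed h)+
      show "0 \<le> dst (\<lambda>x. k\<^sup>2 * h n x) (K g)" using V Kg by simp
      show "dst (\<lambda>x. k\<^sup>2 * h n x) (K g)
          \<le> dst (K (K (h n))) (\<lambda>x. k\<^sup>2 * h n x) + dst (K (K (h n))) (K g)"
        using dst_triangle[OF V Kg] by (simp add: dst_commute[OF V])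
    qed
  qed
  from K_tendsto[OF _ Kg this]
  have l1: "(\<lambda>n. dst (\<lambda>x. k\<^sup>2 * K (h n) x) (K (K g))) \<longlonglongrightarrow> 0"
    unfolding K_scale[OF h(1)] using scale_closed[OF h(1)] by blast
  have l2: "(\<lambda>n. dst (\<lambda>x. k\<^sup>2 * K (h n) x) (\<lambda>x. k\<^sup>2 * g x)) \<longlonglongrightarrow> 0"
  proof -
    have "dst (\<lambda>x. k\<^sup>2 * K (h n) x) (\<lambda>x. k\<^sup>2 * g x) = k\<^sup>2 * dst (K (h n)) g" for n
      using nrm_scale[of "\<lambda>x. K (h n) x - g x" "k\<^sup>2"] h g K_closed
      by (simp add: dst_def diff_closed right_diff_distrib)
    then show ?thesis using tendsto_mult_right_zero[OF lim, of "k\<^sup>2"] by (simp add: mult.commute)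
  qed
  have eig2: "dst (K (K g)) (\<lambda>x. k\<^sup>2 * g x) = 0"
  proof -
    have "(\<lambda>n. dst (\<lambda>x. k\<^sup>2 * K (h n) x) (K (K g)) + dst (\<lambda>x. k\<^sup>2 * K (h n) x) (\<lambda>x. k\<^sup>2 * g x)) \<longlonglongrightarrow> 0 + 0"
      by (intro tendsto_add l1 l2)
    then have "dst (K (K g)) (\<lambda>x. k\<^sup>2 * g x) \<le> 0 + 0"
    proof (rule LIMSEQ_le_const, intro exI[of _ 0] allI impI)
      fix n
      have V: "(\<lambda>x. k\<^sup>2 * K (h n) x) \<in> V" "(\<lambda>x. k\<^sup>2 * g x) \<in> V"
        by (intro scale_closed K_closed h g)+
      show "dst (K (K g)) (\<lambda>x. k\<^sup>2 * g x) \<le>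
          dst (\<lambda>x. k\<^sup>2 * K (h n) x) (K (K g)) + dst (\<lambda>x. k\<^sup>2 * K (h n) x) (\<lambda>x. k\<^sup>2 * g x)"
        using dst_triangle[OF KKg V] by (simp add: dst_commute[OF KKg V(1)])
    qed
    then show ?thesis using dst_nonneg[OF KKg scale_closed[OF g, of "k\<^sup>2"]] by linarith
  qed
  have main: "\<exists>e\<in>V. \<exists>l. l \<noteq> 0 \<and> nrm e = 1 \<and> dst (K e) (\<lambda>x. l * e x) = 0"
    if e: "e \<in> V" "nrm e \<noteq> 0" "dst (K e) (\<lambda>x. l * e x) = 0" "l \<noteq> 0" for e l
  proof (intro bexI exI conjI)
    define c where "c = 1 / nrm e"
    show "(\<lambda>x. c * e x) \<in> V" by (intro scale_closed e)
    show "nrm (\<lambda>x. c * e x) = 1" using nrm_scale[OF e(1), of c] e by (simp add: c_def)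
    have "dst (K (\<lambda>x. c * e x)) (\<lambda>x. l * (c * e x)) = nrm (\<lambda>x. c * (K e x - l * e x))"
      unfolding dst_def K_scale[OF e(1)] by (simp add: right_diff_distrib mult.left_commute)
    also have "\<dots> = \<bar>c\<bar> * dst (K e) (\<lambda>x. l * e x)"
      unfolding dst_def by (intro nrm_scale diff_closed K_closed scale_closed e)
    finally show "dst (K (\<lambda>x. c * e x)) (\<lambda>x. l * (c * e x)) = 0" using e by simp
  qed (use that in auto)
  show ?thesis
  \<comment> \<open>Factor the equation as (K - k)(K + k) g = 0: if (K + k) g is null, then
    \<open>g\<close> belongs to the eigenvalue \<open>- k\<close>; otherwise (K + k) g belongs to
    \<open>k\<close>.\<close>
  proof (cases "nrm (\<lambda>x. 1 * K g x + k * g x) = 0")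
    case True
    show ?thesis
    proof (rule main[OF g])
      show "dst (K g) (\<lambda>x. (- k) * g x) = 0" using True by (simp add: dst_def)
    qed (use nrm_g k_pos in auto)
  next
    case False
    show ?thesis
    proof (rule main[OF _ False])
      show "(\<lambda>x. 1 * K g x + k * g x) \<in> V" using Kg g lin_closed by blast
      have "dst (K (\<lambda>x. 1 * K g x + k * g x)) (\<lambda>x. k * (1 * K g x + k * g x))
          = dst (K (K g)) (\<lambda>x. k\<^sup>2 * g x)"
        unfolding dst_def K_lin[OF Kg g] by (simp add: algebra_simps power2_eq_square)
      then show "dst (K (\<lambda>x. 1 * K g x + k * g x)) (\<lambda>x. k * (1 * K g x + k * g x)) = 0"
        using eig2 by simp
    qed (use k_pos in auto)
  qed
qed

section \<open>Uniform boundedness and semigroups\<close>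

locale semi_hilbert = semi_inner_space V ip
  for V :: "('a \<Rightarrow> real) set" and ip +
  assumes complete: "(\<And>n::nat. f n \<in> V) \<Longrightarrow>
    (\<And>r. r > 0 \<Longrightarrow> \<exists>N. \<forall>m\<ge>N. \<forall>n\<ge>N. dst (f m) (f n) < r) \<Longrightarrow>
    \<exists>u\<in>V. (\<lambda>n. dst (f n) u) \<longlonglongrightarrow> 0"
begin

text \<open>This is the operator norm: the infimum of the admissible constants is itself admissible,
  so every smaller constant fails at some vector.\<close>

lemma least_bound:
  assumes "\<And>u. u \<in> V \<Longrightarrow> nrm (T u) \<le> M * nrm u" "0 \<le> M"
  obtains N where "0 \<le> N" "\<And>u. u \<in> V \<Longrightarrow> nrm (T u) \<le> N * nrm u"
    "\<And>c. c \<ge> 0 \<Longrightarrow> c < N \<Longrightarrow> \<exists>u\<in>V. c * nrm u < nrm (T u)"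
proof -
  define B where "B = {c. c \<ge> 0 \<and> (\<forall>u\<in>V. nrm (T u) \<le> c * nrm u)}"
  have ne: "B \<noteq> {}" using assms by (auto simp: B_def)
  have bdd: "bdd_below B" by (rule bdd_belowI[of _ 0]) (auto simp: B_def)
  show thesis
  proof (rule that[of "Inf B"])
    show "0 \<le> Inf B" by (rule cInf_greatest[OF ne]) (auto simp: B_def)
    show "nrm (T u) \<le> Inf B * nrm u" if u: "u \<in> V" for u
    proof (cases "nrm u = 0")
      case True then show ?thesis using assms(1)[OF u] by simp
    next
      case False
      then have p: "nrm u > 0" using u by (simp add: less_le)
      have "nrm (T u) / nrm u \<le> Inf B"
        using u p by (intro cInf_greatest[OF ne]) (auto simp: B_def divide_le_eq)
      then show ?thesis using p by (simp add: divide_le_eq)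
    qed
    show "\<exists>u\<in>V. c * nrm u < nrm (T u)" if "c \<ge> 0" "c < Inf B" for c
    proof (rule ccontr)
      assume "\<not> ?thesis"
      then have "c \<in> B" using that by (auto simp: B_def not_less)
      then show False using cInf_lower[OF _ bdd, of c] that by simp
    qed
  qed
qed

text \<open>Sokal's proof of the uniform boundedness principle: one of \<open>x + \<xi>\<close>, \<open>x - \<xi>\<close> has an image at
  least as large as that of \<open>\<xi>\<close>.\<close>

lemma uniform_boundedness:
  fixes T :: "nat \<Rightarrow> ('a \<Rightarrow> real) \<Rightarrow> ('a \<Rightarrow> real)"
  assumes T_closed: "\<And>n u. u \<in> V \<Longrightarrow> T n u \<in> V"
    and T_lin: "\<And>n u v a b. u \<in> V \<Longrightarrow> v \<in> V \<Longrightarrow>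
      dst (T n (\<lambda>x. a * u x + b * v x)) (\<lambda>x. a * T n u x + b * T n v x) = 0"
    and T_bdd: "\<And>n. \<exists>M. \<forall>u\<in>V. nrm (T n u) \<le> M * nrm u"
    and pointwise: "\<And>u. u \<in> V \<Longrightarrow> \<exists>B. \<forall>n. nrm (T n u) \<le> B"
  shows "\<exists>M. \<forall>n. \<forall>u\<in>V. nrm (T n u) \<le> M * nrm u"
proof (rule ccontr)
  assume contra: "\<not> ?thesis"
  have nrm_lin: "nrm (T n (\<lambda>x. a * u x + b * v x)) = nrm (\<lambda>x. a * T n u x + b * T n v x)"
    if "u \<in> V" "v \<in> V" for n u v a b
    using nrm_dst[of "T n (\<lambda>x. a * u x + b * v x)" "\<lambda>x. a * T n u x + b * T n v x"]
      T_lin[OF that] that by (simp add: T_closed lin_closed)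
  have "\<exists>N\<ge>0. (\<forall>u\<in>V. nrm (T n u) \<le> N * nrm u) \<and> (\<forall>c\<ge>0. c < N \<longrightarrow> (\<exists>u\<in>V. c * nrm u < nrm (T n u)))" for n
  proof -
    obtain M where M: "\<forall>u\<in>V. nrm (T n u) \<le> M * nrm u" using T_bdd by blast
    have "nrm (T n u) \<le> \<bar>M\<bar> * nrm u" if "u \<in> V" for u
    proof -
      have "nrm (T n u) \<le> M * nrm u" using M that by blast
      also have "\<dots> \<le> \<bar>M\<bar> * nrm u" using that by (intro mult_right_mono) auto
      finally show ?thesis .
    qed
    from least_bound[OF this] show ?thesis by (metis abs_ge_zero)
  qed
  then obtain N where N0: "\<And>n. N n \<ge> 0" and N: "\<And>n u. u \<in> V \<Longrightarrow> nrm (T n u) \<le> N n * nrm u"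
    and N_least: "\<And>n c. c \<ge> 0 \<Longrightarrow> c < N n \<Longrightarrow> \<exists>u\<in>V. c * nrm u < nrm (T n u)"
    by metis
  have "\<exists>n. 4 ^ k \<le> N n" for k :: nat
  proof (rule ccontr)
    assume "\<nexists>n. 4 ^ k \<le> N n"
    then have "nrm (T n u) \<le> 4 ^ k * nrm u" if "u \<in> V" for n u
      using N[OF that, of n] that mult_right_mono[of "N n" "4 ^ k" "nrm u"]
      by (meson linorder_not_less nrm_nonneg order_less_imp_le order_trans)
    then show False using contra by blast
  qed
  then obtain m where m: "\<And>k. 4 ^ k \<le> N (m k)" by metis
  have N_pos: "N (m k) > 0" for k
    using m[of k] by (smt (verit) zero_less_power)
  \<comment> \<open>A vector on which \<open>T (m k)\<close> reaches two thirds of its norm,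
    rescaled to length \<open>(1/3)^k\<close>, is the perturbation; two thirds is any fraction below
    1 that still beats the later loss of one half.\<close>
  have step: "\<exists>y\<in>V. dst y x \<le> (1/3)^k \<and> 2/3 * N (m k) * (1/3)^k \<le> nrm (T (m k) y)"
    if x: "x \<in> V" for x k
  proof -
    obtain u where u: "u \<in> V" "2/3 * N (m k) * nrm u < nrm (T (m k) u)"
      using N_least[of "2/3 * N (m k)" "m k"] N_pos[of k] by auto
    then have "nrm u \<noteq> 0" using N[OF u(1), of "m k"] by auto
    then have nu: "nrm u > 0" using u(1) by (simp add: less_le)
    define a where "a = (1/3)^k / nrm u"
    have a: "a > 0" "a * nrm u = (1/3)^k" using nu by (auto simp: a_def)
    define yp where "yp = (\<lambda>z. 1 * x z + a * u z)"
    define ym where "ym = (\<lambda>z. 1 * x z + (- a) * u z)"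
    have y: "yp \<in> V" "ym \<in> V" unfolding yp_def ym_def using x u lin_closed by blast+
    have d: "dst yp x = (1/3)^k" "dst ym x = (1/3)^k"
      using nrm_scale[OF u(1), of a] nrm_scale[OF u(1), of "- a"] a
      by (auto simp: dst_def yp_def ym_def)
    let ?T = "T (m k)"
    have "2 * a * nrm (?T u) = nrm (\<lambda>z. (2 * a) * ?T u z)"
      using a nrm_scale[OF T_closed[OF u(1)], of "2 * a"] by simp
    also have "(\<lambda>z. (2 * a) * ?T u z) =
        (\<lambda>z. (1 * ?T x z + a * ?T u z) - (1 * ?T x z + (- a) * ?T u z))" by auto
    also have "nrm \<dots> \<le> nrm (\<lambda>z. 1 * ?T x z + a * ?T u z) + nrm (\<lambda>z. 1 * ?T x z + (- a) * ?T u z)"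
    proof -
      have p: "(\<lambda>z. 1 * ?T x z + a * ?T u z) \<in> V" and q: "(\<lambda>z. 1 * ?T x z + (- a) * ?T u z) \<in> V"
        using x u T_closed lin_closed by blast+
      show ?thesis
        using dst_triangle[OF p zero_closed q] dst_commute[OF q zero_closed] dst_zero
        unfolding dst_def by simp
    qed
    also have "\<dots> = nrm (?T yp) + nrm (?T ym)"
      unfolding yp_def ym_def nrm_lin[OF x u(1)] ..
    finally have "a * nrm (?T u) \<le> nrm (?T yp) \<or> a * nrm (?T u) \<le> nrm (?T ym)" by linarith
    moreover have "2/3 * N (m k) * (1/3)^k \<le> a * nrm (?T u)"
    proof -
      have "2/3 * N (m k) * (1/3)^k = a * (2/3 * N (m k) * nrm u)" by (simp flip: a(2))
      also have "\<dots> \<le> a * nrm (?T u)" using u(2) a by (intro mult_left_mono) auto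
      finally show ?thesis .
    qed
    ultimately show ?thesis using y d by force
  qed
  define nx where "nx k x = (SOME y. y \<in> V \<and> dst y x \<le> (1/3)^k \<and> 2/3 * N (m k) * (1/3)^k \<le> nrm (T (m k) y))"
    for k x
  have nx: "nx k x \<in> V \<and> dst (nx k x) x \<le> (1/3)^k \<and> 2/3 * N (m k) * (1/3)^k \<le> nrm (T (m k) (nx k x))"
    if "x \<in> V" for x k
  proof -
    have "\<exists>y. y \<in> V \<and> dst y x \<le> (1/3)^k \<and> 2/3 * N (m k) * (1/3)^k \<le> nrm (T (m k) y)"
      using step[OF that, of k] by blast
    from someI_ex[OF this] show ?thesis by (simp only: nx_def)
  qed
  define X where "X = rec_nat (\<lambda>_. 0) nx"
  have X_Suc: "X (Suc k) = nx k (X k)" for k by (simp add: X_def)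
  have XV: "X k \<in> V" for k
    by (induction k) (use nx zero_closed in \<open>auto simp: X_def\<close>)
  have tail: "dst (X (k + j)) (X k) \<le> 3/2 * (1/3)^k * (1 - (1/3)^j)" for k j
  proof (induction j)
    case (Suc j)
    have "dst (X (k + Suc j)) (X k) \<le> dst (X (Suc (k + j))) (X (k + j)) + dst (X (k + j)) (X k)"
      using dst_triangle[OF XV XV XV] by simp
    also have "\<dots> \<le> (1/3)^(k + j) + 3/2 * (1/3)^k * (1 - (1/3)^j)"
      using Suc nx[OF XV, of "k + j" "k + j"] by (intro add_mono) (auto simp: X_Suc)
    also have "\<dots> = 3/2 * (1/3)^k * (1 - (1/3)^Suc j)" by (simp add: power_add field_simps)
    finally show ?case .
  qed simp
  have tail': "dst (X l) (X k) \<le> 3/2 * (1/3)^k" if "l \<ge> k" for k l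
  proof -
    have "dst (X l) (X k) \<le> 3/2 * (1/3)^k * (1 - (1/3)^(l - k))"
      using tail[of k "l - k"] that by simp
    also have "\<dots> \<le> 3/2 * (1/3)^k * 1" by (intro mult_left_mono) auto
    finally show ?thesis by simp
  qed
  have "\<exists>x\<in>V. (\<lambda>n. dst (X n) x) \<longlonglongrightarrow> 0"
  proof (rule complete[OF XV])
    fix r :: real assume "r > 0"
    have "(\<lambda>k. 3 * (1/3::real)^k) \<longlonglongrightarrow> 0"
      by (intro tendsto_mult_right_zero LIMSEQ_power_zero) simp
    then have "\<forall>\<^sub>F k in sequentially. 3 * (1/3::real)^k < r"
      using \<open>r > 0\<close> by (rule order_tendstoD)
    then obtain k where k: "3 * (1/3::real)^k < r" by (auto simp: eventually_sequentially)
    have "dst (X i) (X j) < r" if "i \<ge> k" "j \<ge> k" for i j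
      using dst_triangle[OF XV[of i] XV[of k] XV[of j]] tail'[OF that(1)] tail'[OF that(2)] k
        dst_commute[OF XV[of j] XV[of k]] by linarith
    then show "\<exists>N. \<forall>i\<ge>N. \<forall>j\<ge>N. dst (X i) (X j) < r" by blast
  qed
  then obtain x where x: "x \<in> V" and lim: "(\<lambda>n. dst (X n) x) \<longlonglongrightarrow> 0" by blast
  have close: "dst x (X k) \<le> 3/2 * (1/3)^k" for k
  proof -
    have "(\<lambda>n. dst (X n) x + 3/2 * (1/3)^k) \<longlonglongrightarrow> 0 + 3/2 * (1/3)^k"
      by (intro tendsto_intros lim)
    then have "dst x (X k) \<le> 0 + 3/2 * (1/3)^k"
    proof (rule LIMSEQ_le_const, intro exI[of _ k] allI impI)
      fix n assume "n \<ge> k"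
      then show "dst x (X k) \<le> dst (X n) x + 3/2 * (1/3)^k"
        using dst_triangle[OF x XV[of n] XV[of k]] tail'[of k n] dst_commute[OF x XV[of n]] by simp
    qed
    then show ?thesis by simp
  qed
  obtain B where B: "\<And>n. nrm (T n x) \<le> B" using pointwise[OF x] by blast
  \<comment> \<open>At step \<open>k\<close> the image gains \<open>2/3 * N (m k) * (1/3)^k\<close>,
    and all later steps together lose at most \<open>1/2 * N (m k) * (1/3)^k\<close>. The remaining
    sixth grows since \<open>N (m k) \<ge> 4 ^ k\<close> outweighs \<open>3 ^ k\<close>.\<close>
  have grow: "1/6 * (4/3)^k \<le> B" for k :: nat
  proof -
    let ?T = "T (m k)" and ?y = "X (Suc k)"
    have "2/3 * N (m k) * (1/3)^k \<le> nrm (?T ?y)" using nx[OF XV, of k k] by (simp add: X_Suc)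
    also have "\<dots> \<le> nrm (?T x) + dst (?T ?y) (?T x)"
      using nrm_dst[OF T_closed[OF XV] T_closed[OF x], of "m k" "Suc k" "m k"] by simp
    also have "dst (?T ?y) (?T x) = nrm (?T (\<lambda>z. 1 * ?y z + (- 1) * x z))"
      unfolding nrm_lin[OF XV x] by (simp add: dst_def)
    also have "\<dots> \<le> N (m k) * dst ?y x"
      using N[OF lin_closed[OF XV x], of "m k" 1 "Suc k" "-1"] by (simp add: dst_def)
    also have "\<dots> \<le> N (m k) * (3/2 * (1/3)^Suc k)"
      using close[of "Suc k"] N0 dst_commute[OF x XV] by (intro mult_left_mono) auto
    finally have "1/6 * (N (m k) * (1/3)^k) \<le> nrm (?T x)" by simp
    then have "1/6 * (N (m k) * (1/3)^k) \<le> B" using B[of "m k"] by linarith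
    moreover have "1/6 * ((4::real)^k * (1/3)^k) \<le> 1/6 * (N (m k) * (1/3)^k)"
      using m[of k] by (intro mult_left_mono mult_right_mono) auto
    moreover have "(4::real)^k * (1/3)^k = (4/3)^k" by (simp add: power_mult_distrib[symmetric])
    ultimately show ?thesis by linarith
  qed
  obtain k where "6 * B < (4/3::real)^k" using real_arch_pow[of "4/3" "6 * B"] by auto
  then show False using grow[of k] by simp
qed

end

section \<open>Strongly continuous semigroups up to null distance\<close>

locale c0_semigroup_space = semi_hilbert V ip
  for V :: "('a \<Rightarrow> real) set" and ip +
  fixes S :: "real \<Rightarrow> ('a \<Rightarrow> real) \<Rightarrow> ('a \<Rightarrow> real)"
  assumes S_closed: "t \<ge> 0 \<Longrightarrow> u \<in> V \<Longrightarrow> S t u \<in> V"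
    and S_lin: "t \<ge> 0 \<Longrightarrow> u \<in> V \<Longrightarrow> v \<in> V \<Longrightarrow>
      dst (S t (\<lambda>x. a * u x + b * v x)) (\<lambda>x. a * S t u x + b * S t v x) = 0"
    and S_bdd: "t \<ge> 0 \<Longrightarrow> \<exists>M. \<forall>u\<in>V. nrm (S t u) \<le> M * nrm u"
    and S_zero: "u \<in> V \<Longrightarrow> dst (S 0 u) u = 0"
    and S_add: "s \<ge> 0 \<Longrightarrow> t \<ge> 0 \<Longrightarrow> u \<in> V \<Longrightarrow> dst (S (s + t) u) (S s (S t u)) = 0"
    and S_cont: "u \<in> V \<Longrightarrow> ((\<lambda>t. dst (S t u) u) \<longlongrightarrow> 0) (at_right 0)"
begin

text \<open>Operator bounds are assumed at each time separately. If they were not uniform near 0,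
  there would be times tending to 0 with unbounded operator norms; right continuity at 0 makes these
  operators pointwise bounded, contradicting uniform boundedness.\<close>

lemma local_bound:
  obtains \<delta> M where "\<delta> > 0" "M \<ge> 0" "\<And>t u. 0 \<le> t \<Longrightarrow> t \<le> \<delta> \<Longrightarrow> u \<in> V \<Longrightarrow> nrm (S t u) \<le> M * nrm u"
proof -
  have "\<exists>n::nat. \<forall>t u. 0 \<le> t \<longrightarrow> t \<le> 1 / Suc n \<longrightarrow> u \<in> V \<longrightarrow> nrm (S t u) \<le> n * nrm u"
  proof (rule ccontr)
    assume "\<not> ?thesis"
    then obtain t v where t: "\<And>n::nat. 0 \<le> t n" "\<And>n. t n \<le> 1 / Suc n" and v: "\<And>n. v n \<in> V"
      and big: "\<And>n. n * nrm (v n) < nrm (S (t n) (v n))"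
      unfolding not_ex not_all not_imp not_le by metis
    have "\<exists>M. \<forall>n. \<forall>u\<in>V. nrm (S (t n) u) \<le> M * nrm u"
    proof (rule uniform_boundedness)
      fix u assume u: "u \<in> V"
      have "\<forall>\<^sub>F s in at_right 0. dst (S s u) u < 1"
        using order_tendstoD(2)[OF S_cont[OF u], of 1] by simp
      then obtain d where d: "d > 0" "\<And>s. 0 < s \<Longrightarrow> s < d \<Longrightarrow> dst (S s u) u < 1"
        unfolding eventually_at_right_field by auto
      obtain K where K: "1 / real (Suc K) < d"
        using reals_Archimedean[OF d(1)] by (auto simp: inverse_eq_divide)
      \<comment> \<open>The sum takes care of the finitely many indices below \<open>K\<close>; for
        the others \<open>S (t n) u\<close> lies within distance 1 of \<open>u\<close>.\<close>
      have "nrm (S (t n) u) \<le> nrm u + 1 + (\<Sum>k<K. nrm (S (t k) u))" for n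
      proof (cases "n < K")
        case True
        have "nrm (S (t n) u) \<le> (\<Sum>k<K. nrm (S (t k) u))"
          using True t u by (intro member_le_sum) (auto simp: S_closed)
        then show ?thesis using nrm_nonneg[OF u] by simp
      next
        case False
        have "dst (S (t n) u) u \<le> 1"
        \<comment> \<open>A limit along \<open>at_right 0\<close> says nothing about time 0
          itself.\<close>
        proof (cases "t n = 0")
          case True then show ?thesis using S_zero[OF u] by simp
        next
          case ne: False
          have "1 / real (Suc n) \<le> 1 / real (Suc K)" using False by (intro divide_left_mono) auto
          then have "t n < d" using t(2)[of n] K by linarith
          then show ?thesis using d(2)[of "t n"] t(1)[of n] ne by force
        qed
        moreover have "0 \<le> (\<Sum>k<K. nrm (S (t k) u))" using t u by (intro sum_nonneg) (auto simp: S_closed)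
        ultimately show ?thesis
          using nrm_dst[OF S_closed[OF t(1) u] u, of n] by linarith
      qed
      then show "\<exists>B. \<forall>n. nrm (S (t n) u) \<le> B" by blast
    qed (use t S_closed S_lin S_bdd in auto)
    then obtain M where M: "\<And>n u. u \<in> V \<Longrightarrow> nrm (S (t n) u) \<le> M * nrm u" by blast
    obtain n :: nat where n: "M < n" using reals_Archimedean2 by blast
    have "n * nrm (v n) < M * nrm (v n)" using big[of n] M[OF v, of n n] by linarith
    then show False using n nrm_nonneg[OF v, of n] mult_right_mono[of M n "nrm (v n)"] by linarith
  qed
  then obtain n :: nat where "\<And>t u. 0 \<le> t \<Longrightarrow> t \<le> 1 / Suc n \<Longrightarrow> u \<in> V \<Longrightarrow> nrm (S t u) \<le> n * nrm u"
    by blast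
  then show thesis by (intro that[of "1 / Suc n" n]) auto
qed

lemma S_scale: "t \<ge> 0 \<Longrightarrow> u \<in> V \<Longrightarrow> dst (S t (\<lambda>x. a * u x)) (\<lambda>x. a * S t u x) = 0"
  using S_lin[of t u u a 0] by simp

lemma S_dst:
  assumes t: "t \<ge> 0" and M: "\<And>u. u \<in> V \<Longrightarrow> nrm (S t u) \<le> M * nrm u" and u: "u \<in> V" and v: "v \<in> V"
  shows "dst (S t u) (S t v) \<le> M * dst u v"
proof -
  have "dst (S t (\<lambda>x. 1 * u x + (-1) * v x)) (\<lambda>x. 1 * S t u x + (-1) * S t v x) = 0"
    by (rule S_lin[OF t u v])
  then have "nrm (S t (\<lambda>x. u x - v x)) = dst (S t u) (S t v)"
    using nrm_dst[of "S t (\<lambda>x. u x - v x)" "\<lambda>x. S t u x - S t v x"] t u v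
    by (simp add: S_closed diff_closed dst_def)
  then show ?thesis using M[OF diff_closed[OF u v]] by (simp add: dst_def)
qed

text \<open>Writing d t for the distance between the orbit at time \<open>t\<close> and its expected
  value, this is d (t + s) \<le> M * d s + \<open>exp (- \<mu> * s)\<close> * d t. The intermediate
  point is \<open>S t\<close> applied to the expected value at time \<open>s\<close>, so only the
  bound of \<open>S t\<close> occurs.\<close>

lemma exp_orbit_step:
  assumes t: "t \<ge> 0" and s: "s \<ge> 0" and e: "e \<in> V"
    and M: "\<And>u. u \<in> V \<Longrightarrow> nrm (S t u) \<le> M * nrm u"
  shows "dst (S (t + s) e) (\<lambda>x. exp (- \<mu> * (t + s)) * e x)
    \<le> M * dst (S s e) (\<lambda>x. exp (- \<mu> * s) * e x) + exp (- \<mu> * s) * dst (S t e) (\<lambda>x. exp (- \<mu> * t) * e x)"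
proof -
  let ?q = "\<lambda>x. exp (- \<mu> * s) * e x" and ?z = "\<lambda>x. exp (- \<mu> * (t + s)) * e x"
  have V: "S (t + s) e \<in> V" "S t (S s e) \<in> V" "S s e \<in> V" "?q \<in> V" "S t ?q \<in> V" "?z \<in> V"
    "(\<lambda>x. exp (- \<mu> * s) * S t e x) \<in> V" "S t e \<in> V" "(\<lambda>x. exp (- \<mu> * t) * e x) \<in> V"
    using t s e by (auto intro!: S_closed scale_closed)
  have "dst (S (t + s) e) ?z \<le> dst (S (t + s) e) (S t (S s e)) + dst (S t (S s e)) ?z"
    using V by (intro dst_triangle)
  also have "dst (S (t + s) e) (S t (S s e)) = 0" by (rule S_add[OF t s e])
  also have "dst (S t (S s e)) ?z \<le> dst (S t (S s e)) (S t ?q) + dst (S t ?q) ?z"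
    using V by (intro dst_triangle)
  also have "dst (S t (S s e)) (S t ?q) \<le> M * dst (S s e) ?q"
    by (rule S_dst[OF t M V(3,4)])
  also have "dst (S t ?q) ?z \<le> dst (S t ?q) (\<lambda>x. exp (- \<mu> * s) * S t e x) + dst (\<lambda>x. exp (- \<mu> * s) * S t e x) ?z"
    using V by (intro dst_triangle)
  also have "dst (S t ?q) (\<lambda>x. exp (- \<mu> * s) * S t e x) = 0" by (rule S_scale[OF t e])
  also have "dst (\<lambda>x. exp (- \<mu> * s) * S t e x) ?z
      = nrm (\<lambda>x. exp (- \<mu> * s) * (S t e x - exp (- \<mu> * t) * e x))"
  proof -
    have "exp (- \<mu> * (t + s)) = exp (- \<mu> * s) * exp (- \<mu> * t)"
      by (simp add: mult_exp_exp algebra_simps)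
    then show ?thesis by (simp add: dst_def right_diff_distrib mult.assoc)
  qed
  also have "\<dots> = exp (- \<mu> * s) * dst (S t e) (\<lambda>x. exp (- \<mu> * t) * e x)"
    unfolding dst_def by (subst nrm_scale) (use V diff_closed in auto)
  finally show ?thesis by simp
qed

text \<open>Only a right derivative is available at each time; the uniform bound on \<open>[0, \<delta>]\<close> is what
  excludes jumps from the left.\<close>

lemma eigenvector_orbit:
  assumes e: "e \<in> V" and \<mu>: "\<mu> \<ge> 0" and t: "t \<ge> 0"
    and lim: "((\<lambda>h. nrm (\<lambda>x. (S h e x - e x) / h - (- \<mu> * e x))) \<longlongrightarrow> 0) (at_right 0)"
  shows "dst (S t e) (\<lambda>x. exp (- \<mu> * t) * e x) = 0"
proof -
  define d where "d t = dst (S t e) (\<lambda>x. exp (- \<mu> * t) * e x)" for t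
  have d_nonneg: "0 \<le> d t" if "t \<ge> 0" for t
    unfolding d_def using that e by (intro dst_nonneg S_closed scale_closed)
  obtain \<delta> M where \<delta>: "\<delta> > 0" and M: "M \<ge> 0"
    and bound: "\<And>t u. 0 \<le> t \<Longrightarrow> t \<le> \<delta> \<Longrightarrow> u \<in> V \<Longrightarrow> nrm (S t u) \<le> M * nrm u"
    using local_bound by blast
  have d0: "d 0 = 0" unfolding d_def using S_zero[OF e] by simp
  \<comment> \<open>The orbit and the exponential have the same right derivative at 0, so their
    distance is of smaller order than \<open>s\<close>.\<close>
  have rate: "((\<lambda>s. d s / s) \<longlongrightarrow> 0) (at_right 0)"
  proof (rule tendsto_0_le_real)
    let ?r = "\<lambda>s. nrm (\<lambda>x. (S s e x - e x) / s - (- \<mu> * e x))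
      + \<bar>(exp (- \<mu> * s) - exp (- \<mu> * 0)) / (s - 0) - (- \<mu>)\<bar> * nrm e"
    have "((\<lambda>s. (exp (- \<mu> * s) - exp (- \<mu> * 0)) / (s - 0)) \<longlongrightarrow> - \<mu>) (at_right 0)"
      using exp_quotient_tendsto[of \<mu>] by simp
    then have "((\<lambda>s. \<bar>(exp (- \<mu> * s) - exp (- \<mu> * 0)) / (s - 0) - (- \<mu>)\<bar> * nrm e) \<longlongrightarrow> 0) (at_right 0)"
      by (intro tendsto_mult_left_zero tendsto_rabs_zero LIM_zero)
    from tendsto_add[OF lim this] show "(?r \<longlongrightarrow> 0) (at_right 0)" by simp
    show "\<forall>\<^sub>F s in at_right 0. 0 \<le> d s / s \<and> d s / s \<le> ?r s"
    proof (rule eventually_at_right_less[THEN eventually_mono], intro conjI)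
      fix s :: real assume s: "0 < s"
      show "0 \<le> d s / s" using d_nonneg s by simp
      define c where "c = (1 - exp (- \<mu> * s)) / s - \<mu>"
      define f where "f = (\<lambda>x. (1 / s) * S s e x + (- (1 / s) + \<mu>) * e x)"
      have SV: "S s e \<in> V" using s e S_closed by simp
      have f: "f \<in> V" unfolding f_def using SV e lin_closed by blast
      have ce: "(\<lambda>x. c * e x) \<in> V" using e by (rule scale_closed)
      have "d s / s = nrm (\<lambda>x. (1 / s) * (S s e x - exp (- \<mu> * s) * e x))"
        unfolding d_def dst_def using s SV e scale_closed[OF e]
        by (subst nrm_scale) (auto intro!: diff_closed)
      also have "(\<lambda>x. (1 / s) * (S s e x - exp (- \<mu> * s) * e x)) = (\<lambda>x. f x + c * e x)"
        using s by (auto simp: f_def c_def field_simps)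
      also have "nrm \<dots> \<le> nrm f + nrm (\<lambda>x. c * e x)" by (rule nrm_add[OF f ce])
      also have "nrm (\<lambda>x. c * e x) = \<bar>c\<bar> * nrm e" by (rule nrm_scale[OF e])
      also have "\<bar>c\<bar> = \<bar>(exp (- \<mu> * s) - exp (- \<mu> * 0)) / (s - 0) - (- \<mu>)\<bar>"
      proof -
        have "(exp (- \<mu> * s) - exp (- \<mu> * 0)) / (s - 0) - (- \<mu>) = - c"
          using s by (simp add: c_def field_simps)
        then show ?thesis by simp
      qed
      also have "f = (\<lambda>x. (S s e x - e x) / s - (- \<mu> * e x))"
        using s by (auto simp: f_def field_simps)
      finally show "d s / s \<le> ?r s" .
    qed
  qed
  \<comment> \<open>The long time \<open>k * s\<close> is placed where the operator bound applies,
    so \<open>M\<close> multiplies only the one-step error and does not compound; the accumulated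
    error gets a factor at most 1.\<close>
  have iter: "d (k * s) \<le> k * (M * d s)" if s: "s \<ge> 0" "k * s \<le> \<delta>" for k :: nat and s :: real
    using that(2)
  proof (induction k)
    case (Suc k)
    have ks: "k * s \<le> \<delta>" "0 \<le> k * s" using Suc.prems s(1) by (auto simp: algebra_simps)
    have "d (k * s + s) \<le> M * d s + exp (- \<mu> * s) * d (k * s)"
      unfolding d_def by (rule exp_orbit_step[OF ks(2) s(1) e bound[OF ks(2,1)]])
    also have "exp (- \<mu> * s) * d (k * s) \<le> 1 * d (k * s)"
      using \<mu> s ks d_nonneg by (intro mult_right_mono) auto
    also have "d (k * s) \<le> k * (M * d s)" using Suc.IH ks by blast
    finally show ?case by (simp add: algebra_simps)
  qed (simp add: d0)
  have small: "d t = 0" if t: "0 \<le> t" "t \<le> \<delta>" for t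
  proof (cases "t = 0")
    case False
    then have tp: "t > 0" using t by simp
    have "filterlim (\<lambda>n. t / Suc n) (at_right 0) sequentially"
    proof -
      have "(\<lambda>n. t / Suc n) \<longlonglongrightarrow> 0" by (rule LIMSEQ_Suc[OF lim_const_over_n])
      then show ?thesis using tp by (intro tendsto_imp_filterlim_at_right) auto
    qed
    from filterlim_compose[OF rate this]
    have "(\<lambda>n. M * t * (d (t / Suc n) / (t / Suc n))) \<longlonglongrightarrow> 0"
      by (intro tendsto_mult_right_zero)
    \<comment> \<open>Cutting \<open>t\<close> into \<open>Suc n\<close> equal steps gives total
      error at most \<open>M * t\<close> times the error per unit time of one step, which tends to
      0.\<close>
    then have "d t \<le> 0"
    proof (rule LIMSEQ_le_const, intro exI[of _ 0] allI impI)
      fix n :: nat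
      define q where "q = real (Suc n)"
      have q: "q > 0" by (simp add: q_def)
      have "d t = d (q * (t / q))" using q by simp
      also have "\<dots> \<le> q * (M * d (t / q))"
        unfolding q_def using t by (intro iter) auto
      also have "\<dots> = M * t * (d (t / q) / (t / q))" using tp q by (simp add: field_simps)
      finally show "d t \<le> M * t * (d (t / Suc n) / (t / Suc n))" by (simp only: q_def)
    qed
    then show ?thesis using d_nonneg t by force
  qed (simp add: d0)
  obtain n :: nat where n: "t / \<delta> < n" using reals_Archimedean2 by blast
  have np: "n > 0" using n t \<delta> by (metis divide_nonneg_pos gr0I leD of_nat_0)
  define s where "s = t / n"
  have s: "0 \<le> s" "s \<le> \<delta>" using n np t \<delta> by (auto simp: s_def field_simps)
  \<comment> \<open>Beyond \<delta> the error of a single step is already exactly 0, so any bound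
    for \<open>S (k * s)\<close> at this one time will do.\<close>
  have "d (k * s) = 0" for k :: nat
  proof (induction k)
    case (Suc k)
    have ks: "0 \<le> k * s" using s by simp
    obtain M' where M': "\<And>u. u \<in> V \<Longrightarrow> nrm (S (k * s) u) \<le> M' * nrm u" using S_bdd[OF ks] by blast
    have "d (k * s + s) \<le> M' * d s + exp (- \<mu> * s) * d (k * s)"
      unfolding d_def by (rule exp_orbit_step[OF ks s(1) e M'])
    then have "d (k * s + s) \<le> 0" using small[OF s] Suc.IH by simp
    then have "d (k * s + s) = 0" using d_nonneg[of "k * s + s"] ks s by simp
    then show ?case by (simp add: algebra_simps)
  qed (simp add: d0)
  from this[of n] show ?thesis using np by (simp add: d_def s_def)
qed

end

section \<open>Diagonal semigroups\<close>

locale orthonormal_basis = semi_hilbert V ip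
  for V :: "('a \<Rightarrow> real) set" and ip +
  fixes b :: "nat \<Rightarrow> 'a \<Rightarrow> real"
  assumes b_closed [simp]: "b n \<in> V"
    and b_orthonormal: "ip (b m) (b n) = of_bool (m = n)"
    and b_total: "u \<in> V \<Longrightarrow> (\<And>n. ip u (b n) = 0) \<Longrightarrow> nrm u = 0"
begin

abbreviation coef :: "('a \<Rightarrow> real) \<Rightarrow> nat \<Rightarrow> real" where
  "coef u n \<equiv> ip u (b n)"

definition psum :: "(nat \<Rightarrow> real) \<Rightarrow> nat \<Rightarrow> 'a \<Rightarrow> real" where
  "psum c N = (\<lambda>x. \<Sum>i<N. c i * b i x)"

lemma psum_closed [simp]: "psum c N \<in> V"
  unfolding psum_def by (rule sum_closed) simp

lemma coef_sum: "finite J \<Longrightarrow> coef (\<lambda>x. \<Sum>i\<in>J. c i * b i x) n = (if n \<in> J then c n else 0)"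
  by (subst ip_sum_left) (auto simp: b_orthonormal of_bool_def if_distrib sum.delta cong: if_cong)

lemma nrm_sum: "finite J \<Longrightarrow> (nrm (\<lambda>x. \<Sum>i\<in>J. c i * b i x))\<^sup>2 = (\<Sum>i\<in>J. (c i)\<^sup>2)"
  by (subst nrm_sq, simp add: sum_closed, subst ip_sum_right)
    (auto simp: sum_closed coef_sum power2_eq_square)

lemma coef_psum: "coef (psum c N) n = (if n < N then c n else 0)"
  unfolding psum_def by (simp add: coef_sum)

lemma nrm_psum: "(nrm (psum c N))\<^sup>2 = (\<Sum>i<N. (c i)\<^sup>2)"
  unfolding psum_def by (rule nrm_sum) simp

lemma dst_psum: "M \<le> N \<Longrightarrow> (dst (psum c N) (psum c M))\<^sup>2 = (\<Sum>i=M..<N. (c i)\<^sup>2)"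
proof -
  assume "M \<le> N"
  have "(\<lambda>x. psum c N x - psum c M x) = (\<lambda>x. \<Sum>i=M..<N. c i * b i x)"
  proof
    fix x
    show "psum c N x - psum c M x = (\<Sum>i=M..<N. c i * b i x)"
      using sum.atLeastLessThan_concat[of 0 M N "\<lambda>i. c i * b i x"] \<open>M \<le> N\<close>
      by (simp add: psum_def lessThan_atLeast0)
  qed
  then show ?thesis by (simp add: dst_def nrm_sum)
qed

lemma coef_null: "u \<in> V \<Longrightarrow> v \<in> V \<Longrightarrow> dst u v = 0 \<Longrightarrow> coef u n = coef v n"
  by (rule ip_null) auto

lemma dst_coef: "u \<in> V \<Longrightarrow> v \<in> V \<Longrightarrow> (\<And>n. coef u n = coef v n) \<Longrightarrow> dst u v = 0"
  unfolding dst_def by (rule b_total) (auto simp: diff_closed ip_diff_left)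

text \<open>Riesz-Fischer: partial sums are Cauchy by orthonormality, and each coefficient is
  eventually constant along them, hence survives in the limit.\<close>

lemma psum_converges:
  assumes c: "summable (\<lambda>n. (c n)\<^sup>2)"
  obtains u where "u \<in> V" "(\<lambda>N. dst (psum c N) u) \<longlonglongrightarrow> 0" "\<And>n. coef u n = c n"
proof -
  have "\<exists>u\<in>V. (\<lambda>N. dst (psum c N) u) \<longlonglongrightarrow> 0"
  proof (rule complete)
    fix r :: real assume r: "r > 0"
    obtain N where N: "\<And>m n. m \<ge> N \<Longrightarrow> norm (\<Sum>i=m..<n. (c i)\<^sup>2) < r\<^sup>2"
      using c r unfolding summable_Cauchy by (metis zero_less_power)
    have main: "dst (psum c n) (psum c m) < r" if "m \<ge> N" "m \<le> n" for m n
    proof (rule power2_less_imp_less)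
      show "(dst (psum c n) (psum c m))\<^sup>2 < r\<^sup>2"
        using N[OF that(1), of n] unfolding dst_psum[OF that(2)] by (simp add: sum_nonneg)
    qed (use r in simp)
    show "\<exists>N. \<forall>m\<ge>N. \<forall>n\<ge>N. dst (psum c m) (psum c n) < r"
      using main dst_commute[OF psum_closed psum_closed] by (metis nle_le)
  qed simp
  then obtain u where u: "u \<in> V" "(\<lambda>N. dst (psum c N) u) \<longlonglongrightarrow> 0" by blast
  have "coef u n = c n" for n
  proof (rule LIMSEQ_unique)
    show "(\<lambda>N. coef (psum c N) n) \<longlonglongrightarrow> coef u n"
      by (rule tendsto_ip) (use u in auto)
    show "(\<lambda>N. coef (psum c N) n) \<longlonglongrightarrow> c n"
      by (rule tendsto_eventually) (auto simp: coef_psum eventually_sequentially intro!: exI[of _ "Suc n"])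
  qed
  with u show thesis using that by blast
qed

lemma bessel:
  assumes u: "u \<in> V"
  shows "summable (\<lambda>n. (coef u n)\<^sup>2)"
proof (rule bounded_imp_summable)
  fix n
  let ?p = "psum (coef u) (Suc n)"
  have "ip u ?p = (\<Sum>i<Suc n. (coef u i)\<^sup>2)"
    unfolding psum_def by (subst ip_sum_right) (use u in \<open>auto simp: power2_eq_square\<close>)
  then have "(nrm ?p)\<^sup>2 = ip u ?p" by (simp only: nrm_psum)
  also have "\<dots> \<le> nrm u * nrm ?p" using cauchy_schwarz[OF u, of ?p] by simp
  finally have le: "(nrm ?p)\<^sup>2 \<le> nrm u * nrm ?p" .
  have "nrm ?p \<le> nrm u"
  proof (cases "nrm ?p = 0")
    case False
    then have "nrm ?p > 0" by (simp add: less_le)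
    then show ?thesis using le by (simp add: power2_eq_square)
  qed (use u in simp)
  then have "(nrm ?p)\<^sup>2 \<le> (nrm u)\<^sup>2" by (intro power_mono) auto
  then show "(\<Sum>i\<le>n. (coef u i)\<^sup>2) \<le> (nrm u)\<^sup>2" by (simp add: nrm_psum lessThan_Suc_atMost)
qed simp

text \<open>The Riesz-Fischer limit of the partial sums has the same coefficients as
  \<open>u\<close>, so totality makes the difference null.\<close>

lemma expansion:
  assumes u: "u \<in> V"
  shows "(\<lambda>N. dst (psum (coef u) N) u) \<longlonglongrightarrow> 0"
proof -
  obtain v where v: "v \<in> V" "(\<lambda>N. dst (psum (coef u) N) v) \<longlonglongrightarrow> 0" "\<And>n. coef v n = coef u n"
    using psum_converges[OF bessel[OF u]] by blast
  have "dst v u = 0" by (rule dst_coef) (use v u in auto)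
  then have "dst (psum (coef u) N) u \<le> dst (psum (coef u) N) v" for N
    using dst_triangle[OF psum_closed v(1) u, of "coef u" N] by simp
  then show ?thesis by (intro tendsto_0_le_real[OF v(2)]) (use u in auto)
qed

lemma parseval_ip:
  assumes u: "u \<in> V" and z: "z \<in> V"
  shows "(\<lambda>n. coef u n * ip (b n) z) sums ip u z"
proof -
  have "(\<lambda>N. ip (psum (coef u) N) z) \<longlonglongrightarrow> ip u z"
    by (rule tendsto_ip) (use u z expansion in auto)
  moreover have "ip (psum (coef u) N) z = (\<Sum>n<N. coef u n * ip (b n) z)" for N
    unfolding psum_def by (rule ip_sum_left) (use z in auto)
  ultimately show ?thesis by (simp add: sums_def)
qed

lemma parseval: "u \<in> V \<Longrightarrow> (\<lambda>n. (coef u n)\<^sup>2) sums (nrm u)\<^sup>2"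
  using parseval_ip[of u u] nrm_sq[of u] by (simp add: power2_eq_square ip_commute[OF b_closed])

lemma nrm_le_coef:
  assumes "u \<in> V" "v \<in> V" "\<And>n. \<bar>coef u n\<bar> \<le> \<bar>coef v n\<bar>"
  shows "nrm u \<le> nrm v"
proof (rule power2_le_imp_le)
  show "(nrm u)\<^sup>2 \<le> (nrm v)\<^sup>2"
    by (rule sums_le[OF _ parseval[OF assms(1)] parseval[OF assms(2)]])
      (use assms(3) in \<open>simp add: abs_le_square_iff\<close>)
qed (use assms in simp)

text \<open>Dominated convergence for coefficient sequences, through Parseval and Tannery's theorem.
  It gives both strong continuity and the convergence of difference quotients.\<close>

lemma tendsto_nrm_coef:
  assumes v: "\<forall>\<^sub>F h in F. v h \<in> V"
    and lim: "\<And>n. ((\<lambda>h. coef (v h) n) \<longlongrightarrow> 0) F"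
    and bound: "\<forall>\<^sub>F h in F. \<forall>n. \<bar>coef (v h) n\<bar> \<le> B n"
    and B: "summable (\<lambda>n. (B n)\<^sup>2)" and F: "F \<noteq> bot"
  shows "((\<lambda>h. nrm (v h)) \<longlongrightarrow> 0) F"
proof -
  have "((\<lambda>h. \<Sum>n. (coef (v h) n)\<^sup>2) \<longlongrightarrow> (\<Sum>n::nat. 0)) F"
  proof (intro conjunct2[OF conjunct2[OF tannerys_theorem]])
    show "((\<lambda>h. (coef (v h) k)\<^sup>2) \<longlongrightarrow> 0) F" for k
      using tendsto_power[OF lim[of k], of 2] by simp
    have "\<forall>\<^sub>F h in F. \<forall>n. (coef (v h) n)\<^sup>2 \<le> (B n)\<^sup>2"
      using bound by eventually_elim (metis abs_ge_zero power2_abs power_mono)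
    \<comment> \<open>Tannery's theorem asks for the domination along a product filter; the bound
      here holds for all indices at once.\<close>
    then have "\<forall>\<^sub>F (k::nat, h) in at_top \<times>\<^sub>F F. \<forall>n. (coef (v h) n)\<^sup>2 \<le> (B n)\<^sup>2"
      by (subst eventually_prod2) simp_all
    then show "\<forall>\<^sub>F (k, h) in at_top \<times>\<^sub>F F. norm ((coef (v h) k)\<^sup>2) \<le> (B k)\<^sup>2"
      by eventually_elim auto
  qed (use B F in auto)
  then have "((\<lambda>h. \<Sum>n. (coef (v h) n)\<^sup>2) \<longlongrightarrow> 0) F" by simp
  moreover have "\<forall>\<^sub>F h in F. (\<Sum>n. (coef (v h) n)\<^sup>2) = (nrm (v h))\<^sup>2"
    using v by eventually_elim (metis parseval sums_unique)
  ultimately have "((\<lambda>h. (nrm (v h))\<^sup>2) \<longlongrightarrow> 0) F" by (rule Lim_transform_eventually)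
  then show ?thesis by simp
qed

end

section \<open>Semigroups acting on coefficients by decaying exponentials\<close>

locale diagonal_generator = orthonormal_basis V ip b
  for V :: "('a \<Rightarrow> real) set" and ip b +
  fixes \<mu> :: "nat \<Rightarrow> real"
  assumes \<mu>_nonneg: "0 \<le> \<mu> n"
begin

text \<open>The representative of the class with the prescribed coefficients is arbitrary.\<close>

definition diag_exp :: "real \<Rightarrow> ('a \<Rightarrow> real) \<Rightarrow> ('a \<Rightarrow> real)" where
  "diag_exp t u = (SOME v. v \<in> V \<and> (\<forall>n. coef v n = exp (- \<mu> n * t) * coef u n))"

lemma diag_exp:
  assumes t: "t \<ge> 0" and u: "u \<in> V"
  shows "diag_exp t u \<in> V" "coef (diag_exp t u) n = exp (- \<mu> n * t) * coef u n"
proof -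
  have "summable (\<lambda>n. (exp (- \<mu> n * t) * coef u n)\<^sup>2)"
  proof (rule summable_comparison_test[OF _ bessel[OF u]], intro exI allI impI)
    fix n
    have "(exp (- \<mu> n * t))\<^sup>2 \<le> 1"
      using \<mu>_nonneg[of n] t by (intro power_le_one) auto
    then show "norm ((exp (- \<mu> n * t) * coef u n)\<^sup>2) \<le> (coef u n)\<^sup>2"
      by (simp add: power_mult_distrib mult_left_le_one_le)
  qed
  from psum_converges[OF this]
  have "\<exists>v. v \<in> V \<and> (\<forall>n. coef v n = exp (- \<mu> n * t) * coef u n)" by metis
  from someI_ex[OF this]
  show "diag_exp t u \<in> V" "coef (diag_exp t u) n = exp (- \<mu> n * t) * coef u n"
    unfolding diag_exp_def by auto
qed

lemma exp_le_one: "t \<ge> 0 \<Longrightarrow> exp (- \<mu> n * t) \<le> 1"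
  using \<mu>_nonneg[of n] by simp

lemma c0_semigroup_diag_exp: "c0_semigroup_space V ip diag_exp"
proof
  show "diag_exp t u \<in> V" if "t \<ge> 0" "u \<in> V" for t u using that by (rule diag_exp)
  show "dst (diag_exp t (\<lambda>x. p * u x + q * v x)) (\<lambda>x. p * diag_exp t u x + q * diag_exp t v x) = 0"
    if "t \<ge> 0" "u \<in> V" "v \<in> V" for t u v p q
    using that by (intro dst_coef) (auto simp: diag_exp lin_closed ip_lin algebra_simps)
  show "\<exists>M. \<forall>u\<in>V. nrm (diag_exp t u) \<le> M * nrm u" if t: "t \<ge> 0" for t
  proof (intro exI ballI)
    fix u assume u: "u \<in> V"
    have "nrm (diag_exp t u) \<le> nrm u"
      using exp_le_one[OF t]
      by (intro nrm_le_coef) (simp_all add: diag_exp[OF t u] u abs_mult mult_left_le_one_le del: exp_le_one_iff)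
    then show "nrm (diag_exp t u) \<le> 1 * nrm u" by simp
  qed
  show "dst (diag_exp 0 u) u = 0" if "u \<in> V" for u
    using that by (intro dst_coef) (auto simp: diag_exp)
  show "dst (diag_exp (s + t) u) (diag_exp s (diag_exp t u)) = 0" if "s \<ge> 0" "t \<ge> 0" "u \<in> V" for s t u
    using that by (intro dst_coef) (auto simp: diag_exp mult_exp_exp algebra_simps)
  show "((\<lambda>t. dst (diag_exp t u) u) \<longlongrightarrow> 0) (at_right 0)" if u: "u \<in> V" for u
    unfolding dst_def
  proof (rule tendsto_nrm_coef[where B = "\<lambda>n. \<bar>coef u n\<bar>"])
    have co: "coef (\<lambda>x. diag_exp t u x - u x) n = (exp (- \<mu> n * t) - 1) * coef u n" if "t \<ge> 0" for t n
      using diag_exp[OF that u] u by (simp add: ip_diff_left algebra_simps)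
    show "\<forall>\<^sub>F t in at_right 0. (\<lambda>x. diag_exp t u x - u x) \<in> V"
      by (rule eventually_at_right_less[THEN eventually_mono]) (use u diag_exp diff_closed in auto)
    show "((\<lambda>t. coef (\<lambda>x. diag_exp t u x - u x) n) \<longlongrightarrow> 0) (at_right 0)" for n
    proof (rule Lim_transform_eventually)
      have "((\<lambda>t. (exp (- \<mu> n * t) - 1) * coef u n) \<longlongrightarrow> (exp (- \<mu> n * 0) - 1) * coef u n) (at_right 0)"
        by (intro tendsto_intros)
      then show "((\<lambda>t. (exp (- \<mu> n * t) - 1) * coef u n) \<longlongrightarrow> 0) (at_right 0)" by simp
      show "\<forall>\<^sub>F t in at_right 0. (exp (- \<mu> n * t) - 1) * coef u n = coef (\<lambda>x. diag_exp t u x - u x) n"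
        by (rule eventually_at_right_less[THEN eventually_mono]) (simp only: co less_imp_le)
    qed
    show "\<forall>\<^sub>F t in at_right 0. \<forall>n. \<bar>coef (\<lambda>x. diag_exp t u x - u x) n\<bar> \<le> \<bar>coef u n\<bar>"
    proof (rule eventually_at_right_less[THEN eventually_mono], intro allI)
      fix t :: real and n assume "0 < t"
      then have "\<bar>exp (- \<mu> n * t) - 1\<bar> \<le> 1" using exp_le_one[of t n] by (simp add: abs_le_iff add_increasing)
      then show "\<bar>coef (\<lambda>x. diag_exp t u x - u x) n\<bar> \<le> \<bar>coef u n\<bar>"
        using \<open>0 < t\<close> by (simp add: co abs_mult mult_left_le_one_le)
    qed
    show "summable (\<lambda>n. \<bar>coef u n\<bar>\<^sup>2)" using bessel[OF u] by simp
  qed simp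
qed

text \<open>One direction reads off coefficients of the limit. For the other,
  \<open>1 - \<mu> n * h \<le> exp (- \<mu> n * h) \<le> 1\<close> bounds the error of each
  difference quotient by \<open>\<mu> n\<close>, so the coefficients of \<open>w\<close> dominate.
  The generator domain is thus described by square summability alone.\<close>

lemma diag_exp_generator:
  assumes u: "u \<in> V" and w: "w \<in> V"
  shows "((\<lambda>h. nrm (\<lambda>x. (diag_exp h u x - u x) / h - w x)) \<longlongrightarrow> 0) (at_right 0)
    \<longleftrightarrow> (\<forall>n. coef w n = - \<mu> n * coef u n)"
proof -
  define v where "v h = (\<lambda>x. (diag_exp h u x - u x) / h - w x)" for h
  define q where "q n h = (exp (- \<mu> n * h) - 1) / h" for n h
  have quot: "(\<lambda>x. (diag_exp h u x - u x) / h) \<in> V"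
      "coef (\<lambda>x. (diag_exp h u x - u x) / h) n = q n h * coef u n" if h: "h > 0" for h n
  proof -
    have e: "(\<lambda>x. (diag_exp h u x - u x) / h) = (\<lambda>x. (1 / h) * diag_exp h u x + (- 1 / h) * u x)"
      by (auto simp: diff_divide_distrib)
    have d: "diag_exp h u \<in> V" using diag_exp[of h u] h u by simp
    show "(\<lambda>x. (diag_exp h u x - u x) / h) \<in> V" unfolding e by (rule lin_closed[OF d u])
    show "coef (\<lambda>x. (diag_exp h u x - u x) / h) n = q n h * coef u n"
      unfolding e ip_lin[OF d u b_closed] q_def using diag_exp[of h u] h u
      by (simp add: field_simps)
  qed
  have v: "v h \<in> V" "coef (v h) n = q n h * coef u n - coef w n" if "h > 0" for h n
    unfolding v_def using quot[OF that] w by (simp_all add: diff_closed ip_diff_left)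
  have ev: "\<forall>\<^sub>F h in at_right 0. v h \<in> V"
    by (rule eventually_at_right_less[THEN eventually_mono]) (rule v)
  have q: "((\<lambda>h. q n h) \<longlongrightarrow> - \<mu> n) (at_right 0)" for n
    unfolding q_def by (rule exp_quotient_tendsto)
  have lim: "((\<lambda>h. coef (v h) n) \<longlongrightarrow> - \<mu> n * coef u n - coef w n) (at_right 0)" for n
  proof (rule Lim_transform_eventually)
    show "((\<lambda>h. q n h * coef u n - coef w n) \<longlongrightarrow> - \<mu> n * coef u n - coef w n) (at_right 0)"
      by (intro tendsto_intros q)
    show "\<forall>\<^sub>F h in at_right 0. q n h * coef u n - coef w n = coef (v h) n"
      by (rule eventually_at_right_less[THEN eventually_mono]) (simp add: v)
  qed
  show ?thesis unfolding v_def[symmetric]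
  proof
    assume "((\<lambda>h. nrm (v h)) \<longlongrightarrow> 0) (at_right 0)"
    then have "((\<lambda>h. dst (v h) (\<lambda>_. 0)) \<longlongrightarrow> 0) (at_right 0)" by (simp add: dst_zero)
    from tendsto_ip[OF ev zero_closed b_closed this]
    have "((\<lambda>h. coef (v h) n) \<longlongrightarrow> 0) (at_right 0)" for n by (simp add: ip_zero_left)
    from tendsto_unique[OF _ this lim] show "\<forall>n. coef w n = - \<mu> n * coef u n" by force
  next
    assume cw: "\<forall>n. coef w n = - \<mu> n * coef u n"
    show "((\<lambda>h. nrm (v h)) \<longlongrightarrow> 0) (at_right 0)"
    proof (rule tendsto_nrm_coef[where B = "\<lambda>n. \<bar>coef w n\<bar>", OF ev])
      show "((\<lambda>h. coef (v h) n) \<longlongrightarrow> 0) (at_right 0)" for n using lim[of n] cw by simp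
      show "\<forall>\<^sub>F h in at_right 0. \<forall>n. \<bar>coef (v h) n\<bar> \<le> \<bar>coef w n\<bar>"
      proof (rule eventually_at_right_less[THEN eventually_mono], intro allI)
        fix h :: real and n assume h: "0 < h"
        have "1 + (- \<mu> n * h) \<le> exp (- \<mu> n * h)" by (rule exp_ge_add_one_self)
        then have "- \<mu> n \<le> q n h" using h by (simp add: q_def field_simps)
        moreover have "q n h \<le> 0" using exp_le_one[of h n] h by (simp add: q_def divide_le_0_iff)
        ultimately have "\<bar>q n h + \<mu> n\<bar> \<le> \<mu> n" by simp
        then have "\<bar>q n h + \<mu> n\<bar> * \<bar>coef u n\<bar> \<le> \<mu> n * \<bar>coef u n\<bar>" by (rule mult_right_mono) simp
        moreover have "coef (v h) n = (q n h + \<mu> n) * coef u n"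
          using v(2)[OF h, of n] cw by (simp add: algebra_simps)
        ultimately show "\<bar>coef (v h) n\<bar> \<le> \<bar>coef w n\<bar>"
          using cw \<mu>_nonneg[of n] by (simp add: abs_mult)
      qed
      show "summable (\<lambda>n. \<bar>coef w n\<bar>\<^sup>2)" using bessel[OF w] by simp
    qed simp
  qed
qed

text \<open>Uniqueness of the semigroup: its orbits through basis vectors are forced by the
  derivative at time 0, linearity extends this to finite sums, and boundedness of \<open>S t\<close>
  at the fixed time extends it to the whole space.\<close>

lemma semigroup_coef:
  assumes S: "c0_semigroup_space V ip S"
    and gen: "\<And>n. ((\<lambda>h. nrm (\<lambda>x. (S h (b n) x - b n x) / h - (- \<mu> n * b n x))) \<longlongrightarrow> 0) (at_right 0)"
    and t: "t \<ge> 0" and u: "u \<in> V"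
  shows "coef (S t u) n = exp (- \<mu> n * t) * coef u n"
proof -
  interpret S: c0_semigroup_space V ip S by (rule S)
  have basis: "coef (S t (b i)) n = exp (- \<mu> i * t) * of_bool (i = n)" for i
  proof -
    have "dst (S t (b i)) (\<lambda>x. exp (- \<mu> i * t) * b i x) = 0"
      by (rule S.eigenvector_orbit[OF b_closed \<mu>_nonneg t gen])
    then have "coef (S t (b i)) n = coef (\<lambda>x. exp (- \<mu> i * t) * b i x) n"
      using t by (intro coef_null S.S_closed scale_closed b_closed)
    then show ?thesis by (simp only: ip_scale_left[OF b_closed b_closed] b_orthonormal)
  qed
  have psum: "coef (S t (psum c N)) n = (if n < N then exp (- \<mu> n * t) * c n else 0)" for c N
  proof (induction N)
    case 0
    \<comment> \<open>Linearity holds only up to null distance, so the empty sum is treated as the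
      multiple 0 of a basis vector.\<close>
    have "dst (S t (\<lambda>x. 0 * b 0 x)) (\<lambda>x. 0 * S t (b 0) x) = 0" by (rule S.S_scale[OF t b_closed])
    from coef_null[OF _ _ this, of n] show ?case
      using S.S_closed[OF t zero_closed] by (simp add: psum_def zero_closed ip_zero_left)
  next
    case (Suc N)
    have e: "psum c (Suc N) = (\<lambda>x. 1 * psum c N x + c N * b N x)" by (simp add: psum_def)
    have "coef (S t (psum c (Suc N))) n = coef (\<lambda>x. 1 * S t (psum c N) x + c N * S t (b N) x) n"
      unfolding e using t
      by (intro coef_null S.S_lin S.S_closed lin_closed psum_closed b_closed)
    also have "\<dots> = coef (S t (psum c N)) n + c N * coef (S t (b N)) n"
      using S.S_closed[OF t] by (subst ip_lin) auto
    finally show ?case using Suc by (auto simp: basis less_Suc_eq)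
  qed
  obtain M where M: "\<And>v. v \<in> V \<Longrightarrow> nrm (S t v) \<le> M * nrm v" using S.S_bdd[OF t] by blast
  have "(\<lambda>N. dst (S t (psum (coef u) N)) (S t u)) \<longlonglongrightarrow> 0"
  proof (rule tendsto_0_le_real)
    show "(\<lambda>N. M * dst (psum (coef u) N) u) \<longlonglongrightarrow> 0"
      by (rule tendsto_mult_right_zero[OF expansion[OF u]])
  qed (use S.S_dst[OF t M] S.S_closed[OF t] u in auto)
  then have "(\<lambda>N. coef (S t (psum (coef u) N)) n) \<longlonglongrightarrow> coef (S t u) n"
    by (intro tendsto_ip) (use S.S_closed[OF t] u in auto)
  moreover have "(\<lambda>N. coef (S t (psum (coef u) N)) n) \<longlonglongrightarrow> exp (- \<mu> n * t) * coef u n"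
    by (rule tendsto_eventually) (auto simp: psum eventually_sequentially intro!: exI[of _ "Suc n"])
  ultimately show ?thesis by (rule LIMSEQ_unique)
qed

end

section \<open>Square integrable functions\<close>

lemma integrable_mult_of_square:
  fixes f g :: "'a \<Rightarrow> real"
  assumes [measurable]: "f \<in> borel_measurable M" "g \<in> borel_measurable M"
    and f: "integrable M (\<lambda>x. (f x)\<^sup>2)" and g: "integrable M (\<lambda>x. (g x)\<^sup>2)"
  shows "integrable M (\<lambda>x. f x * g x)"
proof (rule Bochner_Integration.integrable_bound[OF Bochner_Integration.integrable_add[OF f g]])
  show "AE x in M. norm (f x * g x) \<le> norm ((f x)\<^sup>2 + (g x)\<^sup>2)"
    using abs_mult_le_squares by (intro AE_I2) simp
qed simp

lemma integrable_square_lin: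
  fixes f g :: "'a \<Rightarrow> real"
  assumes [measurable]: "f \<in> borel_measurable M" "g \<in> borel_measurable M"
    and f: "integrable M (\<lambda>x. (f x)\<^sup>2)" and g: "integrable M (\<lambda>x. (g x)\<^sup>2)"
  shows "integrable M (\<lambda>x. (a * f x + b * g x)\<^sup>2)"
proof -
  have "integrable M (\<lambda>x. a\<^sup>2 * (f x)\<^sup>2 + 2 * a * b * (f x * g x) + b\<^sup>2 * (g x)\<^sup>2)"
    using f g integrable_mult_of_square[OF assms] by simp
  moreover have "(\<lambda>x. a\<^sup>2 * (f x)\<^sup>2 + 2 * a * b * (f x * g x) + b\<^sup>2 * (g x)\<^sup>2) = (\<lambda>x. (a * f x + b * g x)\<^sup>2)"
    by (auto simp: power2_eq_square algebra_simps)
  ultimately show ?thesis by simp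
qed

text \<open>Pointwise \<open>d k x \<le> 2^k * (d k x)\<^sup>2 + (1/2)^k\<close>, because
  \<open>d k x\<close> is either at most \<open>(1/2)^k\<close> or at least that large. Integrating
  gives a geometric bound, so the increments are absolutely summable almost everywhere and
  telescope.\<close>

lemma (in finite_measure) fast_Cauchy_AE_convergent:
  fixes h :: "nat \<Rightarrow> 'a \<Rightarrow> real"
  assumes [measurable]: "\<And>k. h k \<in> borel_measurable M"
    and int: "\<And>k. integrable M (\<lambda>x. (h (Suc k) x - h k x)\<^sup>2)"
    and fast: "\<And>k. (\<integral>x. (h (Suc k) x - h k x)\<^sup>2 \<partial>M) \<le> (1/4)^k"
  shows "AE x in M. convergent (\<lambda>k. h k x)"
proof -
  define d where "d k x = \<bar>h (Suc k) x - h k x\<bar>" for k x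
  have [measurable]: "d k \<in> borel_measurable M" for k unfolding d_def by measurable
  let ?m = "measure M (space M)"
  have bound: "(\<integral>\<^sup>+x. ennreal (d k x) \<partial>M) \<le> ennreal ((1/2)^k * (1 + ?m))" for k
  proof -
    have "(\<integral>\<^sup>+x. ennreal (d k x) \<partial>M) \<le> (\<integral>\<^sup>+x. ennreal (2^k * (h (Suc k) x - h k x)\<^sup>2 + (1/2)^k) \<partial>M)"
    proof (intro nn_integral_mono ennreal_leI)
      fix x
      show "d k x \<le> 2^k * (h (Suc k) x - h k x)\<^sup>2 + (1/2)^k"
      proof (cases "d k x \<le> (1/2)^k")
        case False
        then have "1 \<le> 2^k * d k x"
          by (simp add: power_one_over field_simps)
        then have "1 * d k x \<le> (2^k * d k x) * d k x" by (intro mult_right_mono) (auto simp: d_def)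
        then have "d k x \<le> 2^k * (h (Suc k) x - h k x)\<^sup>2"
          by (simp add: d_def power2_eq_square mult.assoc flip: abs_mult)
        moreover have "0 \<le> (1/2::real)^k" by simp
        ultimately show ?thesis by linarith
      next
        case True
        moreover have "0 \<le> 2^k * (h (Suc k) x - h k x)\<^sup>2" by simp
        ultimately show ?thesis by linarith
      qed
    qed
    also have "\<dots> = ennreal (\<integral>x. 2^k * (h (Suc k) x - h k x)\<^sup>2 + (1/2)^k \<partial>M)"
      using int by (intro nn_integral_eq_integral) auto
    also have "(\<integral>x. 2^k * (h (Suc k) x - h k x)\<^sup>2 + (1/2)^k \<partial>M)
        = 2^k * (\<integral>x. (h (Suc k) x - h k x)\<^sup>2 \<partial>M) + (1/2)^k * ?m"
      using int by (subst Bochner_Integration.integral_add) auto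
    also have "\<dots> \<le> 2^k * (1/4)^k + (1/2)^k * ?m"
      using fast[of k] by (intro add_mono mult_left_mono) auto
    also have "2^k * (1/4)^k = (1/2::real)^k" by (simp flip: power_mult_distrib)
    finally show ?thesis by (simp add: algebra_simps ennreal_leI)
  qed
  have "(\<integral>\<^sup>+x. (\<Sum>k. ennreal (d k x)) \<partial>M) = (\<Sum>k. \<integral>\<^sup>+x. ennreal (d k x) \<partial>M)"
    by (rule nn_integral_suminf) measurable
  also have "\<dots> \<le> (\<Sum>k. ennreal ((1/2)^k * (1 + ?m)))"
    by (rule suminf_le[OF bound]) auto
  also have "\<dots> = ennreal (\<Sum>k. (1/2)^k * (1 + ?m))"
    by (rule suminf_ennreal2) (simp, intro summable_mult2 summable_geometric, simp)
  also have "\<dots> < \<infinity>" by simp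
  finally have "(\<integral>\<^sup>+x. (\<Sum>k. ennreal (d k x)) \<partial>M) \<noteq> \<infinity>" by simp
  then have "AE x in M. (\<Sum>k. ennreal (d k x)) \<noteq> \<infinity>"
    by (rule nn_integral_PInf_AE[rotated]) measurable
  then show ?thesis
  proof eventually_elim
    case (elim x)
    have "summable (\<lambda>k. d k x)"
      using elim by (intro summable_suminf_not_top) (simp_all add: d_def)
    then have "summable (\<lambda>k. h (Suc k) x - h k x)"
      unfolding d_def by (rule summable_rabs_cancel)
    then have "convergent (\<lambda>n. \<Sum>k<n. h (Suc k) x - h k x)"
      unfolding summable_iff_convergent .
    then have "convergent (\<lambda>n. h n x - h 0 x)" unfolding sum_lessThan_telescope[of "\<lambda>k. h k x"] .
    then obtain l where "(\<lambda>n. h n x - h 0 x) \<longlonglongrightarrow> l" unfolding convergent_def by blast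
    from tendsto_add[OF this tendsto_const[of "h 0 x"]]
    have "(\<lambda>n. h n x) \<longlonglongrightarrow> l + h 0 x" by simp
    then show ?case by (rule convergentI)
  qed
qed

text \<open>A rapidly converging subsequence has an almost everywhere limit; Fatou's lemma, applied
  to the distance of a fixed \<open>f n\<close> from this subsequence, then yields mean square
  convergence of the full sequence.\<close>

lemma (in finite_measure) square_integrable_complete:
  fixes f :: "nat \<Rightarrow> 'a \<Rightarrow> real"
  assumes [measurable]: "\<And>n. f n \<in> borel_measurable M"
    and f2: "\<And>n. integrable M (\<lambda>x. (f n x)\<^sup>2)"
    and cauchy: "\<And>r. r > 0 \<Longrightarrow> \<exists>N. \<forall>m\<ge>N. \<forall>n\<ge>N. (\<integral>x. (f m x - f n x)\<^sup>2 \<partial>M) < r"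
  obtains g where "g \<in> borel_measurable M" "integrable M (\<lambda>x. (g x)\<^sup>2)"
    "(\<lambda>n. \<integral>x. (f n x - g x)\<^sup>2 \<partial>M) \<longlonglongrightarrow> 0"
proof -
  have fd: "integrable M (\<lambda>x. (f m x - f n x)\<^sup>2)" for m n
    using integrable_square_lin[of "f m" M "f n" 1 "-1"] f2 by simp
  have "\<exists>N. \<forall>m\<ge>N. \<forall>n\<ge>N. (\<integral>x. (f m x - f n x)\<^sup>2 \<partial>M) < (1/4)^k" for k :: nat
    by (rule cauchy) simp
  then obtain N where N: "\<And>k m n. m \<ge> N k \<Longrightarrow> n \<ge> N k \<Longrightarrow> (\<integral>x. (f m x - f n x)\<^sup>2 \<partial>M) < (1/4)^k"
    by metis
  define r where "r = rec_nat (N 0) (\<lambda>k p. max (Suc p) (N (Suc k)))"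
  have r_Suc: "r (Suc k) = max (Suc (r k)) (N (Suc k))" for k by (simp add: r_def)
  have r_mono: "strict_mono r" unfolding strict_mono_Suc_iff r_Suc by auto
  have r_N: "N k \<le> r k" for k by (cases k) (auto simp: r_Suc r_def)
  define h where "h k = f (r k)" for k
  have [measurable]: "h k \<in> borel_measurable M" for k by (simp add: h_def)
  have conv: "AE x in M. convergent (\<lambda>k. h k x)"
  proof (rule fast_Cauchy_AE_convergent)
    show "(\<integral>x. (h (Suc k) x - h k x)\<^sup>2 \<partial>M) \<le> (1/4)^k" for k
      unfolding h_def
      using strict_monoD[OF r_mono, of k "Suc k"] r_N[of k] by (intro less_imp_le[OF N]) auto
  qed (use fd in \<open>auto simp: h_def\<close>)
  define g where "g x = lim (\<lambda>k. h k x)" for x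
  have [measurable]: "g \<in> borel_measurable M" unfolding g_def by measurable
  have lim: "AE x in M. (\<lambda>k. h k x) \<longlonglongrightarrow> g x"
    using conv by eventually_elim (simp add: g_def convergent_LIMSEQ_iff)
  have fatou: "(\<integral>\<^sup>+x. ennreal ((f n x - g x)\<^sup>2) \<partial>M) \<le> ennreal ((1/4)^j)" if n: "n \<ge> N j" for n j
  proof -
    have "(\<integral>\<^sup>+x. ennreal ((f n x - g x)\<^sup>2) \<partial>M) = (\<integral>\<^sup>+x. liminf (\<lambda>k. ennreal ((f n x - h k x)\<^sup>2)) \<partial>M)"
    proof (rule nn_integral_cong_AE, use lim in eventually_elim)
      case (elim x)
      have "(\<lambda>k. ennreal ((f n x - h k x)\<^sup>2)) \<longlonglongrightarrow> ennreal ((f n x - g x)\<^sup>2)"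
        using elim by (intro tendsto_intros)
      then show ?case using lim_imp_Liminf by (metis trivial_limit_sequentially)
    qed
    also have "\<dots> \<le> liminf (\<lambda>k. \<integral>\<^sup>+x. ennreal ((f n x - h k x)\<^sup>2) \<partial>M)"
      by (rule nn_integral_liminf) measurable
    also have "\<dots> \<le> liminf (\<lambda>k. ennreal ((1/4)^j))"
    proof (rule Liminf_mono, unfold eventually_sequentially, intro exI[of _ j] allI impI)
      fix k assume k: "j \<le> k"
      have "(\<integral>\<^sup>+x. ennreal ((f n x - h k x)\<^sup>2) \<partial>M) = ennreal (\<integral>x. (f n x - h k x)\<^sup>2 \<partial>M)"
        using fd by (intro nn_integral_eq_integral) (auto simp: h_def)
      moreover have "r j \<le> r k" using k r_mono by (simp add: strict_mono_less_eq)
      then have "(\<integral>x. (f n x - h k x)\<^sup>2 \<partial>M) < (1/4)^j"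
        unfolding h_def using n r_N[of j] by (intro N) auto
      ultimately show "(\<integral>\<^sup>+x. ennreal ((f n x - h k x)\<^sup>2) \<partial>M) \<le> ennreal ((1/4)^j)"
        by (simp add: ennreal_leI)
    qed
    also have "\<dots> = ennreal ((1/4)^j)" by (simp add: Liminf_const)
    finally show ?thesis .
  qed
  have int: "integrable M (\<lambda>x. (f n x - g x)\<^sup>2)" if n: "n \<ge> N j" for n j
  proof (rule integrableI_bounded)
    show "(\<integral>\<^sup>+x. ennreal (norm ((f n x - g x)\<^sup>2)) \<partial>M) < \<infinity>"
      using fatou[OF n] by (simp add: le_less_trans)
  qed simp
  have small: "(\<integral>x. (f n x - g x)\<^sup>2 \<partial>M) \<le> (1/4)^j" if n: "n \<ge> N j" for n j
    using fatou[OF n] nn_integral_eq_integral[OF int[OF n]] by simp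
  show thesis
  proof (rule that)
    let ?n = "N 0"
    have "integrable M (\<lambda>x. (1 * f ?n x + (-1) * (f ?n x - g x))\<^sup>2)"
      by (rule integrable_square_lin) (use f2 int[of 0] in auto)
    then show "integrable M (\<lambda>x. (g x)\<^sup>2)" by simp
    show "(\<lambda>n. \<integral>x. (f n x - g x)\<^sup>2 \<partial>M) \<longlonglongrightarrow> 0"
    proof (rule LIMSEQ_I)
      fix e :: real assume e: "e > 0"
      obtain j where j: "(1/4::real)^j < e" using real_arch_pow_inv[OF e, of "1/4"] by auto
      have "norm ((\<integral>x. (f n x - g x)\<^sup>2 \<partial>M) - 0) < e" if "n \<ge> N j" for n
        using small[OF that] j by (simp add: integral_nonneg_AE)
      then show "\<exists>no. \<forall>n\<ge>no. norm ((\<integral>x. (f n x - g x)\<^sup>2 \<partial>M) - 0) < e" by blast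
    qed
  qed simp
qed

text \<open>The positive and negative parts are densities of two finite measures that agree on all
  half lines, hence coincide. Equal densities force both parts to vanish, as at each point one of
  them is 0.\<close>

lemma AE_zero_if_tail_integrals_zero:
  fixes h :: "real \<Rightarrow> real"
  assumes h: "integrable lborel h"
    and zero: "\<And>y. (\<integral>x. h x * indicator {y<..} x \<partial>lborel) = 0"
  shows "AE x in lborel. h x = 0"
proof -
  have [measurable]: "h \<in> borel_measurable borel" using h by auto
  define p where "p x = max 0 (h x)" for x
  define q where "q x = max 0 (- h x)" for x
  have p: "integrable lborel p" and q: "integrable lborel q"
    unfolding p_def q_def using h by auto
  have [measurable]: "p \<in> borel_measurable borel" "q \<in> borel_measurable borel"
    unfolding p_def q_def by measurable
  have ind: "integrable lborel (\<lambda>x. f x * indicator {y<..} x)" if "integrable lborel f" for f :: "real \<Rightarrow> real" and y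
    by (rule integrable_real_mult_indicator[OF _ that]) measurable
  have em: "emeasure (density lborel f) {y<..} = ennreal (\<integral>x. f x * indicator {y<..} x \<partial>lborel)"
    if f: "integrable lborel f" and nn: "\<And>x. 0 \<le> f x" for f :: "real \<Rightarrow> real" and y
  proof -
    have "emeasure (density lborel f) {y<..} = (\<integral>\<^sup>+x. ennreal (f x) * indicator {y<..} x \<partial>lborel)"
      using f by (intro emeasure_density) auto
    also have "\<dots> = (\<integral>\<^sup>+x. ennreal (f x * indicator {y<..} x) \<partial>lborel)"
      by (intro nn_integral_cong) (auto simp: indicator_def)
    also have "\<dots> = ennreal (\<integral>x. f x * indicator {y<..} x \<partial>lborel)"
      using ind[OF f] nn by (intro nn_integral_eq_integral) auto
    finally show ?thesis .
  qed
  have eq: "(\<integral>x. p x * indicator {y<..} x \<partial>lborel) = (\<integral>x. q x * indicator {y<..} x \<partial>lborel)" for y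
  proof -
    have "(\<integral>x. p x * indicator {y<..} x \<partial>lborel) - (\<integral>x. q x * indicator {y<..} x \<partial>lborel)
        = (\<integral>x. p x * indicator {y<..} x - q x * indicator {y<..} x \<partial>lborel)"
      using ind[OF p] ind[OF q] by simp
    also have "\<dots> = (\<integral>x. h x * indicator {y<..} x \<partial>lborel)"
      by (intro Bochner_Integration.integral_cong) (auto simp: p_def q_def indicator_def)
    finally show ?thesis using zero by simp
  qed
  have "density lborel p = density lborel q"
  proof (rule measure_eqI_lessThan)
    have nn: "0 \<le> p x" "0 \<le> q x" for x by (auto simp: p_def q_def)
    show "emeasure (density lborel p) {x<..} < \<infinity>" for x by (simp add: em[OF p nn(1)])
    show "emeasure (density lborel p) {x<..} = emeasure (density lborel q) {x<..}" for x
      by (simp only: em[OF p nn(1)] em[OF q nn(2)] eq)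
  qed simp_all
  then have "AE x in lborel. ennreal (p x) = ennreal (q x)"
    by (intro sigma_finite_measure.density_unique[OF sigma_finite_lborel]) auto
  then show ?thesis
    by eventually_elim (auto simp: p_def q_def max_def split: if_splits)
qed

text \<open>Comparing measures on half lines is an argument about Borel functions, so
  \<open>h\<close> is replaced by a Borel function equal to it almost everywhere.\<close>

lemma AE_zero_if_tail_integrals_zero_lebesgue:
  fixes h :: "real \<Rightarrow> real"
  assumes h: "integrable lebesgue h"
    and zero: "\<And>y. (\<integral>x. h x * indicator {y<..} x \<partial>lebesgue) = 0"
  shows "AE x in lebesgue. h x = 0"
proof -
  obtain h' where h': "h' \<in> borel_measurable lborel" and ae: "AE x in lborel. h x = h' x"
    using completion_ex_borel_measurable_real[of h lborel] h by auto
  have ae': "AE x in lebesgue. h x = h' x" using ae by (rule AE_completion)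
  have h'm: "h' \<in> borel_measurable lebesgue" using h' by (simp add: measurable_completion)
  have "integrable lebesgue h'"
    using integrable_cong_AE[OF _ h'm ae'] h by auto
  then have int: "integrable lborel h'" using integrable_completion[OF h'] by simp
  have [measurable]: "h' \<in> borel_measurable borel" using h' by simp
  have "(\<integral>x. h' x * indicator {y<..} x \<partial>lborel) = 0" for y
  proof -
    have "(\<integral>x. h' x * indicator {y<..} x \<partial>lborel) = (\<integral>x. h' x * indicator {y<..} x \<partial>lebesgue)"
      by (rule integral_completion[symmetric]) measurable
    also have "\<dots> = (\<integral>x. h x * indicator {y<..} x \<partial>lebesgue)"
    proof (rule integral_cong_AE)
      show "AE x in lebesgue. h' x * indicator {y<..} x = h x * indicator {y<..} x"
        using ae' by eventually_elim simp
      have ind: "(\<lambda>x. indicator {y<..} x :: real) \<in> borel_measurable lebesgue"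
        by (rule measurable_completion) simp
      show "(\<lambda>x. h' x * indicator {y<..} x) \<in> borel_measurable lebesgue"
        by (intro borel_measurable_times h'm ind)
      show "(\<lambda>x. h x * indicator {y<..} x) \<in> borel_measurable lebesgue"
        by (intro borel_measurable_times ind) (use h in auto)
    qed
    finally show ?thesis using zero by simp
  qed
  from AE_zero_if_tail_integrals_zero[OF int this]
  have "AE x in lebesgue. h' x = 0" by (rule AE_completion)
  with ae' show ?thesis by eventually_elim simp
qed

section \<open>The weighted space\<close>

locale transport =
  fixes L \<epsilon> :: real
  assumes L_pos: "L > 0" and eps_pos: "\<epsilon> > 0"
begin

abbreviation M :: "real measure" where
  "M \<equiv> lebesgue_on {-L<..<0}"

text \<open>The approximation condition of \<open>X_space\<close> is left out;
  \<open>X_space_eq\<close> recovers it once smooth eigenfunctions are known to span a dense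
  subspace.\<close>

abbreviation X :: "(real \<Rightarrow> real) set" where
  "X \<equiv> L2_space {-L<..<0}"

text \<open>With the weight \<open>exp (-x / \<epsilon>)\<close> the operator becomes symmetric.\<close>

definition wt :: "real \<Rightarrow> real" where
  "wt x = exp (- x / \<epsilon>)"

text \<open>The inner product for Lebesgue measure plus point masses \<epsilon> at both end points,
  all multiplied by the density \<open>wt\<close>; the factor at 0 is \<open>wt 0 = 1\<close>.
  Equivalently, \<open>X_inner\<close> of \<open>u\<close> with \<open>wt * v\<close>.\<close>

definition wip :: "(real \<Rightarrow> real) \<Rightarrow> (real \<Rightarrow> real) \<Rightarrow> real" where
  "wip u v = (\<integral>x. wt x * (u x * v x) \<partial>M) + \<epsilon> * (u 0 * v 0 + wt (-L) * (u (-L) * v (-L)))"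

lemma wt_bounds: "x \<in> {-L..0} \<Longrightarrow> 1 \<le> wt x" "x \<in> {-L..0} \<Longrightarrow> wt x \<le> wt (-L)"
  using eps_pos by (auto simp: wt_def intro!: divide_right_mono divide_nonpos_pos)
    (metis divide_right_mono less_imp_le minus_divide_left minus_le_iff)

lemma wt_pos [simp]: "0 < wt x"
  by (simp add: wt_def)

lemma wt_nonzero [simp]: "wt x \<noteq> 0"
  by (simp add: wt_def)

lemma wt_0 [simp]: "wt 0 = 1"
  by (simp add: wt_def)

lemma finite_M: "finite_measure M"
  by (rule finite_measure_lebesgue_on) simp

lemma X_I: "u \<in> borel_measurable M \<Longrightarrow> integrable M (\<lambda>x. (u x)\<^sup>2) \<Longrightarrow> u \<in> X"
  by (simp add: L2_space_def)

lemma X_measurable: "u \<in> X \<Longrightarrow> u \<in> borel_measurable M"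
  by (simp add: L2_space_def)

lemma X_integrable_square: "u \<in> X \<Longrightarrow> integrable M (\<lambda>x. (u x)\<^sup>2)"
  by (simp add: L2_space_def)

lemma continuous_measurable: "continuous_on {-L<..<0} f \<Longrightarrow> f \<in> borel_measurable M"
  by (rule continuous_imp_measurable_on_sets_lebesgue) auto

lemma wt_measurable [measurable]: "wt \<in> borel_measurable M"
  unfolding wt_def by (intro continuous_measurable continuous_intros) (use eps_pos in auto)

lemma integrable_bounded:
  fixes f :: "real \<Rightarrow> real"
  assumes "f \<in> borel_measurable M" "\<And>x. x \<in> {-L<..<0} \<Longrightarrow> \<bar>f x\<bar> \<le> B"
  shows "integrable M f"
  by (rule finite_measure.integrable_const_bound[OF finite_M, of _ B])
    (use assms in \<open>auto intro!: AE_I2\<close>)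

lemma integrable_mult_bounded:
  fixes f g :: "real \<Rightarrow> real"
  assumes f: "f \<in> borel_measurable M" "\<And>x. x \<in> {-L<..<0} \<Longrightarrow> \<bar>f x\<bar> \<le> B" and g: "integrable M g"
  shows "integrable M (\<lambda>x. f x * g x)"
proof (rule Bochner_Integration.integrable_bound)
  show "integrable M (\<lambda>x. B * g x)" using g by simp
  show "(\<lambda>x. f x * g x) \<in> borel_measurable M"
    using f g by (intro borel_measurable_times) auto
  show "AE x in M. norm (f x * g x) \<le> norm (B * g x)"
  proof (rule AE_I2)
    fix x assume "x \<in> space M"
    then have "\<bar>f x\<bar> \<le> B" using f by simp
    then have "\<bar>f x\<bar> * \<bar>g x\<bar> \<le> \<bar>B\<bar> * \<bar>g x\<bar>" by (intro mult_right_mono) auto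
    then show "norm (f x * g x) \<le> norm (B * g x)" by (simp add: abs_mult)
  qed
qed

lemma X_bounded:
  assumes "f \<in> borel_measurable M" "\<And>x. x \<in> {-L<..<0} \<Longrightarrow> \<bar>f x\<bar> \<le> B"
  shows "f \<in> X"
proof (rule X_I[OF assms(1)], rule integrable_bounded)
  show "(\<lambda>x. (f x)\<^sup>2) \<in> borel_measurable M" using assms(1) by measurable
  fix x assume "x \<in> {-L<..<0}"
  then have "\<bar>f x\<bar>\<^sup>2 \<le> B\<^sup>2" using assms(2) by (intro power_mono) auto
  then show "\<bar>(f x)\<^sup>2\<bar> \<le> B\<^sup>2" by simp
qed

lemma X_continuous:
  assumes "continuous_on {-L..0} f"
  shows "f \<in> X"
proof -
  have "compact (f ` {-L..0})" by (intro compact_continuous_image assms) simp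
  then obtain B where "\<And>x. x \<in> {-L..0} \<Longrightarrow> \<bar>f x\<bar> \<le> B"
    by (force dest: compact_imp_bounded simp: bounded_iff)
  moreover have "f \<in> borel_measurable M"
    by (intro continuous_measurable continuous_on_subset[OF assms]) auto
  ultimately show ?thesis by (intro X_bounded[of f B]) auto
qed

lemma X_integrable_mult: "u \<in> X \<Longrightarrow> v \<in> X \<Longrightarrow> integrable M (\<lambda>x. u x * v x)"
  by (rule integrable_mult_of_square) (auto simp: X_measurable X_integrable_square)

lemma wt_integrable: "integrable M f \<Longrightarrow> integrable M (\<lambda>x. wt x * f x)"
  by (rule integrable_mult_bounded[of _ "wt (-L)"]) (use wt_bounds in \<open>auto simp: less_imp_le abs_of_pos\<close>)

lemma wip_integrable: "u \<in> X \<Longrightarrow> v \<in> X \<Longrightarrow> integrable M (\<lambda>x. wt x * (u x * v x))"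
  by (intro wt_integrable X_integrable_mult)

lemma X_lin: "u \<in> X \<Longrightarrow> v \<in> X \<Longrightarrow> (\<lambda>x. a * u x + b * v x) \<in> X"
  by (intro X_I integrable_square_lin borel_measurable_add borel_measurable_times borel_measurable_const)
    (auto simp: X_measurable X_integrable_square)

section \<open>Equivalence of the weighted norm with the norm of X, and completeness\<close>

lemma wip_pos_part: "u \<in> X \<Longrightarrow> (\<integral>x. (u x)\<^sup>2 \<partial>M) \<le> (\<integral>x. wt x * (u x * u x) \<partial>M)"
proof (intro integral_mono X_integrable_square wip_integrable)
  fix x assume "x \<in> space M"
  then have "1 * (u x * u x) \<le> wt x * (u x * u x)" using wt_bounds(1)[of x] by (intro mult_right_mono) auto
  then show "(u x)\<^sup>2 \<le> wt x * (u x * u x)" by (simp add: power2_eq_square)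
qed

lemma wip_upper_part: "u \<in> X \<Longrightarrow> (\<integral>x. wt x * (u x * u x) \<partial>M) \<le> wt (-L) * (\<integral>x. (u x)\<^sup>2 \<partial>M)"
proof -
  assume u: "u \<in> X"
  have "(\<integral>x. wt x * (u x * u x) \<partial>M) \<le> (\<integral>x. wt (-L) * (u x)\<^sup>2 \<partial>M)"
  proof (intro integral_mono wip_integrable u)
    show "integrable M (\<lambda>x. wt (-L) * (u x)\<^sup>2)" using X_integrable_square[OF u] by simp
    fix x assume "x \<in> space M"
    then have "wt x * (u x * u x) \<le> wt (-L) * (u x * u x)"
      using wt_bounds(2)[of x] by (intro mult_right_mono) auto
    then show "wt x * (u x * u x) \<le> wt (-L) * (u x)\<^sup>2" by (simp add: power2_eq_square)
  qed
  then show ?thesis by simp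
qed

lemma square_integral_nonneg: "0 \<le> (\<integral>x. (u x)\<^sup>2 \<partial>M)" for u :: "real \<Rightarrow> real"
  by (rule integral_nonneg_AE) simp

lemma X_norm_sq: "(X_norm \<epsilon> L u)\<^sup>2 = (\<integral>x. (u x)\<^sup>2 \<partial>M) + \<epsilon> * ((u 0)\<^sup>2 + (u (-L))\<^sup>2)"
  unfolding X_norm_def L2_norm_def using eps_pos square_integral_nonneg[of u] by simp

lemma X_norm_nonneg: "0 \<le> X_norm \<epsilon> L u"
  unfolding X_norm_def using eps_pos by (intro real_sqrt_ge_zero) auto

lemma X_norm_le_wip: "u \<in> X \<Longrightarrow> (X_norm \<epsilon> L u)\<^sup>2 \<le> wip u u"
proof -
  assume u: "u \<in> X"
  have "1 * (u (-L))\<^sup>2 \<le> wt (-L) * (u (-L))\<^sup>2" using wt_bounds[of "-L"] L_pos by (intro mult_right_mono) auto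
  then have "\<epsilon> * ((u 0)\<^sup>2 + (u (-L))\<^sup>2) \<le> \<epsilon> * ((u 0)\<^sup>2 + wt (-L) * (u (-L))\<^sup>2)"
    using eps_pos by (intro mult_left_mono) auto
  then show ?thesis using wip_pos_part[OF u] unfolding X_norm_sq wip_def by (simp add: power2_eq_square)
qed

lemma wip_le_X_norm: "u \<in> X \<Longrightarrow> wip u u \<le> wt (-L) * (X_norm \<epsilon> L u)\<^sup>2"
proof -
  assume u: "u \<in> X"
  have "1 * (u 0)\<^sup>2 \<le> wt (-L) * (u 0)\<^sup>2" using wt_bounds[of "-L"] L_pos by (intro mult_right_mono) auto
  then have "\<epsilon> * ((u 0)\<^sup>2 + wt (-L) * (u (-L))\<^sup>2) \<le> \<epsilon> * (wt (-L) * (u 0)\<^sup>2 + wt (-L) * (u (-L))\<^sup>2)"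
    using eps_pos by (intro mult_left_mono) auto
  then show ?thesis using wip_upper_part[OF u] unfolding X_norm_sq wip_def
    by (simp add: power2_eq_square algebra_simps)
qed

text \<open>A Cauchy sequence in X splits into a Cauchy sequence in mean square and two numerical
  ones, which converge independently of each other.\<close>

lemma L2_complete_boundary:
  fixes f :: "nat \<Rightarrow> real \<Rightarrow> real"
  assumes f: "\<And>n. f n \<in> X"
    and cauchy: "\<And>r. r > 0 \<Longrightarrow> \<exists>N. \<forall>m\<ge>N. \<forall>n\<ge>N. X_norm \<epsilon> L (\<lambda>x. f m x - f n x) < r"
  obtains u where "u \<in> X" "(\<lambda>n. X_norm \<epsilon> L (\<lambda>x. f n x - u x)) \<longlonglongrightarrow> 0"
proof -
  have parts: "(\<integral>x. (v x)\<^sup>2 \<partial>M) < r\<^sup>2" "\<epsilon> * (v 0)\<^sup>2 < r\<^sup>2" "\<epsilon> * (v (-L))\<^sup>2 < r\<^sup>2"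
    if "X_norm \<epsilon> L v < r" for v r
  proof -
    have "(X_norm \<epsilon> L v)\<^sup>2 < r\<^sup>2" using that X_norm_nonneg[of v] by (intro power_strict_mono) auto
    moreover have "0 \<le> \<epsilon> * (v 0)\<^sup>2" "0 \<le> \<epsilon> * (v (-L))\<^sup>2" using eps_pos by auto
    ultimately show "(\<integral>x. (v x)\<^sup>2 \<partial>M) < r\<^sup>2" "\<epsilon> * (v 0)\<^sup>2 < r\<^sup>2" "\<epsilon> * (v (-L))\<^sup>2 < r\<^sup>2"
      using square_integral_nonneg[of v] unfolding X_norm_sq distrib_left by linarith+
  qed
  obtain g where g: "g \<in> borel_measurable M" "integrable M (\<lambda>x. (g x)\<^sup>2)"
    "(\<lambda>n. \<integral>x. (f n x - g x)\<^sup>2 \<partial>M) \<longlonglongrightarrow> 0"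
  proof (rule finite_measure.square_integrable_complete[OF finite_M])
    fix r :: real assume r: "r > 0"
    then obtain N where N: "\<And>m n. m \<ge> N \<Longrightarrow> n \<ge> N \<Longrightarrow> X_norm \<epsilon> L (\<lambda>x. f m x - f n x) < sqrt r"
      using cauchy[of "sqrt r"] by auto
    show "\<exists>N. \<forall>m\<ge>N. \<forall>n\<ge>N. (\<integral>x. (f m x - f n x)\<^sup>2 \<partial>M) < r"
      using parts(1)[OF N] r by (intro exI[of _ N]) simp
  qed (use f X_measurable X_integrable_square in auto)
  have point: "Cauchy (\<lambda>n. f n p)" if p: "p = 0 \<or> p = -L" for p
  proof (rule CauchyI)
    fix e :: real assume e: "e > 0"
    obtain N where N: "\<And>m n. m \<ge> N \<Longrightarrow> n \<ge> N \<Longrightarrow> X_norm \<epsilon> L (\<lambda>x. f m x - f n x) < sqrt \<epsilon> * e"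
      using cauchy[of "sqrt \<epsilon> * e"] e eps_pos by auto
    have "norm (f m p - f n p) < e" if "m \<ge> N" "n \<ge> N" for m n
    proof -
      have "\<epsilon> * (f m p - f n p)\<^sup>2 < (sqrt \<epsilon> * e)\<^sup>2"
        using parts(2,3)[OF N[OF that]] p by auto
      then have "(f m p - f n p)\<^sup>2 < e\<^sup>2" using eps_pos by (simp add: power_mult_distrib)
      then show ?thesis using e power2_less_imp_less[of "\<bar>f m p - f n p\<bar>" e] by simp
    qed
    then show "\<exists>N. \<forall>m\<ge>N. \<forall>n\<ge>N. norm (f m p - f n p) < e" by blast
  qed
  obtain a where a: "(\<lambda>n. f n 0) \<longlonglongrightarrow> a" using point[of 0] by (auto simp: Cauchy_convergent_iff convergent_def)
  obtain c where c: "(\<lambda>n. f n (-L)) \<longlonglongrightarrow> c" using point[of "-L"] by (auto simp: Cauchy_convergent_iff convergent_def)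
  \<comment> \<open>The limit of the square integrable part is overwritten at the end points, which
    the open interval does not see, so as to carry the limits of the boundary values.\<close>
  define u where "u = (\<lambda>x. if x = 0 then a else if x = -L then c else g x)"
  have u_in: "u x = g x" if "x \<in> {-L<..<0}" for x using that by (auto simp: u_def)
  have "u \<in> X"
  proof (rule X_I)
    show "u \<in> borel_measurable M" using g(1) by (subst measurable_cong[of _ _ g]) (auto simp: u_in)
    show "integrable M (\<lambda>x. (u x)\<^sup>2)"
      using g(2) by (subst Bochner_Integration.integrable_cong[of _ M _ "\<lambda>x. (g x)\<^sup>2"]) (auto simp: u_in)
  qed
  moreover have "(\<lambda>n. X_norm \<epsilon> L (\<lambda>x. f n x - u x)) \<longlonglongrightarrow> 0"
  proof -
    have i: "(\<integral>x. (f n x - u x)\<^sup>2 \<partial>M) = (\<integral>x. (f n x - g x)\<^sup>2 \<partial>M)" for n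
      by (rule Bochner_Integration.integral_cong) (auto simp: u_in)
    have "(\<lambda>n. (\<integral>x. (f n x - g x)\<^sup>2 \<partial>M) + \<epsilon> * ((f n 0 - a)\<^sup>2 + (f n (-L) - c)\<^sup>2))
        \<longlonglongrightarrow> 0 + \<epsilon> * ((a - a)\<^sup>2 + (c - c)\<^sup>2)"
      by (intro tendsto_intros g(3) a c)
    then have "(\<lambda>n. (X_norm \<epsilon> L (\<lambda>x. f n x - u x))\<^sup>2) \<longlonglongrightarrow> 0"
      unfolding X_norm_sq i using L_pos by (simp add: u_def)
    then show ?thesis by simp
  qed
  ultimately show thesis by (rule that)
qed

sublocale X: semi_inner_space X wip
proof
  show "(\<lambda>_. 0) \<in> X" by (rule X_continuous) simp
  show "(\<lambda>x. a * u x + b * v x) \<in> X" if "u \<in> X" "v \<in> X" for u v a b using that by (rule X_lin)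
  show "wip u v = wip v u" for u v by (simp add: wip_def mult.commute)
  show "wip (\<lambda>x. a * u x + b * v x) z = a * wip u z + b * wip v z"
    if "u \<in> X" "v \<in> X" "z \<in> X" for u v z a b
  proof -
    have "(\<integral>x. wt x * ((a * u x + b * v x) * z x) \<partial>M)
        = (\<integral>x. a * (wt x * (u x * z x)) + b * (wt x * (v x * z x)) \<partial>M)"
      by (rule Bochner_Integration.integral_cong) (auto simp: algebra_simps)
    also have "\<dots> = a * (\<integral>x. wt x * (u x * z x) \<partial>M) + b * (\<integral>x. wt x * (v x * z x) \<partial>M)"
      using wip_integrable[OF that(1,3)] wip_integrable[OF that(2,3)] by simp
    finally show ?thesis by (simp add: wip_def algebra_simps)
  qed
  show "0 \<le> wip u u" if "u \<in> X" for u using X_norm_le_wip[OF that] by (meson order_trans zero_le_power2)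
qed

lemma X_norm_le_nrm: "u \<in> X \<Longrightarrow> X_norm \<epsilon> L u \<le> X.nrm u"
  by (rule power2_le_imp_le) (auto simp: X.nrm_sq X_norm_le_wip)

lemma nrm_le_X_norm: "u \<in> X \<Longrightarrow> X.nrm u \<le> sqrt (wt (-L)) * X_norm \<epsilon> L u"
  by (rule power2_le_imp_le) (auto simp: X.nrm_sq power_mult_distrib less_imp_le wip_le_X_norm X_norm_nonneg)

sublocale X: semi_hilbert X wip
proof
  fix f :: "nat \<Rightarrow> real \<Rightarrow> real"
  assume f: "\<And>n. f n \<in> X"
    and cauchy: "\<And>r. r > 0 \<Longrightarrow> \<exists>N. \<forall>m\<ge>N. \<forall>n\<ge>N. X.dst (f m) (f n) < r"
  have "X_norm \<epsilon> L (\<lambda>x. f m x - f n x) \<le> X.dst (f m) (f n)" for m n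
    unfolding X.dst_def by (intro X_norm_le_nrm X.diff_closed f)
  then have "\<exists>N. \<forall>m\<ge>N. \<forall>n\<ge>N. X_norm \<epsilon> L (\<lambda>x. f m x - f n x) < r" if "r > 0" for r
    using cauchy[OF that] by (meson order_le_less_trans)
  from L2_complete_boundary[OF f this] obtain u
    where u: "u \<in> X" "(\<lambda>n. X_norm \<epsilon> L (\<lambda>x. f n x - u x)) \<longlonglongrightarrow> 0" by blast
  have "(\<lambda>n. X.dst (f n) u) \<longlonglongrightarrow> 0"
  proof (rule tendsto_0_le_real)
    show "(\<lambda>n. sqrt (wt (-L)) * X_norm \<epsilon> L (\<lambda>x. f n x - u x)) \<longlonglongrightarrow> 0"
      by (rule tendsto_mult_right_zero[OF u(2)])
    show "\<forall>\<^sub>F n in sequentially. 0 \<le> X.dst (f n) u \<and> X.dst (f n) u \<le> sqrt (wt (-L)) * X_norm \<epsilon> L (\<lambda>x. f n x - u x)"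
      unfolding X.dst_def by (intro always_eventually allI conjI nrm_le_X_norm X.nrm_nonneg X.diff_closed f u)
  qed
  with u show "\<exists>u\<in>X. (\<lambda>n. X.dst (f n) u) \<longlonglongrightarrow> 0" by blast
qed


section \<open>The Green operator\<close>

text \<open>\<open>ker x\<close> is the Green function of the generator: \<open>green f\<close> solves \<open>- A u = f\<close>.\<close>

definition ker :: "real \<Rightarrow> real \<Rightarrow> real" where
  "ker x s = exp (min x s / \<epsilon>)"

definition green :: "(real \<Rightarrow> real) \<Rightarrow> real \<Rightarrow> real" where
  "green f x = wip f (ker x)"

definition nrm1 :: real where
  "nrm1 = X.nrm (\<lambda>_. 1)"

lemma one_X: "(\<lambda>_. 1) \<in> X"
  by (rule X_continuous) simp

lemma nrm1_nonneg: "0 \<le> nrm1"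
  unfolding nrm1_def by (rule X.nrm_nonneg[OF one_X])

lemma ker_X: "ker x \<in> X"
  unfolding ker_def by (rule X_continuous) (intro continuous_intros, use eps_pos in auto)

lemma ker_nonneg: "0 \<le> ker x s"
  by (simp add: ker_def)

lemma ker_le_1: "s \<le> 0 \<Longrightarrow> ker x s \<le> 1"
  using eps_pos by (auto simp: ker_def divide_le_0_iff min_def)

lemma nrm_le_sup:
  assumes u: "u \<in> X" and bound: "\<And>x. x \<in> {-L..0} \<Longrightarrow> \<bar>u x\<bar> \<le> c"
  shows "X.nrm u \<le> c * nrm1"
proof (rule power2_le_imp_le)
  have c: "0 \<le> c" using bound[of 0] L_pos by (meson abs_ge_zero atLeastAtMost_iff le_minus_iff less_imp_le neg_0_le_iff_le order_refl order_trans)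
  have sq: "u x * u x \<le> c\<^sup>2" if "x \<in> {-L..0}" for x
    using power_mono[OF bound[OF that] abs_ge_zero, of 2] by (simp add: power2_eq_square)
  have "(\<integral>x. wt x * (u x * u x) \<partial>M) \<le> (\<integral>x. c\<^sup>2 * (wt x * (1 * 1)) \<partial>M)"
  proof (rule integral_mono)
    show "integrable M (\<lambda>x. wt x * (u x * u x))" by (rule wip_integrable[OF u u])
    show "integrable M (\<lambda>x. c\<^sup>2 * (wt x * (1 * 1)))"
      using wip_integrable[OF one_X one_X] by simp
    fix x assume "x \<in> space M"
    then show "wt x * (u x * u x) \<le> c\<^sup>2 * (wt x * (1 * 1))"
      using sq[of x] by simp
  qed
  moreover have "\<epsilon> * (u 0 * u 0 + wt (-L) * (u (-L) * u (-L))) \<le> \<epsilon> * (c\<^sup>2 * 1 + wt (-L) * (c\<^sup>2 * 1))"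
    using eps_pos sq[of 0] sq[of "-L"] L_pos by (intro mult_left_mono add_mono) (auto simp: less_imp_le)
  ultimately have "wip u u \<le> c\<^sup>2 * wip (\<lambda>_. 1) (\<lambda>_. 1)"
    by (simp add: wip_def algebra_simps)
  then show "(X.nrm u)\<^sup>2 \<le> (c * nrm1)\<^sup>2"
    using u one_X by (simp add: power_mult_distrib nrm1_def X.nrm_sq)
  show "0 \<le> c * nrm1" using c nrm1_nonneg by simp
qed

lemma nrm_ker: "X.nrm (ker x) \<le> nrm1"
  using nrm_le_sup[OF ker_X[of x], of 1] ker_le_1 ker_nonneg by (simp add: abs_le_iff order_trans[OF _ ker_nonneg])

lemma exp_lipschitz_nonpos:
  fixes a b :: real
  assumes "a \<le> 0" "b \<le> 0"
  shows "\<bar>exp a - exp b\<bar> \<le> \<bar>a - b\<bar>"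
proof -
  have main: "exp b - exp a \<le> b - a" if "a \<le> b" "b \<le> 0" for a b :: real
  proof -
    have "exp b - exp a = exp b * (1 - exp (a - b))" by (simp add: algebra_simps mult_exp_exp)
    also have "\<dots> \<le> exp b * (b - a)"
    proof (rule mult_left_mono)
      show "1 - exp (a - b) \<le> b - a" using exp_ge_add_one_self[of "a - b"] by linarith
    qed simp
    also have "\<dots> \<le> 1 * (b - a)" using that by (intro mult_right_mono) auto
    finally show ?thesis by simp
  qed
  show ?thesis using main[of a b] main[of b a] assms
    by (cases "a \<le> b") (auto simp: abs_if)
qed

lemma ker_lipschitz: "s \<le> 0 \<Longrightarrow> \<bar>ker x s - ker y s\<bar> \<le> \<bar>x - y\<bar> / \<epsilon>"
proof -
  assume s: "s \<le> 0"
  have "\<bar>ker x s - ker y s\<bar> \<le> \<bar>min x s / \<epsilon> - min y s / \<epsilon>\<bar>"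
    unfolding ker_def using s eps_pos by (intro exp_lipschitz_nonpos) (auto simp: divide_le_0_iff min_def)
  also have "\<dots> = \<bar>min x s - min y s\<bar> / \<epsilon>"
    using eps_pos by (simp add: diff_divide_distrib[symmetric] abs_divide)
  also have "\<dots> \<le> \<bar>x - y\<bar> / \<epsilon>" using eps_pos by (intro divide_right_mono) (auto simp: min_def abs_if)
  finally show ?thesis .
qed

lemma green_bound: "f \<in> X \<Longrightarrow> \<bar>green f x\<bar> \<le> X.nrm f * nrm1"
proof -
  assume f: "f \<in> X"
  have "\<bar>green f x\<bar> \<le> X.nrm f * X.nrm (ker x)" unfolding green_def by (rule X.cauchy_schwarz[OF f ker_X])
  also have "\<dots> \<le> X.nrm f * nrm1" using f nrm_ker by (intro mult_left_mono) auto
  finally show ?thesis .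
qed

text \<open>The Lipschitz constant depends on \<open>f\<close> only through its norm, so images of
  bounded sets are equicontinuous; compactness rests on this.\<close>

lemma green_lipschitz: "f \<in> X \<Longrightarrow> \<bar>green f x - green f y\<bar> \<le> X.nrm f * nrm1 / \<epsilon> * \<bar>x - y\<bar>"
proof -
  assume f: "f \<in> X"
  have d: "(\<lambda>s. ker x s - ker y s) \<in> X" by (rule X.diff_closed[OF ker_X ker_X])
  have "\<bar>green f x - green f y\<bar> = \<bar>wip f (\<lambda>s. ker x s - ker y s)\<bar>"
    unfolding green_def by (simp add: X.ip_diff_right ker_X f)
  also have "\<dots> \<le> X.nrm f * X.nrm (\<lambda>s. ker x s - ker y s)" by (rule X.cauchy_schwarz[OF f d])
  also have "\<dots> \<le> X.nrm f * (\<bar>x - y\<bar> / \<epsilon> * nrm1)"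
    using f by (intro mult_left_mono nrm_le_sup d ker_lipschitz) auto
  finally show ?thesis by (simp add: mult_ac)
qed

lemma green_continuous: "f \<in> X \<Longrightarrow> continuous_on S (green f)"
proof -
  assume f: "f \<in> X"
  have "(X.nrm f * nrm1 / \<epsilon>)-lipschitz_on UNIV (green f)"
    using green_lipschitz[OF f] f nrm1_nonneg eps_pos by (intro lipschitz_onI) (auto simp: dist_real_def)
  then show ?thesis using lipschitz_on_continuous_on continuous_on_subset by blast
qed

lemma green_X: "f \<in> X \<Longrightarrow> green f \<in> X"
  by (rule X_continuous[OF green_continuous])

lemma green_lin: "u \<in> X \<Longrightarrow> v \<in> X \<Longrightarrow> green (\<lambda>x. a * u x + b * v x) = (\<lambda>x. a * green u x + b * green v x)"
  unfolding green_def by (simp add: X.ip_lin ker_X)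

text \<open>The images are equal as functions, not just as classes. This is what turns an
  eigenvector up to null distance into an eigenfunction satisfying its equation at every
  point.\<close>

lemma green_null: "u \<in> X \<Longrightarrow> v \<in> X \<Longrightarrow> X.dst u v = 0 \<Longrightarrow> green u = green v"
  unfolding green_def by (rule ext, rule X.ip_null) (auto intro: ker_X)

lemma green_nrm: "f \<in> X \<Longrightarrow> X.nrm (green f) \<le> nrm1 * nrm1 * X.nrm f"
  using nrm_le_sup[OF green_X green_bound, of f] by (simp add: mult_ac)

text \<open>Arzela-Ascoli on the closed interval; uniform convergence there, end points included,
  dominates the weighted norm through \<open>nrm_le_sup\<close>.\<close>

lemma green_compact:
  fixes f :: "nat \<Rightarrow> real \<Rightarrow> real"
  assumes f: "\<And>n. f n \<in> X" "\<And>n. X.nrm (f n) \<le> 1"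
  shows "\<exists>g\<in>X. \<exists>r. strict_mono r \<and> (\<lambda>n. X.dst (green (f (r n))) g) \<longlonglongrightarrow> 0"
proof -
  define F where "F n = green (f n)" for n
  have bound: "norm (F n x) \<le> nrm1" for n x
  proof -
    have "\<bar>F n x\<bar> \<le> X.nrm (f n) * nrm1" unfolding F_def by (rule green_bound[OF f(1)])
    also have "\<dots> \<le> 1 * nrm1" using f nrm1_nonneg by (intro mult_right_mono) auto
    finally show ?thesis by simp
  qed
  \<comment> \<open>The summand 1 makes \<open>c\<close> positive from nonnegativity of
    \<open>nrm1\<close> alone, so that one may divide by it; likewise in \<open>d\<close>
    below.\<close>
  define c where "c = nrm1 / \<epsilon> + 1"
  have c: "c > 0" using nrm1_nonneg eps_pos by (simp add: c_def add_nonneg_pos)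
  have lip: "norm (F n x - F n y) \<le> c * norm (x - y)" for n x y
  proof -
    have "\<bar>F n x - F n y\<bar> \<le> X.nrm (f n) * nrm1 / \<epsilon> * \<bar>x - y\<bar>" unfolding F_def by (rule green_lipschitz[OF f(1)])
    also have "X.nrm (f n) * nrm1 / \<epsilon> \<le> 1 * nrm1 / \<epsilon>"
      using f nrm1_nonneg eps_pos by (intro divide_right_mono mult_right_mono) auto
    also have "\<dots> \<le> c" by (simp add: c_def)
    finally show ?thesis by (simp add: mult_right_mono)
  qed
  obtain g r where g: "continuous_on {-L..0} g" and r: "strict_mono (r :: nat \<Rightarrow> nat)"
    and lim: "\<And>e. 0 < e \<Longrightarrow> \<exists>N. \<forall>n x. n \<ge> N \<and> x \<in> {-L..0} \<longrightarrow> norm (F (r n) x - g x) < e"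
  proof (rule Arzela_Ascoli[of "{-L..0}" F nrm1])
    fix x e :: real assume e: "0 < e"
    have "norm (F n x - F n y) < e" if "norm (x - y) < e / c" for n y
      using lip[of n x y] that c by (simp add: field_simps)
    then show "\<exists>d. 0 < d \<and> (\<forall>n y. y \<in> {-L..0} \<and> norm (x - y) < d \<longrightarrow> norm (F n x - F n y) < e)"
      using e c by (intro exI[of _ "e / c"]) auto
  qed (use bound in auto)
  have gX: "g \<in> X" using g by (rule X_continuous)
  have "(\<lambda>n. X.dst (F (r n)) g) \<longlonglongrightarrow> 0"
  proof (rule LIMSEQ_I)
    fix e :: real assume e: "0 < e"
    define d where "d = e / (nrm1 + 1)"
    have d: "d > 0" "d * nrm1 < e" using e nrm1_nonneg by (auto simp: d_def field_simps)
    obtain N where N: "\<And>n x. n \<ge> N \<Longrightarrow> x \<in> {-L..0} \<Longrightarrow> norm (F (r n) x - g x) < d"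
      using lim[OF d(1)] by blast
    have V: "(\<lambda>x. F (r n) x - g x) \<in> X" for n
      unfolding F_def by (intro X.diff_closed green_X f gX)
    have "norm (X.dst (F (r n)) g - 0) < e" if "n \<ge> N" for n
    proof -
      have "X.dst (F (r n)) g \<le> d * nrm1"
        unfolding X.dst_def by (rule nrm_le_sup[OF V]) (use N[OF that] in \<open>simp add: less_imp_le\<close>)
      then show ?thesis using d X.nrm_nonneg[OF V, of n] by (simp add: X.dst_def)
    qed
    then show "\<exists>no. \<forall>n\<ge>no. norm (X.dst (F (r n)) g - 0) < e" by blast
  qed
  with gX r show ?thesis unfolding F_def by blast
qed

section \<open>Symmetry of the Green operator\<close>

lemma green_split:
  assumes f: "f \<in> X" and x: "x \<in> {-L..0}"
  shows "green f x = (\<integral>s. wt s * (f s * ker x s) \<partial>M) + \<epsilon> * (f 0 * exp (x / \<epsilon>) + f (-L))"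
proof -
  have "min x 0 = x" "min x (-L) = -L" using x by auto
  then show ?thesis by (simp add: green_def wip_def ker_def wt_def mult_exp_exp)
qed

text \<open>Fubini with the symmetric kernel; integrability on the product follows since the kernel
  lies between 0 and 1 for nonpositive arguments.\<close>

lemma kernel_integral_symmetric:
  assumes a: "integrable M a" and c: "integrable M c"
  shows "(\<integral>x. a x * (\<integral>s. c s * ker x s \<partial>M) \<partial>M) = (\<integral>x. c x * (\<integral>s. a s * ker x s \<partial>M) \<partial>M)"
proof -
  interpret finite_measure M by (rule finite_M)
  interpret pair_sigma_finite M M by unfold_locales
  have [measurable]: "a \<in> borel_measurable M" "c \<in> borel_measurable M" using a c by auto
  have [measurable]: "(\<lambda>x::real. x) \<in> borel_measurable M" by (intro continuous_measurable continuous_intros)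
  have [measurable]: "(\<lambda>(x, s). ker x s) \<in> borel_measurable (M \<Otimes>\<^sub>M M)" unfolding ker_def by measurable
  have int: "integrable (M \<Otimes>\<^sub>M M) (\<lambda>(x, s). a x * c s)"
  proof (rule Fubini_integrable)
    show "integrable M (\<lambda>x. \<integral>y. norm (case (x, y) of (x, s) \<Rightarrow> a x * c s) \<partial>M)"
      using a by (simp add: abs_mult)
  qed (use c in auto)
  have "integrable (M \<Otimes>\<^sub>M M) (\<lambda>(x, s). a x * c s * ker x s)"
  proof (rule Bochner_Integration.integrable_bound[OF int])
    show "AE p in M \<Otimes>\<^sub>M M. norm (case p of (x, s) \<Rightarrow> a x * c s * ker x s) \<le> norm (case p of (x, s) \<Rightarrow> a x * c s)"
    proof (rule AE_I2)
      fix p assume "p \<in> space (M \<Otimes>\<^sub>M M)"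
      then obtain x s where p: "p = (x, s)" "s \<le> 0" by (cases p) (auto simp: space_pair_measure)
      then show "norm (case p of (x, s) \<Rightarrow> a x * c s * ker x s) \<le> norm (case p of (x, s) \<Rightarrow> a x * c s)"
        using ker_le_1[of s x] ker_nonneg[of x s] by (simp add: abs_mult mult_left_le)
    qed
  qed measurable
  from Fubini_integral[OF this]
  have "(\<integral>s. \<integral>x. a x * c s * ker x s \<partial>M \<partial>M) = (\<integral>x. \<integral>s. a x * c s * ker x s \<partial>M \<partial>M)" .
  moreover have "(\<integral>s. a x * c s * ker x s \<partial>M) = a x * (\<integral>s. c s * ker x s \<partial>M)" for x
    by (simp add: mult.assoc)
  moreover have "(\<integral>x. a x * c s * ker x s \<partial>M) = c s * (\<integral>x. a x * ker s x \<partial>M)" for s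
  proof -
    have "(\<lambda>x. a x * c s * ker x s) = (\<lambda>x. c s * (a x * ker s x))"
      by (auto simp: ker_def min.commute)
    then show ?thesis by simp
  qed
  ultimately show ?thesis by simp
qed

text \<open>All terms are arranged so that exchanging \<open>f\<close> and \<open>g\<close> visibly
  permutes them, except for the double integral, which is left to Fubini. The cancellation
  \<open>wt x * exp (x / \<epsilon>) = 1\<close> produces the unweighted single integrals.\<close>

lemma wip_green_expand:
  assumes f: "f \<in> X" and g: "g \<in> X"
  shows "wip (green f) g =
      (\<integral>x. (wt x * g x) * (\<integral>s. (wt s * f s) * ker x s \<partial>M) \<partial>M)
      + \<epsilon> * (f 0 * (\<integral>x. g x \<partial>M) + f (-L) * (\<integral>x. wt x * g x \<partial>M)
           + g 0 * (\<integral>x. f x \<partial>M) + g (-L) * (\<integral>x. wt x * f x \<partial>M))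
      + \<epsilon>\<^sup>2 * (f 0 * g 0 + f (-L) * g 0 + f 0 * g (-L) + wt (-L) * (f (-L) * g (-L)))"
proof -
  have intX: "integrable M f" if "f \<in> X" for f
    using X_integrable_mult[OF that one_X] by simp
  have e: "wt x * exp (x / \<epsilon>) = 1" for x by (simp add: wt_def mult_exp_exp)
  define J where "J x = (\<integral>s. (wt s * f s) * ker x s \<partial>M)" for x
  have J: "green f x = J x + \<epsilon> * (f 0 * exp (x / \<epsilon>) + f (-L))" if "x \<in> {-L..0}" for x
    using green_split[OF f that] by (simp add: J_def mult.assoc)
  have iG: "integrable M (\<lambda>x. wt x * (green f x * g x))" by (rule wip_integrable[OF green_X[OF f] g])
  have i1: "integrable M g" "integrable M (\<lambda>x. wt x * g x)" using intX[OF g] wt_integrable by auto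
  have eq: "wt x * (green f x * g x) - \<epsilon> * f 0 * g x - \<epsilon> * f (-L) * (wt x * g x) = (wt x * g x) * J x"
    if "x \<in> {-L..0}" for x
  proof -
    have "wt x * (green f x * g x) = (wt x * g x) * J x + \<epsilon> * f 0 * ((wt x * exp (x / \<epsilon>)) * g x) + \<epsilon> * f (-L) * (wt x * g x)"
      unfolding J[OF that] by (simp add: algebra_simps)
    then show ?thesis unfolding e by simp
  qed
  have "(\<integral>x. (wt x * g x) * J x \<partial>M) = (\<integral>x. wt x * (green f x * g x) - \<epsilon> * f 0 * g x - \<epsilon> * f (-L) * (wt x * g x) \<partial>M)"
    by (rule Bochner_Integration.integral_cong) (use eq in auto)
  also have "\<dots> = (\<integral>x. wt x * (green f x * g x) \<partial>M) - \<epsilon> * f 0 * (\<integral>x. g x \<partial>M) - \<epsilon> * f (-L) * (\<integral>x. wt x * g x \<partial>M)"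
    using iG i1 by simp
  finally have I: "(\<integral>x. wt x * (green f x * g x) \<partial>M)
      = (\<integral>x. (wt x * g x) * J x \<partial>M) + \<epsilon> * f 0 * (\<integral>x. g x \<partial>M) + \<epsilon> * f (-L) * (\<integral>x. wt x * g x \<partial>M)"
    by simp
  have J0: "J 0 = (\<integral>x. f x \<partial>M)"
    unfolding J_def
  proof (rule Bochner_Integration.integral_cong)
    fix s assume "s \<in> space M"
    then have "ker 0 s = exp (s / \<epsilon>)" by (simp add: ker_def)
    then show "wt s * f s * ker 0 s = f s" using e[of s] by (simp add: mult.commute mult.left_commute)
  qed simp
  have JL: "wt (-L) * J (-L) = (\<integral>x. wt x * f x \<partial>M)"
  proof -
    have "J (-L) = (\<integral>s. (wt s * f s) * exp (-L / \<epsilon>) \<partial>M)"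
      unfolding J_def by (rule Bochner_Integration.integral_cong) (auto simp: ker_def min_def)
    then show ?thesis using e[of "-L"] by (simp add: mult.left_commute)
  qed
  have g0: "green f 0 = J 0 + \<epsilon> * (f 0 + f (-L))" using J[of 0] L_pos by simp
  have gL: "wt (-L) * green f (-L) = wt (-L) * J (-L) + \<epsilon> * (f 0 + wt (-L) * f (-L))"
    using J[of "-L"] L_pos e[of "-L"] by (simp add: algebra_simps)
  have "wip (green f) g = (\<integral>x. wt x * (green f x * g x) \<partial>M) + \<epsilon> * (green f 0 * g 0 + (wt (-L) * green f (-L)) * g (-L))"
    by (simp add: wip_def mult.assoc)
  also have "\<dots> = (\<integral>x. (wt x * g x) * J x \<partial>M) + \<epsilon> * f 0 * (\<integral>x. g x \<partial>M) + \<epsilon> * f (-L) * (\<integral>x. wt x * g x \<partial>M)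
      + \<epsilon> * (((\<integral>x. f x \<partial>M) + \<epsilon> * (f 0 + f (-L))) * g 0 + ((\<integral>x. wt x * f x \<partial>M) + \<epsilon> * (f 0 + wt (-L) * f (-L))) * g (-L))"
    unfolding I g0 gL J0 JL ..
  finally show ?thesis unfolding J_def[symmetric] by (simp add: algebra_simps power2_eq_square)
qed

lemma green_symmetric:
  assumes f: "f \<in> X" and g: "g \<in> X"
  shows "wip (green f) g = wip f (green g)"
proof -
  have i: "integrable M (\<lambda>x. wt x * u x)" if "u \<in> X" for u
    using wip_integrable[OF that one_X] by simp
  have "wip (green f) g = wip (green g) f"
    unfolding wip_green_expand[OF f g] wip_green_expand[OF g f]
      kernel_integral_symmetric[OF i[OF g] i[OF f]] by (simp add: algebra_simps)
  then show ?thesis using X.ip_commute[OF green_X[OF g] f] by simp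
qed

section \<open>Injectivity of the Green operator\<close>

lemma null_AE:
  assumes u: "u \<in> X" and null: "X.nrm u = 0"
  shows "u 0 = 0" "u (-L) = 0" "AE x in M. u x = 0"
proof -
  have "wip u u = 0" using X.ip_self_zero_iff[OF u] null by blast
  then have "(X_norm \<epsilon> L u)\<^sup>2 \<le> 0" using X_norm_le_wip[OF u] by linarith
  then have z: "(\<integral>x. (u x)\<^sup>2 \<partial>M) + \<epsilon> * ((u 0)\<^sup>2 + (u (-L))\<^sup>2) \<le> 0" unfolding X_norm_sq .
  have p: "0 \<le> \<epsilon> * (u 0)\<^sup>2" "0 \<le> \<epsilon> * (u (-L))\<^sup>2" using eps_pos by auto
  have "\<epsilon> * (u 0)\<^sup>2 = 0" "\<epsilon> * (u (-L))\<^sup>2 = 0" and i: "(\<integral>x. (u x)\<^sup>2 \<partial>M) = 0"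
    using z p square_integral_nonneg[of u] unfolding distrib_left by linarith+
  then show "u 0 = 0" "u (-L) = 0" using eps_pos by auto
  show "AE x in M. u x = 0"
    using integral_nonneg_eq_0_iff_AE[OF X_integrable_square[OF u]] i by simp
qed

lemma AE_zero_continuous:
  fixes f :: "real \<Rightarrow> real"
  assumes cont: "continuous_on {-L<..<0} f" and ae: "AE x in M. f x = 0" and x: "x \<in> {-L<..<0}"
  shows "f x = 0"
proof (rule ccontr)
  assume nz: "f x \<noteq> 0"
  let ?U = "{-L<..<0} \<inter> f -` (- {0})"
  have op: "open ?U" by (rule continuous_open_preimage[OF cont]) (simp_all add: open_Compl)
  have "negligible ?U"
  proof -
    have ae': "AE x in lebesgue. x \<in> {-L<..<0} \<longrightarrow> f x = 0" using ae by (subst (asm) AE_restrict_space_iff) auto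
    have e: "{y \<in> space lebesgue. \<not> (y \<in> {-L<..<0} \<longrightarrow> f y = 0)} = ?U" by auto
    have "?U \<in> sets lebesgue" using borel_open[OF op] by (intro sets_completionI_sets) simp
    from AE_iff_null[OF this[folded e]] ae' have "?U \<in> null_sets lebesgue" unfolding e by (rule iffD1)
    then show ?thesis by (simp add: negligible_iff_null_sets)
  qed
  then have "?U = {}" using open_not_negligible op by blast
  with nz x show False by auto
qed


lemma indicator_measurable: "(\<lambda>x. indicator {y<..} x :: real) \<in> borel_measurable M"
  by (intro measurable_restrict_space1 measurable_completion) measurable

text \<open>Difference quotients of the kernel in its first variable converge to the indicator of a
  half line.\<close>

lemma green_zero_tail:
  assumes f: "f \<in> X" and zero: "\<And>x. x \<in> {-L..0} \<Longrightarrow> green f x = 0" and y: "-L \<le> y" "y < 0"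
  shows "(\<integral>x. wt x * f x * indicator {y<..} x \<partial>M) + \<epsilon> * f 0 = 0"
proof -
  define z where "z n = y + (- y) / real (Suc n)" for n
  have z: "y < z n" "z n \<le> 0" for n
  proof -
    show "y < z n" using y by (simp add: z_def field_simps)
    have "(- y) / real (Suc n) \<le> (- y) / 1" using y by (intro divide_left_mono) auto
    then show "z n \<le> 0" by (simp add: z_def)
  qed
  have z_lim: "z \<longlonglongrightarrow> y"
  proof -
    have "(\<lambda>n. y + (- y) / real (Suc n)) \<longlonglongrightarrow> y + 0"
      by (intro tendsto_add tendsto_const LIMSEQ_Suc[OF lim_const_over_n])
    then show ?thesis by (simp add: z_def[abs_def])
  qed
  define D where "D n = exp (z n / \<epsilon>) - exp (y / \<epsilon>)" for n
  have D: "D n > 0" for n using z[of n] eps_pos by (simp add: D_def divide_strict_right_mono)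
  \<comment> \<open>A ramp from 0 at \<open>y\<close> to 1 at \<open>z n\<close>, as
    \<open>D n\<close> is the total increase of the kernel difference. It vanishes at
    \<open>-L\<close> and equals 1 at 0, so the only boundary term left in
    \<open>wip f (\<phi> n)\<close> is \<open>\<epsilon> * f 0\<close>.\<close>
  define \<phi> where "\<phi> n s = (ker (z n) s - ker y s) / D n" for n s
  have \<phi>_low: "\<phi> n s = 0" if "s \<le> y" for n s using that z[of n] by (simp add: \<phi>_def ker_def min_def)
  have \<phi>_high: "\<phi> n s = 1" if "s \<ge> z n" for n s
    using that z[of n] D[of n] eps_pos by (simp add: \<phi>_def ker_def D_def min_def)
  have \<phi>_range: "0 \<le> \<phi> n s" "\<phi> n s \<le> 1" for n s
  proof -
    have "ker y s \<le> ker (z n) s" unfolding ker_def using z[of n] eps_pos by (auto simp: divide_right_mono)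
    then show "0 \<le> \<phi> n s" using D[of n] by (simp add: \<phi>_def)
    have "ker (z n) s - ker y s \<le> D n"
    proof (cases "s \<le> y")
      case True then show ?thesis using z[of n] D[of n] by (simp add: ker_def min_def)
    next
      case False
      then have "ker y s = exp (y / \<epsilon>)" by (simp add: ker_def)
      moreover have "ker (z n) s \<le> exp (z n / \<epsilon>)" using eps_pos by (simp add: ker_def divide_right_mono)
      ultimately show ?thesis by (simp add: D_def)
    qed
    then show "\<phi> n s \<le> 1" using D[of n] by (simp add: \<phi>_def)
  qed
  have \<phi>X: "\<phi> n \<in> X" for n
  proof -
    have "(\<lambda>s. (1 / D n) * (ker (z n) s - ker y s)) \<in> X"
      by (intro X.scale_closed X.diff_closed ker_X)
    then show ?thesis by (simp add: \<phi>_def[abs_def])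
  qed
  have "wip f (\<phi> n) = 0" for n
  proof -
    have "wip f (\<lambda>s. (1 / D n) * (ker (z n) s - ker y s)) = (1 / D n) * (green f (z n) - green f y)"
      unfolding green_def X.ip_scale_right[OF X.diff_closed[OF ker_X ker_X] f]
        X.ip_diff_right[OF ker_X ker_X f] ..
    also have "\<dots> = 0" using zero[of "z n"] zero[of y] z[of n] y by simp
    finally show ?thesis by (simp add: \<phi>_def[abs_def])
  qed
  moreover have "wip f (\<phi> n) = (\<integral>x. wt x * (f x * \<phi> n x) \<partial>M) + \<epsilon> * f 0" for n
    using \<phi>_high[of n 0] \<phi>_low[of "-L" n] z[of n] y by (simp add: wip_def)
  ultimately have c: "(\<integral>x. wt x * (f x * \<phi> n x) \<partial>M) + \<epsilon> * f 0 = 0" for n by simp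
  have "(\<lambda>n. \<integral>x. wt x * (f x * \<phi> n x) \<partial>M) \<longlonglongrightarrow> (\<integral>x. wt x * f x * indicator {y<..} x \<partial>M)"
  proof (rule integral_dominated_convergence[where w = "\<lambda>x. \<bar>wt x * (f x * 1)\<bar>"])
    show "integrable M (\<lambda>x. \<bar>wt x * (f x * 1)\<bar>)" by (intro integrable_abs wip_integrable f one_X)
    have m: "wt \<in> borel_measurable M" "f \<in> borel_measurable M" "\<phi> n \<in> borel_measurable M" for n
      using f \<phi>X X_measurable by auto
    show "(\<lambda>x. wt x * (f x * \<phi> n x)) \<in> borel_measurable M" for n by (intro borel_measurable_times m)
    show "(\<lambda>x. wt x * f x * indicator {y<..} x) \<in> borel_measurable M"
      by (intro borel_measurable_times m indicator_measurable)
    show "AE x in M. norm (wt x * (f x * \<phi> n x)) \<le> \<bar>wt x * (f x * 1)\<bar>" for n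
    proof (rule AE_I2)
      fix x
      have "\<bar>wt x * f x\<bar> * \<bar>\<phi> n x\<bar> \<le> \<bar>wt x * f x\<bar> * 1"
        using \<phi>_range[of n x] by (intro mult_left_mono) auto
      then show "norm (wt x * (f x * \<phi> n x)) \<le> \<bar>wt x * (f x * 1)\<bar>" by (simp add: abs_mult mult.assoc)
    qed
    show "AE x in M. (\<lambda>n. wt x * (f x * \<phi> n x)) \<longlonglongrightarrow> wt x * f x * indicator {y<..} x"
    proof (rule AE_I2)
      fix x
      have "(\<lambda>n. \<phi> n x) \<longlonglongrightarrow> indicator {y<..} x"
      proof (cases "y < x")
        case True
        have "\<forall>\<^sub>F n in sequentially. z n < x" using order_tendstoD(2)[OF z_lim True] .
        then have "\<forall>\<^sub>F n in sequentially. \<phi> n x = 1" by eventually_elim (simp add: \<phi>_high)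
        with True show ?thesis by (simp add: tendsto_eventually)
      qed (simp add: \<phi>_low)
      then have "(\<lambda>n. wt x * f x * \<phi> n x) \<longlonglongrightarrow> wt x * f x * indicator {y<..} x"
        by (rule tendsto_mult[OF tendsto_const])
      then show "(\<lambda>n. wt x * (f x * \<phi> n x)) \<longlonglongrightarrow> wt x * f x * indicator {y<..} x" by (simp only: mult.assoc)
    qed
  qed
  moreover have "(\<integral>x. wt x * (f x * \<phi> n x) \<partial>M) = - \<epsilon> * f 0" for n using c[of n] by simp
  ultimately have "(\<integral>x. wt x * f x * indicator {y<..} x \<partial>M) = - \<epsilon> * f 0"
    by (simp add: LIMSEQ_const_iff)
  then show ?thesis by simp
qed

text \<open>By continuity a null image vanishes everywhere, so the tail identity holds for every
  \<open>y < 0\<close>. Letting \<open>y\<close> tend to 0 isolates \<open>f 0\<close>; then all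
  tail integrals of \<open>wt * f\<close> vanish and \<open>f\<close> is 0 almost everywhere;
  finally \<open>green f (-L)\<close> reduces to \<open>\<epsilon> * f (-L)\<close>.\<close>

lemma green_injective:
  assumes f: "f \<in> X" and null: "X.nrm (green f) = 0"
  shows "X.nrm f = 0"
proof -
  have zero: "green f x = 0" if x: "x \<in> {-L..0}" for x
  proof -
    note n = null_AE[OF green_X[OF f] null]
    consider "x = 0" | "x = -L" | "x \<in> {-L<..<0}" using x by fastforce
    then show ?thesis
    proof cases
      case 3 then show ?thesis by (rule AE_zero_continuous[OF green_continuous[OF f] n(3)])
    qed (use n in simp_all)
  qed
  note tail = green_zero_tail[OF f zero]
  have fw: "integrable M (\<lambda>x. wt x * f x)" using wip_integrable[OF f one_X] by simp
  have f0: "f 0 = 0"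
  proof -
    \<comment> \<open>The tail identity is available only for \<open>-L \<le> y < 0\<close>, so 0 is
      approached from below starting at \<open>-L\<close>.\<close>
    define y where "y n = - L / real (Suc n)" for n
    have y: "-L \<le> y n" "y n < 0" for n
    proof -
      have "L / real (Suc n) \<le> L / 1" using L_pos by (intro divide_left_mono) auto
      then show "-L \<le> y n" by (simp add: y_def)
      show "y n < 0" using L_pos by (simp add: y_def divide_neg_pos)
    qed
    have y_lim: "y \<longlonglongrightarrow> 0" unfolding y_def by (intro LIMSEQ_Suc[OF lim_const_over_n])
    have "(\<lambda>n. \<integral>x. wt x * f x * indicator {y n<..} x \<partial>M) \<longlonglongrightarrow> (\<integral>x. 0 \<partial>M)"
    proof (rule integral_dominated_convergence[where w = "\<lambda>x. \<bar>wt x * f x\<bar>"])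
      show "integrable M (\<lambda>x. \<bar>wt x * f x\<bar>)" using fw by simp
      show "(\<lambda>x. wt x * f x * indicator {y n<..} x) \<in> borel_measurable M" for n
        by (intro borel_measurable_times indicator_measurable X_measurable f wt_measurable)
      show "AE x in M. norm (wt x * f x * indicator {y n<..} x) \<le> \<bar>wt x * f x\<bar>" for n
        by (rule AE_I2) (auto simp: indicator_def)
      show "AE x in M. (\<lambda>n. wt x * f x * indicator {y n<..} x) \<longlonglongrightarrow> 0"
      proof (rule AE_I2)
        fix x assume "x \<in> space M"
        then have "x < 0" by simp
        from order_tendstoD(1)[OF y_lim this]
        show "(\<lambda>n. wt x * f x * indicator {y n<..} x) \<longlonglongrightarrow> 0"
          by (intro tendsto_eventually) (erule eventually_mono, simp)
      qed
    qed simp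
    moreover have "(\<integral>x. wt x * f x * indicator {y n<..} x \<partial>M) = - \<epsilon> * f 0" for n using tail[OF _ y, of n] by simp
    ultimately show ?thesis using eps_pos by (simp add: LIMSEQ_const_iff)
  qed
  have tail0: "(\<integral>x. wt x * f x * indicator {y<..} x \<partial>M) = 0" for y
  proof (cases "y < -L")
    case True
    have "(\<integral>x. wt x * f x * indicator {y<..} x \<partial>M) = (\<integral>x. wt x * f x * indicator {-L<..} x \<partial>M)"
      by (rule Bochner_Integration.integral_cong) (use True in auto)
    then show ?thesis using tail[of "-L"] L_pos f0 by simp
  next
    case low: False
    show ?thesis
    proof (cases "y < 0")
      case True then show ?thesis using tail[of y] low f0 by simp
    next
      case False
      then have "(\<integral>x. wt x * f x * indicator {y<..} x \<partial>M) = (\<integral>x. 0 \<partial>M)"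
        by (intro Bochner_Integration.integral_cong) (auto simp: indicator_def)
      then show ?thesis by simp
    qed
  qed
  define h where "h x = indicator {-L<..<0} x * (wt x * f x)" for x
  have ae: "AE x in M. f x = 0"
  proof -
    have "AE x in lebesgue. h x = 0"
    proof (rule AE_zero_if_tail_integrals_zero_lebesgue)
      show "integrable lebesgue h"
        using fw integrable_restrict_space[of "{-L<..<0}" lebesgue "\<lambda>x. wt x * f x"] by (simp add: h_def[abs_def])
      show "(\<integral>x. h x * indicator {y<..} x \<partial>lebesgue) = 0" for y
        using tail0[of y] integral_restrict_space[of "{-L<..<0}" lebesgue "\<lambda>x. wt x * f x * indicator {y<..} x"]
        by (simp add: h_def mult.assoc)
    qed
    then have "AE x in lebesgue. x \<in> {-L<..<0} \<longrightarrow> f x = 0"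
    proof eventually_elim
      case (elim x)
      then show ?case using wt_pos[of x] by (auto simp: h_def)
    qed
    then show ?thesis by (subst AE_restrict_space_iff) auto
  qed
  have fL: "f (-L) = 0"
  proof -
    have "(\<integral>s. wt s * (f s * ker (-L) s) \<partial>M) = (\<integral>s. 0 \<partial>M)"
    proof (rule integral_cong_AE)
      show "AE s in M. wt s * (f s * ker (-L) s) = 0" using ae by eventually_elim simp
      show "(\<lambda>s. wt s * (f s * ker (-L) s)) \<in> borel_measurable M"
        using wip_integrable[OF f ker_X] by auto
    qed simp
    then have "green f (-L) = \<epsilon> * f (-L)" using green_split[OF f, of "-L"] L_pos f0 by simp
    then show ?thesis using zero[of "-L"] L_pos eps_pos by simp
  qed
  have "(\<integral>x. wt x * (f x * f x) \<partial>M) = (\<integral>x. 0 \<partial>M)"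
  proof (rule integral_cong_AE)
    show "AE x in M. wt x * (f x * f x) = 0" using ae by eventually_elim simp
    show "(\<lambda>x. wt x * (f x * f x)) \<in> borel_measurable M" using wip_integrable[OF f f] by auto
  qed simp
  then show ?thesis by (simp add: X.nrm_def wip_def f0 fL)
qed

section \<open>Eigenfunctions\<close>

text \<open>Equality of functions rather than of classes, so that eigenfunctions are continuous and
  their boundary values are limits from inside. The parameter belongs to the negated generator and
  is the reciprocal of the eigenvalue of \<open>green\<close>.\<close>

definition eig :: "real \<Rightarrow> (real \<Rightarrow> real) \<Rightarrow> bool" where
  "eig \<mu> e \<longleftrightarrow> e \<in> X \<and> e = (\<lambda>x. \<mu> * green e x)"

text \<open>The system with time derivative replaced by multiplication with \<open>- \<mu>\<close>,
  both in the equation and in the dynamic boundary conditions, written in first order form with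
  \<open>d\<close> for the derivative of \<open>e\<close>.\<close>

definition eig_ode :: "real \<Rightarrow> (real \<Rightarrow> real) \<Rightarrow> (real \<Rightarrow> real) \<Rightarrow> bool" where
  "eig_ode \<mu> e d \<longleftrightarrow>
     (\<forall>x\<in>{-L..0}. (e has_real_derivative d x) (at x within {-L..0})) \<and>
     (\<forall>x\<in>{-L..0}. (d has_real_derivative (d x - \<mu> * e x) / \<epsilon>) (at x within {-L..0})) \<and>
     d 0 = \<mu> * e 0 \<and> d (-L) = e (-L) * (1 / \<epsilon> - \<mu>)"

lemma eigX: "eig \<mu> e \<Longrightarrow> e \<in> X"
  by (simp add: eig_def)

lemma eig_eq: "eig \<mu> e \<Longrightarrow> e x = \<mu> * green e x"
  unfolding eig_def by metis

lemma eig_continuous: "eig \<mu> e \<Longrightarrow> continuous_on S e"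
proof -
  assume e: "eig \<mu> e"
  have "continuous_on S (\<lambda>x. \<mu> * green e x)" by (intro continuous_intros green_continuous eigX[OF e])
  moreover have "e = (\<lambda>x. \<mu> * green e x)" using e unfolding eig_def by (rule conjunct2)
  ultimately show ?thesis by (rule ssubst[rotated])
qed

lemma eig_lin: "eig \<mu> e \<Longrightarrow> eig \<mu> f \<Longrightarrow> eig \<mu> (\<lambda>x. a * e x + b * f x)"
proof -
  assume e: "eig \<mu> e" and f: "eig \<mu> f"
  show ?thesis unfolding eig_def green_lin[OF eigX[OF e] eigX[OF f]]
  proof
    show "(\<lambda>x. a * e x + b * f x) \<in> X" using e f by (intro X_lin eigX)
    show "(\<lambda>x. a * e x + b * f x) = (\<lambda>x. \<mu> * (a * green e x + b * green f x))"
      using eig_eq[OF e] eig_eq[OF f] by (auto simp: algebra_simps)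
  qed
qed

lemma M_integral_eq:
  fixes f :: "real \<Rightarrow> real"
  assumes "integrable M f" "(f has_integral i) {-L..0}"
  shows "(\<integral>x. f x \<partial>M) = i"
proof -
  have "(f has_integral (\<integral>x. f x \<partial>M)) {-L<..<0}"
    by (rule has_integral_integral_lebesgue_on[OF assms(1)]) simp
  then have "(f has_integral (\<integral>x. f x \<partial>M)) {-L..0}" by (simp add: has_integral_Icc_iff_Ioo)
  then show ?thesis using assms(2) has_integral_unique by blast
qed

lemma M_FTC:
  assumes F: "\<And>x. x \<in> {-L..0} \<Longrightarrow> (F has_real_derivative f x) (at x within {-L..0})" and f: "integrable M f"
  shows "(\<integral>x. f x \<partial>M) = F 0 - F (-L)"
proof (rule M_integral_eq[OF f])
  show "(f has_integral (F 0 - F (-L))) {-L..0}"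
    using L_pos F by (intro fundamental_theorem_of_calculus) (auto simp: has_real_derivative_iff_has_vector_derivative)
qed

text \<open>Splitting the integral at \<open>x\<close> resolves the minimum in the kernel: on the
  left, weight and kernel cancel; on the right, the kernel is constant. The result can be
  differentiated by the fundamental theorem of calculus.\<close>

lemma eig_formula:
  assumes e: "eig \<mu> e" and x: "x \<in> {-L..0}"
  shows "e x = \<mu> * (\<epsilon> * e (-L) + \<epsilon> * e 0 * exp (x / \<epsilon>)
    + integral {-L..x} e + exp (x / \<epsilon>) * integral {x..0} (\<lambda>s. wt s * e s))"
proof -
  let ?f = "\<lambda>s. wt s * (e s * ker x s)"
  have cont: "continuous_on S ?f" for S
    unfolding wt_def ker_def by (intro continuous_intros eig_continuous[OF e]) (use eps_pos in auto)
  have i1: "(?f has_integral integral {-L..x} e) {-L..x}"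
  proof (rule has_integral_eq)
    show "(e has_integral integral {-L..x} e) {-L..x}"
      by (intro integrable_integral integrable_continuous_real eig_continuous[OF e])
    fix s assume "s \<in> {-L..x}"
    then have "min x s = s" by auto
    then show "e s = wt s * (e s * ker x s)" by (simp add: wt_def ker_def mult_exp_exp mult.left_commute)
  qed
  have i2: "(?f has_integral exp (x / \<epsilon>) * integral {x..0} (\<lambda>s. wt s * e s)) {x..0}"
  proof (rule has_integral_eq)
    have "continuous_on {x..0} (\<lambda>s. wt s * e s)"
      unfolding wt_def by (intro continuous_intros eig_continuous[OF e]) (use eps_pos in auto)
    then show "((\<lambda>s. exp (x / \<epsilon>) * (wt s * e s)) has_integral exp (x / \<epsilon>) * integral {x..0} (\<lambda>s. wt s * e s)) {x..0}"
      by (intro has_integral_mult_right integrable_integral integrable_continuous_real)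
    fix s assume "s \<in> {x..0}"
    then have "min x s = x" by auto
    then show "exp (x / \<epsilon>) * (wt s * e s) = wt s * (e s * ker x s)" by (simp add: ker_def)
  qed
  have "(?f has_integral (integral {-L..x} e + exp (x / \<epsilon>) * integral {x..0} (\<lambda>s. wt s * e s))) {-L..0}"
    using x by (intro has_integral_combine[OF _ _ i1 i2]) auto
  from M_integral_eq[OF wip_integrable[OF eigX[OF e] ker_X] this] show ?thesis
    using eig_eq[OF e, of x] green_split[OF eigX[OF e] x] by (simp add: algebra_simps)
qed

lemma eig_ode_exists:
  assumes e: "eig \<mu> e"
  shows "\<exists>d. eig_ode \<mu> e d"
proof -
  define g where "g s = wt s * e s" for s
  have gc: "continuous_on S g" for S
    unfolding g_def wt_def by (intro continuous_intros eig_continuous[OF e]) (use eps_pos in auto)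
  define G where "G x = integral {-L..0} g - integral {-L..x} g" for x
  have G: "integral {x..0} g = G x" if "x \<in> {-L..0}" for x
    using Henstock_Kurzweil_Integration.integral_combine[of "-L" x 0 g, OF _ _ integrable_continuous_real[OF gc]] that
    by (auto simp: G_def)
  have dG: "(G has_real_derivative - g x) (at x within {-L..0})" if "x \<in> {-L..0}" for x
    unfolding G_def using integral_has_vector_derivative[OF gc that]
    by (auto intro!: derivative_eq_intros simp: has_real_derivative_iff_has_vector_derivative)
  have dE: "((\<lambda>x. integral {-L..x} e) has_real_derivative e x) (at x within {-L..0})" if "x \<in> {-L..0}" for x
    using integral_has_vector_derivative[OF eig_continuous[OF e] that]
    by (simp add: has_real_derivative_iff_has_vector_derivative)
  \<comment> \<open>What remains of the derivative of the formula after the two contributions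
    \<open>e x\<close> from the moving end points of the integrals cancel.\<close>
  define d where "d x = \<mu> * (exp (x / \<epsilon>) * (e 0 + G x / \<epsilon>))" for x
  have w: "exp (x / \<epsilon>) * g x = e x" for x by (simp add: g_def wt_def mult_exp_exp flip: mult.assoc)
  have form: "e x = \<mu> * (\<epsilon> * e (-L) + \<epsilon> * e 0 * exp (x / \<epsilon>) + integral {-L..x} e + exp (x / \<epsilon>) * G x)"
    if "x \<in> {-L..0}" for x
    using eig_formula[OF e that] G[OF that] by (simp add: g_def[abs_def])
  have "(e has_real_derivative d x) (at x within {-L..0})" if x: "x \<in> {-L..0}" for x
  proof (rule has_field_derivative_transform_within[OF _ zero_less_one x])
    show "\<mu> * (\<epsilon> * e (-L) + \<epsilon> * e 0 * exp (y / \<epsilon>) + integral {-L..y} e + exp (y / \<epsilon>) * G y) = e y"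
      if "y \<in> {-L..0}" for y using form[OF that] ..
    have "((\<lambda>y. \<mu> * (\<epsilon> * e (-L) + \<epsilon> * e 0 * exp (y / \<epsilon>) + integral {-L..y} e + exp (y / \<epsilon>) * G y))
       has_real_derivative \<mu> * (\<epsilon> * e 0 * (exp (x / \<epsilon>) * (1 / \<epsilon>)) + e x + (exp (x / \<epsilon>) * (1 / \<epsilon>) * G x + exp (x / \<epsilon>) * (- g x))))
       (at x within {-L..0})"
      using eps_pos by (auto intro!: derivative_eq_intros dG dE x simp: algebra_simps)
    also have "\<mu> * (\<epsilon> * e 0 * (exp (x / \<epsilon>) * (1 / \<epsilon>)) + e x + (exp (x / \<epsilon>) * (1 / \<epsilon>) * G x + exp (x / \<epsilon>) * (- g x))) = d x"
      using w[of x] eps_pos by (simp add: d_def algebra_simps)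
    finally show "((\<lambda>y. \<mu> * (\<epsilon> * e (-L) + \<epsilon> * e 0 * exp (y / \<epsilon>) + integral {-L..y} e + exp (y / \<epsilon>) * G y))
       has_real_derivative d x) (at x within {-L..0})" .
  qed
  moreover have "(d has_real_derivative (d x - \<mu> * e x) / \<epsilon>) (at x within {-L..0})" if x: "x \<in> {-L..0}" for x
  proof -
    have "(d has_real_derivative \<mu> * (exp (x / \<epsilon>) * (1 / \<epsilon>) * (e 0 + G x / \<epsilon>) + exp (x / \<epsilon>) * (- g x / \<epsilon>))) (at x within {-L..0})"
      unfolding d_def using eps_pos by (auto intro!: derivative_eq_intros dG x simp: field_simps)
    also have "\<mu> * (exp (x / \<epsilon>) * (1 / \<epsilon>) * (e 0 + G x / \<epsilon>) + exp (x / \<epsilon>) * (- g x / \<epsilon>)) = (d x - \<mu> * e x) / \<epsilon>"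
      unfolding d_def w[of x, symmetric] by (simp add: algebra_simps diff_divide_distrib add_divide_distrib)
    finally show ?thesis .
  qed
  moreover have "d 0 = \<mu> * e 0" by (simp add: d_def G_def)
  moreover have "d (-L) = e (-L) * (1 / \<epsilon> - \<mu>)"
  proof -
    have "e (-L) = \<mu> * (\<epsilon> * e (-L) + \<epsilon> * e 0 * exp (-L / \<epsilon>) + exp (-L / \<epsilon>) * G (-L))"
      using form[of "-L"] L_pos by simp
    also have "\<dots> = \<mu> * \<epsilon> * e (-L) + \<epsilon> * d (-L)" using eps_pos by (simp add: d_def algebra_simps)
    finally show ?thesis using eps_pos by (simp add: field_simps)
  qed
  ultimately show ?thesis unfolding eig_ode_def by blast
qed


lemma ode_continuous:
  assumes "eig_ode \<mu> e d"
  shows "continuous_on {-L..0} e" "continuous_on {-L..0} d"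
  using assms unfolding eig_ode_def continuous_on_eq_continuous_within
  by (meson DERIV_continuous)+

lemma integrable_continuous_M:
  fixes f :: "real \<Rightarrow> real"
  assumes "continuous_on {-L..0} f"
  shows "integrable M f"
  using X_integrable_mult[OF X_continuous[OF assms] one_X] by simp

text \<open>Integrating the derivative of \<open>\<epsilon> * wt * d * e\<close> identifies \<open>\<mu> * wip e e\<close> with the Dirichlet
  form.\<close>

lemma eig_nonneg:
  assumes e: "eig \<mu> e" and n: "X.nrm e = 1"
  shows "\<mu> > 0"
proof -
  obtain d where ode: "eig_ode \<mu> e d" using eig_ode_exists[OF e] by blast
  note c = ode_continuous[OF ode]
  have de: "(e has_real_derivative d x) (at x within {-L..0})"
    and dd: "(d has_real_derivative (d x - \<mu> * e x) / \<epsilon>) (at x within {-L..0})" if "x \<in> {-L..0}" for x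
    using ode that by (auto simp: eig_ode_def)
  have wc: "continuous_on S wt" for S unfolding wt_def by (intro continuous_intros) (use eps_pos in auto)
  have dw: "(wt has_real_derivative - wt x / \<epsilon>) (at x within {-L..0})" for x
    unfolding wt_def using eps_pos by (auto intro!: derivative_eq_intros)
  let ?F = "\<lambda>x. \<epsilon> * (wt x * (d x * e x))"
  have i1: "integrable M (\<lambda>x. \<epsilon> * (wt x * (d x)\<^sup>2))"
    by (intro integrable_continuous_M continuous_intros c wc)
  have i2: "integrable M (\<lambda>x. \<mu> * (wt x * (e x * e x)))"
    by (intro integrable_continuous_M continuous_intros c wc)
  have "(\<integral>x. \<epsilon> * (wt x * (d x)\<^sup>2) - \<mu> * (wt x * (e x * e x)) \<partial>M) = ?F 0 - ?F (-L)"
  proof (rule M_FTC)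
    fix x assume x: "x \<in> {-L..0}"
    have "(?F has_real_derivative \<epsilon> * ((- wt x / \<epsilon>) * (d x * e x) + wt x * ((d x - \<mu> * e x) / \<epsilon> * e x + d x * d x)))
        (at x within {-L..0})"
      by (auto intro!: derivative_eq_intros de dd dw x simp: algebra_simps)
    also have "\<epsilon> * ((- wt x / \<epsilon>) * (d x * e x) + wt x * ((d x - \<mu> * e x) / \<epsilon> * e x + d x * d x))
        = \<epsilon> * (wt x * (d x)\<^sup>2) - \<mu> * (wt x * (e x * e x))"
      using eps_pos by (simp add: field_simps power2_eq_square)
    finally show "(?F has_real_derivative \<epsilon> * (wt x * (d x)\<^sup>2) - \<mu> * (wt x * (e x * e x))) (at x within {-L..0})" .
  qed (use i1 i2 in simp)
  \<comment> \<open>At both ends the boundary conditions express \<open>d\<close> through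
    \<open>e\<close>; the terms containing \<mu> complete the boundary part of
    \<open>\<mu> * wip e e\<close>.\<close>
  moreover have "?F 0 - ?F (-L) = \<epsilon> * \<mu> * (e 0)\<^sup>2 - wt (-L) * (e (-L))\<^sup>2 + \<epsilon> * \<mu> * (wt (-L) * (e (-L))\<^sup>2)"
  proof -
    have d0: "d 0 = \<mu> * e 0" and "d (-L) = e (-L) * (1 / \<epsilon> - \<mu>)" using ode by (auto simp: eig_ode_def)
    then have dL: "\<epsilon> * d (-L) = e (-L) - \<epsilon> * \<mu> * e (-L)" using eps_pos by (simp add: field_simps)
    have "?F (-L) = wt (-L) * ((\<epsilon> * d (-L)) * e (-L))" by simp
    then show ?thesis unfolding dL d0 by (simp add: algebra_simps power2_eq_square)
  qed
  moreover have "(\<integral>x. \<epsilon> * (wt x * (d x)\<^sup>2) - \<mu> * (wt x * (e x * e x)) \<partial>M)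
      = (\<integral>x. \<epsilon> * (wt x * (d x)\<^sup>2) \<partial>M) - \<mu> * (\<integral>x. wt x * (e x * e x) \<partial>M)"
    using i1 i2 by simp
  ultimately have "\<mu> * wip e e = (\<integral>x. \<epsilon> * (wt x * (d x)\<^sup>2) \<partial>M) + wt (-L) * (e (-L))\<^sup>2"
    by (simp add: wip_def algebra_simps power2_eq_square)
  moreover have "0 \<le> (\<integral>x. \<epsilon> * (wt x * (d x)\<^sup>2) \<partial>M)"
    using eps_pos by (intro integral_nonneg_AE AE_I2) (auto simp: less_imp_le)
  moreover have "wip e e = 1" using n X.nrm_sq[OF eigX[OF e]] by simp
  ultimately have "0 \<le> \<mu>" by (simp add: less_imp_le)
  moreover have "\<mu> \<noteq> 0"
  proof
    assume "\<mu> = 0"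
    then have "e = (\<lambda>_. 0)" using e by (simp add: eig_def)
    then show False using n X.nrm_zero by simp
  qed
  ultimately show ?thesis by simp
qed

text \<open>The boundary condition at \<open>-L\<close> makes \<open>d (-L)\<close> vanish together
  with \<open>e (-L)\<close>, so all Cauchy data are 0. A Gronwall argument follows:
  \<open>?P\<close> is nonincreasing, nonnegative and starts at 0.\<close>

lemma eig_zero_boundary:
  assumes e: "eig \<mu> e" and zero: "e (-L) = 0" and x: "x \<in> {-L..0}"
  shows "e x = 0"
proof -
  obtain d where ode: "eig_ode \<mu> e d" using eig_ode_exists[OF e] by blast
  define q where "q = 1 - \<mu> / \<epsilon>"
  \<comment> \<open>The derivative of e^2 + d^2 is 2 q e d + (2 / \<epsilon>) d^2, and 2 |e d| is at
    most e^2 + d^2.\<close>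
  define C where "C = \<bar>q\<bar> + 2 / \<epsilon>"
  let ?P = "\<lambda>x. ((e x)\<^sup>2 + (d x)\<^sup>2) * exp (- C * x)"
  let ?P' = "\<lambda>x. (2 * q * (e x * d x) + 2 / \<epsilon> * (d x)\<^sup>2 - C * ((e x)\<^sup>2 + (d x)\<^sup>2)) * exp (- C * x)"
  have dP: "(?P has_real_derivative ?P' y) (at y within {-L..0})" if y: "y \<in> {-L..0}" for y
  proof -
    have de: "(e has_real_derivative d y) (at y within {-L..0})"
      and dd: "(d has_real_derivative (d y - \<mu> * e y) / \<epsilon>) (at y within {-L..0})"
      using ode y by (auto simp: eig_ode_def)
    have "(?P has_real_derivative (2 * e y * d y + 2 * d y * ((d y - \<mu> * e y) / \<epsilon>)) * exp (- C * y)
        + ((e y)\<^sup>2 + (d y)\<^sup>2) * (exp (- C * y) * - C)) (at y within {-L..0})"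
      by (auto intro!: derivative_eq_intros de dd)
    also have "(2 * e y * d y + 2 * d y * ((d y - \<mu> * e y) / \<epsilon>)) * exp (- C * y)
        + ((e y)\<^sup>2 + (d y)\<^sup>2) * (exp (- C * y) * - C) = ?P' y"
      using eps_pos by (simp add: q_def field_simps power2_eq_square)
    finally show ?thesis .
  qed
  have neg: "?P' y \<le> 0" for y
  proof -
    have "2 * q * (e y * d y) \<le> \<bar>q\<bar> * (2 * \<bar>e y\<bar> * \<bar>d y\<bar>)"
      using abs_ge_self[of "2 * q * (e y * d y)"] by (simp add: abs_mult mult_ac)
    also have "\<dots> \<le> \<bar>q\<bar> * ((e y)\<^sup>2 + (d y)\<^sup>2)"
      using sum_squares_bound[of "\<bar>e y\<bar>" "\<bar>d y\<bar>"] by (intro mult_left_mono) auto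
    finally have "2 * q * (e y * d y) \<le> \<bar>q\<bar> * ((e y)\<^sup>2 + (d y)\<^sup>2)" .
    moreover have "2 / \<epsilon> * (d y)\<^sup>2 \<le> 2 / \<epsilon> * ((e y)\<^sup>2 + (d y)\<^sup>2)"
      using eps_pos by (intro mult_left_mono) auto
    ultimately have "2 * q * (e y * d y) + 2 / \<epsilon> * (d y)\<^sup>2 - C * ((e y)\<^sup>2 + (d y)\<^sup>2) \<le> 0"
      unfolding C_def distrib_right by linarith
    then show ?thesis by (intro mult_nonpos_nonneg) auto
  qed
  have "?P x \<le> ?P (-L)"
  proof (cases "x = -L")
    case False
    then have lt: "-L < x" using x by auto
    have "\<exists>y\<in>{-L<..<x}. ?P x - ?P (-L) = (x - (-L)) * ?P' y"
    proof -
      have "\<exists>y\<in>{-L<..<x}. ?P x - ?P (-L) = ?P' y * (x - (-L))"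
      proof (rule mvt_simple[OF lt, of ?P "\<lambda>y h. ?P' y * h"])
        fix y assume "-L \<le> y" "y \<le> x"
        then have "y \<in> {-L..0}" using x by auto
        from dP[OF this] have "(?P has_real_derivative ?P' y) (at y within {-L..x})"
          by (rule has_field_derivative_subset) (use x in auto)
        then show "(?P has_derivative (\<lambda>h. ?P' y * h)) (at y within {-L..x})"
          by (simp add: has_field_derivative_def)
      qed
      then show ?thesis by (simp add: mult.commute)
    qed
    then obtain y where "?P x - ?P (-L) = (x - (-L)) * ?P' y" by blast
    moreover have "(x - (-L)) * ?P' y \<le> 0" using lt by (intro mult_nonneg_nonpos neg) simp
    ultimately show ?thesis by linarith
  qed simp
  also have "?P (-L) = 0" using ode zero by (simp add: eig_ode_def)
  finally have "(e x)\<^sup>2 + (d x)\<^sup>2 \<le> 0" by (simp add: mult_le_0_iff)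
  then show ?thesis by (simp add: sum_power2_le_zero_iff)
qed

lemma eig_boundary_nonzero:
  assumes e: "eig \<mu> e" and n: "X.nrm e = 1"
  shows "e (-L) \<noteq> 0"
proof
  assume "e (-L) = 0"
  then have "X.nrm e \<le> 0 * nrm1"
    using eig_zero_boundary[OF e] by (intro nrm_le_sup eigX[OF e]) auto
  then show False using n by simp
qed

text \<open>The combination \<open>f (-L) * e - e (-L) * f\<close> vanishes at \<open>-L\<close>,
  hence everywhere. Simplicity is phrased as non-orthogonality because totality is proved by finding
  an eigenvector orthogonal to all chosen ones.\<close>

lemma eig_simple:
  assumes e: "eig \<mu> e" "X.nrm e = 1" and f: "eig \<mu> f" "X.nrm f = 1"
  shows "wip e f \<noteq> 0"
proof
  assume orth: "wip e f = 0"
  let ?u = "\<lambda>x. f (-L) * e x + (- e (-L)) * f x"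
  have u: "eig \<mu> ?u" by (rule eig_lin[OF e(1) f(1)])
  have eX: "e \<in> X" and fX: "f \<in> X" using e f eigX by auto
  have "?u x = 0" if "x \<in> {-L..0}" for x by (rule eig_zero_boundary[OF u _ that]) simp
  then have "X.nrm ?u \<le> 0 * nrm1" by (intro nrm_le_sup eigX[OF u]) auto
  then have "X.nrm ?u = 0" using X.nrm_nonneg[OF eigX[OF u]] by linarith
  then have "wip ?u e = 0" using X.cauchy_schwarz[OF eigX[OF u] eX] by simp
  moreover have "wip ?u e = f (-L) * wip e e + (- e (-L)) * wip f e" by (rule X.ip_lin[OF eX fX eX])
  moreover have "wip e e = 1" using e X.nrm_sq[OF eX] by simp
  moreover have "wip f e = 0" using orth X.ip_commute[OF eX fX] by simp
  ultimately have "f (-L) = 0" by simp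
  then show False using eig_boundary_nonzero[OF f] by simp
qed

section \<open>Discreteness of the spectrum and completeness of the eigenfunctions\<close>

definition eigenvalues :: "real set" where
  "eigenvalues = {\<mu>. \<exists>e. eig \<mu> e \<and> X.nrm e = 1}"

text \<open>One normalised eigenfunction per eigenvalue is enough for a basis, the eigenspaces being
  one-dimensional by \<open>eig_simple\<close>.\<close>

definition ef :: "real \<Rightarrow> real \<Rightarrow> real" where
  "ef \<mu> = (SOME e. eig \<mu> e \<and> X.nrm e = 1)"

lemma ef: "\<mu> \<in> eigenvalues \<Longrightarrow> eig \<mu> (ef \<mu>)" "\<mu> \<in> eigenvalues \<Longrightarrow> X.nrm (ef \<mu>) = 1"
proof -
  assume "\<mu> \<in> eigenvalues"
  then have "\<exists>e. eig \<mu> e \<and> X.nrm e = 1" by (simp add: eigenvalues_def)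
  from someI_ex[OF this] show "eig \<mu> (ef \<mu>)" "X.nrm (ef \<mu>) = 1" by (simp_all add: ef_def)
qed

lemma efX: "\<mu> \<in> eigenvalues \<Longrightarrow> ef \<mu> \<in> X"
  using ef(1) eigX by blast

lemma eigenvalue_pos: "\<mu> \<in> eigenvalues \<Longrightarrow> \<mu> > 0"
  using eig_nonneg ef by blast

lemma green_ef: "\<mu> \<in> eigenvalues \<Longrightarrow> green (ef \<mu>) = (\<lambda>x. (1 / \<mu>) * ef \<mu> x)"
proof
  fix x assume \<mu>: "\<mu> \<in> eigenvalues"
  show "green (ef \<mu>) x = (1 / \<mu>) * ef \<mu> x"
    using eig_eq[OF ef(1)[OF \<mu>], of x] eigenvalue_pos[OF \<mu>] by (simp add: field_simps)
qed

lemma ef_orthonormal: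
  assumes \<mu>: "\<mu> \<in> eigenvalues" and \<nu>: "\<nu> \<in> eigenvalues"
  shows "wip (ef \<mu>) (ef \<nu>) = of_bool (\<mu> = \<nu>)"
proof (cases "\<mu> = \<nu>")
  case True
  then show ?thesis using ef(2)[OF \<mu>] X.nrm_sq[OF efX[OF \<mu>]] by simp
next
  case False
  have "(1 / \<mu>) * wip (ef \<mu>) (ef \<nu>) = (1 / \<nu>) * wip (ef \<mu>) (ef \<nu>)"
    using green_symmetric[OF efX[OF \<mu>] efX[OF \<nu>]]
    unfolding green_ef[OF \<mu>] green_ef[OF \<nu>] X.ip_scale_left[OF efX[OF \<mu>] efX[OF \<nu>]]
      X.ip_scale_right[OF efX[OF \<nu>] efX[OF \<mu>]] .
  then show ?thesis using False eigenvalue_pos[OF \<mu>] eigenvalue_pos[OF \<nu>] by (auto simp: field_simps)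
qed

text \<open>The images \<open>ef \<mu> / \<mu>\<close> under \<open>green\<close> are orthogonal
  with norm at least \<open>1 / R\<close>, so they stay at mutual distance at least
  \<open>1 / R\<close>; infinitely many of them would contradict compactness.\<close>

lemma finite_eigenvalues_le: "finite {\<mu> \<in> eigenvalues. \<mu> \<le> R}"
proof (rule ccontr)
  assume "infinite {\<mu> \<in> eigenvalues. \<mu> \<le> R}"
  then obtain m :: "nat \<Rightarrow> real" where inj: "inj m" and range: "range m \<subseteq> {\<mu> \<in> eigenvalues. \<mu> \<le> R}"
    using infinite_countable_subset by blast
  have m: "m n \<in> eigenvalues" "m n \<le> R" for n using range by auto
  define g where "g n = green (ef (m n))" for n
  obtain h r where h: "h \<in> X" and r: "strict_mono (r :: nat \<Rightarrow> nat)" and lim: "(\<lambda>n. X.dst (g (r n)) h) \<longlonglongrightarrow> 0"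
    using green_compact[of "\<lambda>n. ef (m n)"] ef(2)[OF m(1)] efX[OF m(1)] unfolding g_def by force
  have gX: "g n \<in> X" for n unfolding g_def by (rule green_X[OF efX[OF m(1)]])
  have R: "R > 0" using eigenvalue_pos[OF m(1)[of 0]] m(2)[of 0] by linarith
  have far: "1 / R \<le> X.dst (g i) (g j)" if "i \<noteq> j" for i j
  proof (rule power2_le_imp_le)
    have ne: "m i \<noteq> m j" using inj that by (auto dest: injD)
    have eX: "ef (m i) \<in> X" "ef (m j) \<in> X" using efX[OF m(1)] by auto
    have "(X.dst (g i) (g j))\<^sup>2 = (X.dst (g i) (\<lambda>x. (1 / m j) * ef (m j) x))\<^sup>2"
      unfolding g_def green_ef[OF m(1)] ..
    also have "\<dots> = (X.nrm (g i))\<^sup>2 - 2 * (1 / m j) * wip (g i) (ef (m j)) + (1 / m j)\<^sup>2 * (X.nrm (ef (m j)))\<^sup>2"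
      by (rule X.dst_scale_sq[OF gX eX(2)])
    also have "wip (g i) (ef (m j)) = 0"
      unfolding g_def green_ef[OF m(1)] X.ip_scale_left[OF eX] ef_orthonormal[OF m(1) m(1)] using ne by simp
    also have "X.nrm (g i) = 1 / m i"
      unfolding g_def green_ef[OF m(1)] X.nrm_scale[OF eX(1)] ef(2)[OF m(1)]
      using eigenvalue_pos[OF m(1)[of i]] by simp
    also have "X.nrm (ef (m j)) = 1" by (rule ef(2)[OF m(1)])
    finally have "(X.dst (g i) (g j))\<^sup>2 = (1 / m i)\<^sup>2 + (1 / m j)\<^sup>2" by simp
    moreover have "(1 / R)\<^sup>2 \<le> (1 / m i)\<^sup>2"
      using eigenvalue_pos[OF m(1)[of i]] m(2)[of i] R by (intro power_mono divide_left_mono) auto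
    ultimately show "(1 / R)\<^sup>2 \<le> (X.dst (g i) (g j))\<^sup>2"
      using zero_le_power2[of "1 / m j"] by linarith
  qed (use gX in simp)
  have "\<forall>\<^sub>F n in sequentially. X.dst (g (r n)) h < 1 / (2 * R)"
    using order_tendstoD(2)[OF lim, of "1 / (2 * R)"] R by simp
  then obtain N where N: "\<And>n. n \<ge> N \<Longrightarrow> X.dst (g (r n)) h < 1 / (2 * R)" by (auto simp: eventually_sequentially)
  have "r N \<noteq> r (Suc N)" using strict_monoD[OF r, of N "Suc N"] by simp
  from far[OF this] X.dst_triangle[OF gX h gX, of "r N" "r (Suc N)"] X.dst_commute[OF gX h, of "r (Suc N)"]
  have "1 / R \<le> X.dst (g (r N)) h + X.dst (g (r (Suc N))) h" by simp
  also have "\<dots> < 1 / (2 * R) + 1 / (2 * R)" by (intro add_strict_mono N) auto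
  finally show False by (simp add: field_simps)
qed

text \<open>The orthogonal complement \<open>W\<close> of the eigenfunctions is invariant under
  \<open>green\<close> by symmetry and closed under limits, so the compactness argument works inside
  it. A non-null \<open>u\<close> in \<open>W\<close> has a non-null image by injectivity, which
  yields an eigenvector in \<open>W\<close> and contradicts simplicity.\<close>

lemma ef_total:
  assumes u: "u \<in> X" and orth: "\<And>\<mu>. \<mu> \<in> eigenvalues \<Longrightarrow> wip u (ef \<mu>) = 0"
  shows "X.nrm u = 0"
proof (rule ccontr)
  assume nz: "X.nrm u \<noteq> 0"
  define W where "W = {v \<in> X. \<forall>\<mu>\<in>eigenvalues. wip v (ef \<mu>) = 0}"
  have WX: "v \<in> X" if "v \<in> W" for v using that by (simp add: W_def)
  have greenW: "green v \<in> W" if "v \<in> W" for v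
  proof -
    have "wip (green v) (ef \<mu>) = 0" if \<mu>: "\<mu> \<in> eigenvalues" for \<mu>
      using \<open>v \<in> W\<close> \<mu> unfolding green_symmetric[OF WX[OF \<open>v \<in> W\<close>] efX[OF \<mu>]] green_ef[OF \<mu>]
        X.ip_scale_right[OF efX[OF \<mu>] WX[OF \<open>v \<in> W\<close>]] by (simp add: W_def)
    then show ?thesis using green_X[OF WX[OF that]] by (simp add: W_def)
  qed
  interpret W: semi_inner_space W wip
  proof
    show "(\<lambda>_. 0) \<in> W" using X.zero_closed X.ip_zero_left efX by (simp add: W_def)
    show "(\<lambda>x. a * f x + b * g x) \<in> W" if "f \<in> W" "g \<in> W" for f g a b
      using that X_lin X.ip_lin[OF WX WX efX] by (simp add: W_def)
  qed (use WX X.ip_commute X.ip_lin X.ip_nonneg in auto)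
  have "\<exists>e\<in>W. \<exists>l. l \<noteq> 0 \<and> X.nrm e = 1 \<and> X.dst (green e) (\<lambda>x. l * e x) = 0"
  proof (rule W.compact_symmetric_eigenvector)
    show "u \<in> W" using u orth by (simp add: W_def)
    show "X.nrm (green u) \<noteq> 0" using green_injective[OF u] nz by blast
    show "X.nrm (green v) \<le> nrm1 * nrm1 * X.nrm v" if "v \<in> W" for v by (rule green_nrm[OF WX[OF that]])
    fix f :: "nat \<Rightarrow> real \<Rightarrow> real"
    assume f: "\<And>n. f n \<in> W" "\<And>n. X.nrm (f n) \<le> 1"
    obtain g r where g: "g \<in> X" and r: "strict_mono (r :: nat \<Rightarrow> nat)" and lim: "(\<lambda>n. X.dst (green (f (r n))) g) \<longlonglongrightarrow> 0"
      using green_compact[of f] f WX by blast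
    have "wip g (ef \<mu>) = 0" if \<mu>: "\<mu> \<in> eigenvalues" for \<mu>
    proof (rule LIMSEQ_unique)
      show "(\<lambda>n. wip (green (f (r n))) (ef \<mu>)) \<longlonglongrightarrow> wip g (ef \<mu>)"
        by (rule X.tendsto_ip[OF _ g efX[OF \<mu>] lim]) (simp add: green_X WX f)
      have "wip (green (f (r n))) (ef \<mu>) = 0" for n using greenW[OF f(1)] \<mu> by (simp add: W_def)
      then show "(\<lambda>n. wip (green (f (r n))) (ef \<mu>)) \<longlonglongrightarrow> 0" by simp
    qed
    then have "g \<in> W" using g by (simp add: W_def)
    with r lim show "\<exists>g\<in>W. \<exists>r. strict_mono r \<and> (\<lambda>n. X.dst (green (f (r n))) g) \<longlonglongrightarrow> 0" by blast
  qed (use greenW WX green_lin green_symmetric in auto)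
  then obtain e l where e: "e \<in> W" and l: "l \<noteq> 0" and n: "X.nrm e = 1"
    and eq: "X.dst (green e) (\<lambda>x. l * e x) = 0" by blast
  have eX: "e \<in> X" by (rule WX[OF e])
  \<comment> \<open>The eigenvector \<open>e\<close> satisfies its equation only up to null
    distance. Applying \<open>green\<close> once picks the representative for which the equation
    holds pointwise.\<close>
  define e' where "e' = (\<lambda>x. (1 / l) * green e x)"
  have e'X: "e' \<in> X" unfolding e'_def by (rule X.scale_closed[OF green_X[OF eX]])
  have d: "X.dst e' e = 0"
  proof -
    have "X.dst e' e = X.nrm (\<lambda>x. (1 / l) * (green e x - l * e x))"
      unfolding X.dst_def e'_def using l by (simp add: right_diff_distrib)
    also have "\<dots> = \<bar>1 / l\<bar> * X.dst (green e) (\<lambda>x. l * e x)"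
      unfolding X.dst_def by (intro X.nrm_scale X.diff_closed X.scale_closed green_X eX)
    finally show ?thesis using eq by simp
  qed
  have "eig (1 / l) e'"
    unfolding eig_def
  proof
    show "e' \<in> X" by (rule e'X)
    have "green e' = green e" by (rule green_null[OF e'X eX d])
    then show "e' = (\<lambda>x. (1 / l) * green e' x)" by (simp only: e'_def)
  qed
  moreover have "X.nrm e' = 1" using X.nrm_dst[OF e'X eX] d n by simp
  ultimately have \<mu>: "1 / l \<in> eigenvalues" and "eig (1 / l) e'" "X.nrm e' = 1" by (auto simp: eigenvalues_def)
  then have "wip e' (ef (1 / l)) \<noteq> 0" using eig_simple ef[OF \<mu>] by blast
  moreover have "wip e' (ef (1 / l)) = wip e (ef (1 / l))" by (rule X.ip_null[OF e'X eX efX[OF \<mu>] d])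
  ultimately show False using e \<mu> by (simp add: W_def)
qed

text \<open>The element of \<open>X\<close> carried by the boundary point \<open>-L\<close> is not a finite combination of
  continuous functions.\<close>

lemma infinite_eigenvalues: "infinite eigenvalues"
proof
  assume fin: "finite eigenvalues"
  define u :: "real \<Rightarrow> real" where "u = (\<lambda>x. if x = -L then 1 else 0)"
  have u0: "u x = 0" if "x \<in> {-L<..<0}" for x using that by (simp add: u_def)
  have um: "u \<in> borel_measurable M"
    by (subst measurable_cong[of _ _ "\<lambda>_. 0"]) (auto simp: u0)
  have uX: "u \<in> X" by (rule X_bounded[OF um, of 1]) (simp add: u0)
  define v where "v = (\<lambda>x. \<Sum>\<mu>\<in>eigenvalues. wip u (ef \<mu>) * ef \<mu> x)"
  have vX: "v \<in> X" unfolding v_def by (rule X.sum_closed[OF efX])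
  have "wip v (ef \<nu>) = wip u (ef \<nu>)" if \<nu>: "\<nu> \<in> eigenvalues" for \<nu>
  proof -
    have "wip v (ef \<nu>) = (\<Sum>\<mu>\<in>eigenvalues. wip u (ef \<mu>) * wip (ef \<mu>) (ef \<nu>))"
      unfolding v_def by (rule X.ip_sum_left[OF efX efX[OF \<nu>]])
    also have "\<dots> = (\<Sum>\<mu>\<in>eigenvalues. if \<mu> = \<nu> then wip u (ef \<mu>) else 0)"
      by (rule sum.cong) (simp_all add: ef_orthonormal \<nu>)
    also have "\<dots> = wip u (ef \<nu>)" using fin \<nu> by simp
    finally show ?thesis .
  qed
  then have "X.nrm (\<lambda>x. v x - u x) = 0"
    by (intro ef_total X.diff_closed vX uX) (simp add: X.ip_diff_left vX uX efX)
  note null = null_AE[OF X.diff_closed[OF vX uX] this]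
  have cont: "continuous_on S v" for S
    unfolding v_def by (intro continuous_intros eig_continuous[OF ef(1)])
  \<comment> \<open>The finite expansion \<open>v\<close> is continuous and vanishes almost
    everywhere inside, so it is 0 at \<open>-L\<close> by continuity, while as a representative of
    \<open>u\<close> it must be 1 there.\<close>
  have "AE x in M. v x = 0" by (rule AE_mp[OF null(3)]) (rule AE_I2, simp add: u0)
  then have "v x = 0" if "x \<in> {-L<..<0}" for x by (rule AE_zero_continuous[OF cont _ that])
  then have "v (-L) = 0"
    by (rule continuous_constant_on_closure[OF cont, of "{-L<..<0}"]) (use L_pos in simp_all)
  moreover have "v (-L) = 1" using null(2) by (simp add: u_def)
  ultimately show False by simp
qed

lemma countable_eigenvalues: "countable eigenvalues"
proof -
  have "eigenvalues \<subseteq> (\<Union>n::nat. {\<mu> \<in> eigenvalues. \<mu> \<le> n})"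
  proof
    fix \<mu> assume "\<mu> \<in> eigenvalues"
    moreover obtain n :: nat where "\<mu> \<le> n" using real_arch_simple by blast
    ultimately show "\<mu> \<in> (\<Union>n::nat. {\<mu> \<in> eigenvalues. \<mu> \<le> n})" by blast
  qed
  moreover have "countable (\<Union>n::nat. {\<mu> \<in> eigenvalues. \<mu> \<le> n})"
    by (intro countable_UN[OF countableI_type] countable_finite finite_eigenvalues_le)
  ultimately show ?thesis by (rule countable_subset)
qed

text \<open>An enumeration in no particular order; growth enters only through
  \<open>finite_ev_le\<close>.\<close>

definition ev :: "nat \<Rightarrow> real" where
  "ev = from_nat_into eigenvalues"

lemma ev_bij: "bij_betw ev UNIV eigenvalues"
  unfolding ev_def by (rule bij_betw_from_nat_into[OF countable_eigenvalues infinite_eigenvalues])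

lemma ev_mem: "ev n \<in> eigenvalues"
  using ev_bij bij_betwE by blast

lemma ev_inj: "ev m = ev n \<longleftrightarrow> m = n"
  using ev_bij by (auto simp: bij_betw_def inj_def)

lemma finite_ev_le: "finite {n. ev n \<le> R}"
proof -
  have "finite (ev -` {\<mu> \<in> eigenvalues. \<mu> \<le> R})"
    by (rule finite_vimageI[OF finite_eigenvalues_le]) (use ev_bij in \<open>simp add: bij_betw_def\<close>)
  moreover have "ev -` {\<mu> \<in> eigenvalues. \<mu> \<le> R} = {n. ev n \<le> R}" using ev_mem by auto
  ultimately show ?thesis by simp
qed

sublocale X: diagonal_generator X wip "\<lambda>n. ef (ev n)" ev
proof
  show "wip (ef (ev m)) (ef (ev n)) = of_bool (m = n)" for m n
    using ef_orthonormal[OF ev_mem ev_mem] by (simp add: ev_inj)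
  show "X.nrm u = 0" if "u \<in> X" "\<And>n. wip u (ef (ev n)) = 0" for u
  proof (rule ef_total[OF that(1)])
    fix \<mu> assume "\<mu> \<in> eigenvalues"
    then obtain n where "\<mu> = ev n" using ev_bij unfolding bij_betw_def by blast
    then show "wip u (ef \<mu>) = 0" using that(2) by simp
  qed
qed (use efX[OF ev_mem] eigenvalue_pos[OF ev_mem] in \<open>auto simp: less_imp_le\<close>)


section \<open>The generator\<close>

lemma dx_eq:
  assumes "x \<in> {-L..0}" "(f has_real_derivative f') (at x within {-L..0})"
  shows "dx L f x = f'"
  using vector_derivative_within_cbox[of "-L" 0 x f f'] assms L_pos
  by (simp add: dx_def has_real_derivative_iff_has_vector_derivative)

lemma C_infinity_derivative:
  assumes f: "f \<in> C_infinity L" and x: "x \<in> {-L..0}"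
  shows "((dx L ^^ k) f has_real_derivative (dx L ^^ Suc k) f x) (at x within {-L..0})"
proof -
  have "(dx L ^^ k) f differentiable at x within {-L..0}"
    using f x by (simp add: C_infinity_def differentiable_on_def)
  then show ?thesis
    by (simp add: vector_derivative_works has_real_derivative_iff_has_vector_derivative dx_def)
qed

text \<open>Smoothness and all values of iterated \<open>dx\<close> are obtained by exhibiting
  candidates \<open>F k\<close>. The induction carries value and differentiability together, because
  \<open>dx\<close> is controlled only on the closed interval and each derivative has to be
  transported along equality there.\<close>

lemma C_infinity_chain:
  fixes F :: "nat \<Rightarrow> real \<Rightarrow> real"
  assumes F0: "\<And>x. x \<in> {-L..0} \<Longrightarrow> F 0 x = f x"
    and F: "\<And>k x. x \<in> {-L..0} \<Longrightarrow> (F k has_real_derivative F (Suc k) x) (at x within {-L..0})"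
  shows "f \<in> C_infinity L" "x \<in> {-L..0} \<Longrightarrow> (dx L ^^ k) f x = F k x"
proof -
  have chain: "\<forall>x\<in>{-L..0}. (dx L ^^ k) f x = F k x \<and> ((dx L ^^ k) f has_real_derivative F (Suc k) x) (at x within {-L..0})" for k
  proof (induction k)
    case 0
    show ?case
    proof (intro ballI conjI)
      fix x assume x: "x \<in> {-L..0}"
      show "(dx L ^^ 0) f x = F 0 x" using F0[OF x] by simp
      show "((dx L ^^ 0) f has_real_derivative F (Suc 0) x) (at x within {-L..0})"
        by (rule has_field_derivative_transform_within[OF F[OF x, of 0] zero_less_one x]) (simp add: F0)
    qed
  next
    case (Suc k)
    have eq: "(dx L ^^ Suc k) f x = F (Suc k) x" if "x \<in> {-L..0}" for x
      using Suc that dx_eq by simp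
    show ?case
    proof (intro ballI conjI)
      fix x assume x: "x \<in> {-L..0}"
      show "(dx L ^^ Suc k) f x = F (Suc k) x" by (rule eq[OF x])
      show "((dx L ^^ Suc k) f has_real_derivative F (Suc (Suc k)) x) (at x within {-L..0})"
        by (rule has_field_derivative_transform_within[OF F[OF x, of "Suc k"] zero_less_one x]) (simp only: eq)
    qed
  qed
  show "f \<in> C_infinity L"
    unfolding C_infinity_def differentiable_on_def
    using chain unfolding has_field_derivative_def differentiable_def by blast
  show "x \<in> {-L..0} \<Longrightarrow> (dx L ^^ k) f x = F k x" using chain by blast
qed

lemma C_infinity_lin:
  assumes f: "f \<in> C_infinity L" and g: "g \<in> C_infinity L"
  shows "(\<lambda>x. a * f x + b * g x) \<in> C_infinity L"
    "x \<in> {-L..0} \<Longrightarrow> (dx L ^^ k) (\<lambda>x. a * f x + b * g x) x = a * (dx L ^^ k) f x + b * (dx L ^^ k) g x"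
proof -
  define F where "F k x = a * (dx L ^^ k) f x + b * (dx L ^^ k) g x" for k x
  have 0: "F 0 x = a * f x + b * g x" for x by (simp add: F_def)
  have d: "(F k has_real_derivative F (Suc k) x) (at x within {-L..0})" if "x \<in> {-L..0}" for k x
    unfolding F_def
    by (intro DERIV_add DERIV_cmult C_infinity_derivative f g that)
  show "(\<lambda>x. a * f x + b * g x) \<in> C_infinity L" by (rule C_infinity_chain(1)[of F, OF 0 d])
  show "x \<in> {-L..0} \<Longrightarrow> (dx L ^^ k) (\<lambda>x. a * f x + b * g x) x = a * (dx L ^^ k) f x + b * (dx L ^^ k) g x"
    using C_infinity_chain(2)[of F, OF 0 d] by (simp add: F_def)
qed

lemma C_infinity_continuous: "f \<in> C_infinity L \<Longrightarrow> continuous_on {-L..0} ((dx L ^^ k) f)"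
  unfolding continuous_on_eq_continuous_within using C_infinity_derivative DERIV_continuous by blast

lemma C_infinity_X: "f \<in> C_infinity L \<Longrightarrow> f \<in> X"
  using C_infinity_continuous[of f 0] by (simp add: X_continuous)

text \<open>The functions \<open>exp (c * x) * (a * e x + b * d x)\<close> are closed under differentiation.\<close>

lemma eig_smooth:
  assumes ode: "eig_ode \<mu> e d"
  shows "(\<lambda>x. exp (c * x) * (a * e x + b * d x)) \<in> C_infinity L"
    "x \<in> {-L..0} \<Longrightarrow> dx L (\<lambda>x. exp (c * x) * (a * e x + b * d x)) x
      = exp (c * x) * ((c * a - b * \<mu> / \<epsilon>) * e x + (a + c * b + b / \<epsilon>) * d x)"
    "x \<in> {-L..0} \<Longrightarrow> dx L (dx L (\<lambda>x. exp (c * x) * (a * e x + b * d x))) x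
      = exp (c * x) * ((c * (c * a - b * \<mu> / \<epsilon>) - (a + c * b + b / \<epsilon>) * \<mu> / \<epsilon>) * e x
          + ((c * a - b * \<mu> / \<epsilon>) + c * (a + c * b + b / \<epsilon>) + (a + c * b + b / \<epsilon>) / \<epsilon>) * d x)"
proof -
  \<comment> \<open>The pair of coefficients of \<open>e\<close> and \<open>d\<close>, updated by
    the product rule with the derivatives \<open>d\<close> and
    \<open>(d - \<mu> * e) / \<epsilon>\<close> substituted.\<close>
  define p where "p = rec_nat (a, b) (\<lambda>_ (a, b). (c * a - b * \<mu> / \<epsilon>, a + c * b + b / \<epsilon>))"
  define F where "F k x = exp (c * x) * (fst (p k) * e x + snd (p k) * d x)" for k x
  have p: "p 0 = (a, b)" "p (Suc k) = (c * fst (p k) - snd (p k) * \<mu> / \<epsilon>, fst (p k) + c * snd (p k) + snd (p k) / \<epsilon>)" for k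
    by (simp_all add: p_def split: prod.split)
  have 0: "F 0 x = exp (c * x) * (a * e x + b * d x)" for x by (simp add: F_def p)
  have D: "(F k has_real_derivative F (Suc k) x) (at x within {-L..0})" if x: "x \<in> {-L..0}" for k x
  proof -
    have de: "(e has_real_derivative d x) (at x within {-L..0})"
      and dd: "(d has_real_derivative (d x - \<mu> * e x) / \<epsilon>) (at x within {-L..0})"
      using ode x by (auto simp: eig_ode_def)
    have "(F k has_real_derivative exp (c * x) * c * (fst (p k) * e x + snd (p k) * d x)
        + exp (c * x) * (fst (p k) * d x + snd (p k) * ((d x - \<mu> * e x) / \<epsilon>))) (at x within {-L..0})"
      unfolding F_def by (auto intro!: derivative_eq_intros de dd simp: algebra_simps)
    also have "exp (c * x) * c * (fst (p k) * e x + snd (p k) * d x)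
        + exp (c * x) * (fst (p k) * d x + snd (p k) * ((d x - \<mu> * e x) / \<epsilon>)) = F (Suc k) x"
      using eps_pos by (simp add: F_def p field_simps)
    finally show ?thesis .
  qed
  note chain = C_infinity_chain[of F, OF 0 D]
  show "(\<lambda>x. exp (c * x) * (a * e x + b * d x)) \<in> C_infinity L" by (rule chain(1))
  show "x \<in> {-L..0} \<Longrightarrow> dx L (\<lambda>x. exp (c * x) * (a * e x + b * d x)) x
      = exp (c * x) * ((c * a - b * \<mu> / \<epsilon>) * e x + (a + c * b + b / \<epsilon>) * d x)"
    using chain(2)[of x 1] by (simp add: F_def p)
  show "x \<in> {-L..0} \<Longrightarrow> dx L (dx L (\<lambda>x. exp (c * x) * (a * e x + b * d x))) x
      = exp (c * x) * ((c * (c * a - b * \<mu> / \<epsilon>) - (a + c * b + b / \<epsilon>) * \<mu> / \<epsilon>) * e x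
          + ((c * a - b * \<mu> / \<epsilon>) + c * (a + c * b + b / \<epsilon>) + (a + c * b + b / \<epsilon>) / \<epsilon>) * d x)"
    using chain(2)[of x "Suc 1"] by (simp add: F_def p numeral_2_eq_2)
qed

lemma eig_C_infinity: "eig \<mu> e \<Longrightarrow> e \<in> C_infinity L"
proof -
  assume "eig \<mu> e"
  then obtain d where "eig_ode \<mu> e d" using eig_ode_exists by blast
  from eig_smooth(1)[OF this, of 0 1 0] show ?thesis by simp
qed

text \<open>The Riesz representer of \<open>a_form\<close> in its first argument for
  \<open>wip\<close>: inside, the formal adjoint applied to \<phi> and divided by the weight; at the
  end points, the boundary terms divided by \<epsilon> and the weight.\<close>

definition psi :: "(real \<Rightarrow> real) \<Rightarrow> real \<Rightarrow> real" where
  "psi \<phi> x = (if x = 0 then dx L \<phi> 0 + \<phi> 0 / \<epsilon>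
    else if x = -L then - dx L \<phi> (-L) / wt (-L)
    else (- \<epsilon> * dx L (dx L \<phi>) x - dx L \<phi> x) / wt x)"

lemma wip_cong: "(\<And>x. x \<in> {-L..0} \<Longrightarrow> v x = v' x) \<Longrightarrow> wip u v = wip u v'"
  unfolding wip_def using L_pos
  by (intro arg_cong2[of _ _ _ _ "(+)"] Bochner_Integration.integral_cong arg_cong[of _ _ "(*) \<epsilon>"]) auto

lemma psi_X: "\<phi> \<in> C_infinity L \<Longrightarrow> psi \<phi> \<in> X"
proof -
  assume \<phi>: "\<phi> \<in> C_infinity L"
  let ?g = "\<lambda>x. (- \<epsilon> * dx L (dx L \<phi>) x - dx L \<phi> x) / wt x"
  have c: "continuous_on {-L..0} (dx L \<phi>)" "continuous_on {-L..0} (dx L (dx L \<phi>))"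
    using C_infinity_continuous[OF \<phi>, of 1] C_infinity_continuous[OF \<phi>, of "Suc 1"] by simp_all
  have "continuous_on {-L..0} ?g"
    unfolding wt_def by (intro continuous_intros c) (use eps_pos in auto)
  then have g: "?g \<in> X" by (rule X_continuous)
  have e: "psi \<phi> x = ?g x" if "x \<in> {-L<..<0}" for x using that by (simp add: psi_def)
  show ?thesis
  proof (rule X_I)
    show "psi \<phi> \<in> borel_measurable M"
      using X_measurable[OF g] by (subst measurable_cong[of _ _ ?g]) (simp_all add: e)
    show "integrable M (\<lambda>x. (psi \<phi> x)\<^sup>2)"
      using X_integrable_square[OF g]
      by (subst Bochner_Integration.integrable_cong[of _ M _ "\<lambda>x. (?g x)\<^sup>2"]) (simp_all add: e)
  qed
qed

lemma a_form_eq_wip: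
  assumes u: "u \<in> X" and \<phi>: "\<phi> \<in> C_infinity L"
  shows "a_form \<epsilon> L u \<phi> = wip u (psi \<phi>)"
proof -
  have c: "continuous_on {-L..0} (dx L \<phi>)" "continuous_on {-L..0} (dx L (dx L \<phi>))"
    using C_infinity_continuous[OF \<phi>, of 1] C_infinity_continuous[OF \<phi>, of "Suc 1"] by simp_all
  have i: "integrable M (\<lambda>x. u x * dx L \<phi> x)" "integrable M (\<lambda>x. u x * dx L (dx L \<phi>) x)"
    using X_integrable_mult[OF u X_continuous] c by auto
  have "(\<integral>x. wt x * (u x * psi \<phi> x) \<partial>M) = (\<integral>x. - \<epsilon> * (u x * dx L (dx L \<phi>) x) - u x * dx L \<phi> x \<partial>M)"
    by (rule Bochner_Integration.integral_cong) (auto simp: psi_def field_simps)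
  also have "\<dots> = - \<epsilon> * (\<integral>x. u x * dx L (dx L \<phi>) x \<partial>M) - (\<integral>x. u x * dx L \<phi> x \<partial>M)"
    using i by simp
  finally have int: "(\<integral>x. wt x * (u x * psi \<phi> x) \<partial>M)
      = - \<epsilon> * (\<integral>x. u x * dx L (dx L \<phi>) x \<partial>M) - (\<integral>x. u x * dx L \<phi> x \<partial>M)" .
  have p0: "psi \<phi> 0 = dx L \<phi> 0 + \<phi> 0 / \<epsilon>" by (simp add: psi_def)
  have "psi \<phi> (-L) = - dx L \<phi> (-L) / wt (-L)" using L_pos by (simp add: psi_def)
  then have "wt (-L) * psi \<phi> (-L) = - dx L \<phi> (-L)" by simp
  then have "wt (-L) * (u (-L) * psi \<phi> (-L)) = - (u (-L) * dx L \<phi> (-L))" by (simp add: mult.left_commute)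
  then show ?thesis
    unfolding a_form_def wip_def int p0 using eps_pos by (simp add: algebra_simps)
qed

lemma X_inner_eq_wip: "X_inner \<epsilon> L u \<phi> = wip u (\<lambda>x. \<phi> x / wt x)"
  unfolding X_inner_def wip_def by simp

lemma div_wt_X: "\<phi> \<in> C_infinity L \<Longrightarrow> (\<lambda>x. \<phi> x / wt x) \<in> X"
  using C_infinity_continuous[of \<phi> 0] unfolding wt_def
  by (intro X_continuous continuous_intros) (use eps_pos in auto)

text \<open>Multiplication by the weight turns an eigenfunction into one of the formal adjoint, so
  \<open>psi\<close> returns \<open>\<mu> * e\<close>. This supplies test functions that read off
  single coefficients of an arbitrary \<open>u\<close>.\<close>

lemma wt_eig:
  assumes e: "eig \<mu> e"
  shows "(\<lambda>x. wt x * e x) \<in> C_infinity L" "u \<in> X \<Longrightarrow> a_form \<epsilon> L u (\<lambda>x. wt x * e x) = \<mu> * wip u e"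
proof -
  obtain d where ode: "eig_ode \<mu> e d" using eig_ode_exists[OF e] by blast
  have form: "(\<lambda>x. wt x * e x) = (\<lambda>x. exp (- (1 / \<epsilon>) * x) * (1 * e x + 0 * d x))"
    by (simp add: wt_def)
  show s: "(\<lambda>x. wt x * e x) \<in> C_infinity L" unfolding form by (rule eig_smooth(1)[OF ode])
  have d1: "dx L (\<lambda>x. wt x * e x) x = wt x * (d x - e x / \<epsilon>)" if "x \<in> {-L..0}" for x
    unfolding form eig_smooth(2)[OF ode that] using eps_pos by (simp add: wt_def field_simps)
  have d2: "dx L (dx L (\<lambda>x. wt x * e x)) x = wt x * ((1 / \<epsilon>\<^sup>2 - \<mu> / \<epsilon>) * e x - d x / \<epsilon>)" if "x \<in> {-L..0}" for x
    unfolding form eig_smooth(3)[OF ode that] using eps_pos by (simp add: wt_def field_simps power2_eq_square)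
  have psi: "psi (\<lambda>x. wt x * e x) x = \<mu> * e x" if x: "x \<in> {-L..0}" for x
  proof -
    have b0: "d 0 = \<mu> * e 0" and bL: "d (-L) = e (-L) * (1 / \<epsilon> - \<mu>)" using ode by (auto simp: eig_ode_def)
    consider "x = 0" | "x = -L" | "x \<noteq> 0" "x \<noteq> -L" by blast
    then show ?thesis
    proof cases
      case 1
      then show ?thesis using d1[of 0] L_pos b0 by (simp add: psi_def)
    next
      case 2
      then show ?thesis using d1[of "-L"] L_pos bL by (simp add: psi_def algebra_simps)
    next
      case 3
      have "- \<epsilon> * (wt x * ((1 / \<epsilon>\<^sup>2 - \<mu> / \<epsilon>) * e x - d x / \<epsilon>)) - wt x * (d x - e x / \<epsilon>) = (\<mu> * e x) * wt x"
        using eps_pos by (simp add: field_simps power2_eq_square)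
      then show ?thesis using 3 unfolding psi_def d1[OF x] d2[OF x] by simp
    qed
  qed
  show "a_form \<epsilon> L u (\<lambda>x. wt x * e x) = \<mu> * wip u e" if u: "u \<in> X"
    unfolding a_form_eq_wip[OF u s] X.ip_scale_right[OF eigX[OF e] u, symmetric]
    by (rule wip_cong) (rule psi)
qed

text \<open>Counterpart of \<open>wt_eig\<close> with the eigenfunction in the first slot and an
  arbitrary test function in the second: the boundary conditions turn the end point terms of Green's
  formula into the boundary part of \<open>X_inner\<close>.\<close>

lemma a_form_eig:
  assumes e: "eig \<mu> e" and \<phi>: "\<phi> \<in> C_infinity L"
  shows "a_form \<epsilon> L e \<phi> = \<mu> * X_inner \<epsilon> L e \<phi>"
proof -
  obtain d where ode: "eig_ode \<mu> e d" using eig_ode_exists[OF e] by blast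
  have b: "d 0 = \<mu> * e 0" "d (-L) = e (-L) * (1 / \<epsilon> - \<mu>)" using ode by (auto simp: eig_ode_def)
  have c: "continuous_on {-L..0} \<phi>" "continuous_on {-L..0} (dx L \<phi>)" "continuous_on {-L..0} (dx L (dx L \<phi>))"
    using C_infinity_continuous[OF \<phi>, of 0] C_infinity_continuous[OF \<phi>, of 1] C_infinity_continuous[OF \<phi>, of "Suc 1"] by simp_all
  have ce: "continuous_on {-L..0} e" by (rule eig_continuous[OF e])
  have i: "integrable M (\<lambda>x. e x * dx L (dx L \<phi>) x)" "integrable M (\<lambda>x. e x * dx L \<phi> x)" "integrable M (\<lambda>x. e x * \<phi> x)"
    by (intro integrable_continuous_M continuous_intros c ce)+
  \<comment> \<open>Antiderivative from Green's formula; in its derivative the terms in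
    \<open>d\<close> cancel by the equation for \<open>d\<close>.\<close>
  let ?H = "\<lambda>x. \<epsilon> * (e x * dx L \<phi> x - d x * \<phi> x) + e x * \<phi> x"
  have "(\<integral>x. \<epsilon> * (e x * dx L (dx L \<phi>) x) + e x * dx L \<phi> x + \<mu> * (e x * \<phi> x) \<partial>M) = ?H 0 - ?H (-L)"
  proof (rule M_FTC)
    fix x assume x: "x \<in> {-L..0}"
    have de: "(e has_real_derivative d x) (at x within {-L..0})"
      and dd: "(d has_real_derivative (d x - \<mu> * e x) / \<epsilon>) (at x within {-L..0})"
      using ode x by (auto simp: eig_ode_def)
    have p0: "(\<phi> has_real_derivative dx L \<phi> x) (at x within {-L..0})"
      and p1: "(dx L \<phi> has_real_derivative dx L (dx L \<phi>) x) (at x within {-L..0})"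
      using C_infinity_derivative[OF \<phi> x, of 0] C_infinity_derivative[OF \<phi> x, of 1] by simp_all
    have "(?H has_real_derivative \<epsilon> * (d x * dx L \<phi> x + e x * dx L (dx L \<phi>) x - ((d x - \<mu> * e x) / \<epsilon> * \<phi> x + d x * dx L \<phi> x))
        + (d x * \<phi> x + e x * dx L \<phi> x)) (at x within {-L..0})"
      by (auto intro!: derivative_eq_intros de dd p0 p1 simp: algebra_simps)
    also have "\<epsilon> * (d x * dx L \<phi> x + e x * dx L (dx L \<phi>) x - ((d x - \<mu> * e x) / \<epsilon> * \<phi> x + d x * dx L \<phi> x))
        + (d x * \<phi> x + e x * dx L \<phi> x) = \<epsilon> * (e x * dx L (dx L \<phi>) x) + e x * dx L \<phi> x + \<mu> * (e x * \<phi> x)"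
      using eps_pos by (simp add: field_simps)
    finally show "(?H has_real_derivative \<epsilon> * (e x * dx L (dx L \<phi>) x) + e x * dx L \<phi> x + \<mu> * (e x * \<phi> x)) (at x within {-L..0})" .
  qed (use i in simp)
  moreover have "(\<integral>x. \<epsilon> * (e x * dx L (dx L \<phi>) x) + e x * dx L \<phi> x + \<mu> * (e x * \<phi> x) \<partial>M)
      = \<epsilon> * (\<integral>x. e x * dx L (dx L \<phi>) x \<partial>M) + (\<integral>x. e x * dx L \<phi> x \<partial>M) + \<mu> * (\<integral>x. e x * \<phi> x \<partial>M)"
    using i by simp
  ultimately have "a_form \<epsilon> L e \<phi> = \<mu> * (\<integral>x. e x * \<phi> x \<partial>M) - (?H 0 - ?H (-L))
      + \<epsilon> * (e 0 * dx L \<phi> 0 - e (-L) * dx L \<phi> (-L)) + e 0 * \<phi> 0"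
    unfolding a_form_def by simp
  also have "\<dots> = \<mu> * (\<integral>x. e x * \<phi> x \<partial>M) + \<epsilon> * (d 0 * \<phi> 0) - (\<epsilon> * d (-L) - e (-L)) * \<phi> (-L)"
    by (simp add: algebra_simps)
  also have "\<epsilon> * d (-L) - e (-L) = - \<epsilon> * \<mu> * e (-L)" using b eps_pos by (simp add: field_simps)
  finally show ?thesis unfolding b X_inner_def by (simp add: algebra_simps)
qed

section \<open>Identification of X and the weak form in coefficients\<close>

lemma sum_C_infinity:
  assumes "\<And>i. i \<in> J \<Longrightarrow> f i \<in> C_infinity L"
  shows "(\<lambda>x. \<Sum>i\<in>J. c i * f i x) \<in> C_infinity L"
  using assms
proof (induction J rule: infinite_finite_induct)
  case (insert j J)
  then show ?case using C_infinity_lin(1)[of "f j" "\<lambda>x. \<Sum>i\<in>J. c i * f i x" "c j" 1] by simp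
qed (use C_infinity_chain(1)[of "\<lambda>_ _. 0"] in auto)

text \<open>Density of the smooth functions comes from the eigenfunction expansion, whose partial
  sums are smooth; it approximates arbitrary boundary values along with the square integrable
  part.\<close>

lemma X_space_eq: "X_space \<epsilon> L = X"
proof
  show "X_space \<epsilon> L \<subseteq> X" by (auto simp: X_space_def)
  show "X \<subseteq> X_space \<epsilon> L"
  proof
    fix u assume u: "u \<in> X"
    define p where "p = X.psum (X.coef u)"
    have p: "p n \<in> C_infinity L" for n
      unfolding p_def X.psum_def by (intro sum_C_infinity eig_C_infinity[OF ef(1)[OF ev_mem]])
    have "(\<lambda>n. X_norm \<epsilon> L (\<lambda>x. p n x - u x)) \<longlonglongrightarrow> 0"
    proof (rule tendsto_0_le_real[OF X.expansion[OF u]], intro always_eventually allI conjI)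
      show "0 \<le> X_norm \<epsilon> L (\<lambda>x. p n x - u x)" for n by (rule X_norm_nonneg)
      show "X_norm \<epsilon> L (\<lambda>x. p n x - u x) \<le> X.dst (X.psum (X.coef u) n) u" for n
        unfolding X.dst_def p_def by (intro X_norm_le_nrm X.diff_closed u X.psum_closed)
    qed
    with u p show "u \<in> X_space \<epsilon> L" unfolding X_space_def by blast
  qed
qed

lemma X_eq_iff: "u \<in> X \<Longrightarrow> v \<in> X \<Longrightarrow> X_eq \<epsilon> L u v \<longleftrightarrow> X.dst u v = 0"
proof -
  assume uv: "u \<in> X" "v \<in> X"
  then have d: "(\<lambda>x. u x - v x) \<in> X" by (rule X.diff_closed)
  show ?thesis
    unfolding X_eq_def X.dst_def
    using X_norm_le_nrm[OF d] nrm_le_X_norm[OF d] X_norm_nonneg[of "\<lambda>x. u x - v x"] X.nrm_nonneg[OF d] by auto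
qed

lemma X_norm_tendsto_iff:
  assumes "\<forall>\<^sub>F h in F. v h \<in> X"
  shows "((\<lambda>h. X_norm \<epsilon> L (v h)) \<longlongrightarrow> 0) F \<longleftrightarrow> ((\<lambda>h. X.nrm (v h)) \<longlongrightarrow> 0) F"
proof
  assume "((\<lambda>h. X_norm \<epsilon> L (v h)) \<longlongrightarrow> 0) F"
  then have "((\<lambda>h. sqrt (wt (-L)) * X_norm \<epsilon> L (v h)) \<longlongrightarrow> 0) F" by (rule tendsto_mult_right_zero)
  then show "((\<lambda>h. X.nrm (v h)) \<longlongrightarrow> 0) F"
    by (rule tendsto_0_le_real) (rule eventually_mono[OF assms], simp add: nrm_le_X_norm)
next
  assume "((\<lambda>h. X.nrm (v h)) \<longlongrightarrow> 0) F"
  then show "((\<lambda>h. X_norm \<epsilon> L (v h)) \<longlongrightarrow> 0) F"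
    by (rule tendsto_0_le_real) (rule eventually_mono[OF assms], simp add: X_norm_le_nrm X_norm_nonneg)
qed

text \<open>Testing with weighted eigenfunctions gives the coefficients. Conversely both sides are
  expanded by Parseval, and \<open>a_form_eig\<close> matches them term by term for every test
  function.\<close>

lemma weak_generator_iff:
  assumes u: "u \<in> X" and w: "w \<in> X"
  shows "(\<forall>\<phi>\<in>C_infinity L. X_inner \<epsilon> L (\<lambda>x. - w x) \<phi> = a_form \<epsilon> L u \<phi>) \<longleftrightarrow> (\<forall>n. X.coef w n = - ev n * X.coef u n)"
proof -
  have neg: "wip (\<lambda>x. - w x) z = - wip w z" if "z \<in> X" for z
    using X.ip_scale_left[OF w that, of "-1"] by simp
  show ?thesis
  proof
    assume weak: "\<forall>\<phi>\<in>C_infinity L. X_inner \<epsilon> L (\<lambda>x. - w x) \<phi> = a_form \<epsilon> L u \<phi>"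
    show "\<forall>n. X.coef w n = - ev n * X.coef u n"
    proof
      fix n
      note e = ef(1)[OF ev_mem[of n]]
      have "X_inner \<epsilon> L (\<lambda>x. - w x) (\<lambda>x. wt x * ef (ev n) x) = ev n * X.coef u n"
        using weak wt_eig(1)[OF e] wt_eig(2)[OF e u] by simp
      moreover have "X_inner \<epsilon> L (\<lambda>x. - w x) (\<lambda>x. wt x * ef (ev n) x) = - X.coef w n"
        unfolding X_inner_eq_wip using neg[OF eigX[OF e]] by simp
      ultimately show "X.coef w n = - ev n * X.coef u n" by simp
    qed
  next
    assume c: "\<forall>n. X.coef w n = - ev n * X.coef u n"
    show "\<forall>\<phi>\<in>C_infinity L. X_inner \<epsilon> L (\<lambda>x. - w x) \<phi> = a_form \<epsilon> L u \<phi>"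
    proof
      fix \<phi> assume \<phi>: "\<phi> \<in> C_infinity L"
      have s1: "(\<lambda>n. X.coef u n * wip (ef (ev n)) (psi \<phi>)) sums wip u (psi \<phi>)" by (rule X.parseval_ip[OF u psi_X[OF \<phi>]])
      have s2: "(\<lambda>n. X.coef w n * wip (ef (ev n)) (\<lambda>x. \<phi> x / wt x)) sums wip w (\<lambda>x. \<phi> x / wt x)"
        by (rule X.parseval_ip[OF w div_wt_X[OF \<phi>]])
      have "wip (ef (ev n)) (psi \<phi>) = ev n * wip (ef (ev n)) (\<lambda>x. \<phi> x / wt x)" for n
        using a_form_eig[OF ef(1)[OF ev_mem] \<phi>] unfolding a_form_eq_wip[OF efX[OF ev_mem] \<phi>] X_inner_eq_wip .
      then have "X.coef u n * wip (ef (ev n)) (psi \<phi>) = - (X.coef w n * wip (ef (ev n)) (\<lambda>x. \<phi> x / wt x))" for n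
        using c by simp
      then have "(\<lambda>n. - (X.coef w n * wip (ef (ev n)) (\<lambda>x. \<phi> x / wt x))) sums wip u (psi \<phi>)" using s1 by simp
      then have "wip u (psi \<phi>) = - wip w (\<lambda>x. \<phi> x / wt x)" using sums_minus[OF s2] sums_unique2 by blast
      then show "X_inner \<epsilon> L (\<lambda>x. - w x) \<phi> = a_form \<epsilon> L u \<phi>"
        unfolding a_form_eq_wip[OF u \<phi>] X_inner_eq_wip neg[OF div_wt_X[OF \<phi>]] by simp
    qed
  qed
qed

end

section \<open>Dirichlet series\<close>

text \<open>Absolute summability of the coefficients gives uniform convergence on the closed right
  half plane, hence a holomorphic sum inside, to which the identity theorem applies. Finiteness
  below each level provides a smallest exponent with nonzero coefficient.\<close>

lemma dirichlet_series_zero: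
  fixes a \<mu> :: "nat \<Rightarrow> real"
  assumes a: "summable (\<lambda>n. \<bar>a n\<bar>)" and inj: "inj \<mu>" and fin: "\<And>R. finite {n. \<mu> n \<le> R}"
    and \<mu>: "\<And>n. 0 \<le> \<mu> n" and T: "T > 0"
    and zero: "\<And>t. 0 < t \<Longrightarrow> t < T \<Longrightarrow> (\<lambda>n. a n * exp (- \<mu> n * t)) sums 0"
  shows "a k = 0"
proof -
  define f where "f n z = of_real (a n) * exp (- of_real (\<mu> n) * z)" for n and z :: complex
  define F where "F z = (\<Sum>n. f n z)" for z
  let ?S = "{z::complex. 0 < Re z}"
  have bound: "norm (f n z) \<le> \<bar>a n\<bar>" if "0 \<le> Re z" for n z
    using that \<mu>[of n] by (simp add: f_def norm_mult mult_left_le)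
  have opS: "open ?S" by (rule open_halfspace_Re_gt)
  have "F holomorphic_on ?S"
  proof (rule holomorphic_uniform_sequence[OF opS])
    show "(\<lambda>z. \<Sum>n<N. f n z) holomorphic_on ?S" for N
      unfolding f_def by (intro holomorphic_intros)
    fix z assume "z \<in> ?S"
    then obtain d where d: "d > 0" "cball z d \<subseteq> ?S" using opS open_contains_cball by blast
    moreover have "uniform_limit (cball z d) (\<lambda>N z. \<Sum>n<N. f n z) F sequentially"
      unfolding F_def
    proof (rule Weierstrass_m_test[OF _ a])
      fix n y assume "y \<in> cball z d"
      then have "0 \<le> Re y" using d(2) by (auto simp: less_imp_le subset_iff)
      then show "norm (f n y) \<le> \<bar>a n\<bar>" by (rule bound)
    qed
    ultimately show "\<exists>d>0. cball z d \<subseteq> ?S \<and> uniform_limit (cball z d) (\<lambda>N z. \<Sum>n<N. f n z) F sequentially"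
      by blast
  qed
  have fr: "f n (of_real t) = of_real (a n * exp (- \<mu> n * t))" for n t
    by (simp add: f_def exp_of_real flip: of_real_mult of_real_minus)
  have sm: "summable (\<lambda>n. a n * exp (- \<mu> n * t))" if "t \<ge> 0" for t
  proof (rule summable_comparison_test[OF _ a], intro exI allI impI)
    show "norm (a n * exp (- \<mu> n * t)) \<le> \<bar>a n\<bar>" for n
      using \<mu>[of n] that by (simp add: abs_mult mult_left_le)
  qed
  have Fr: "F (of_real t) = of_real (\<Sum>n. a n * exp (- \<mu> n * t))" if "t \<ge> 0" for t
    unfolding F_def fr by (rule suminf_of_real[OF sm[OF that], symmetric])
  have F_zero: "F z = 0" if "z \<in> ?S" for z
  proof (rule analytic_continuation[OF \<open>F holomorphic_on ?S\<close> opS _ _ _ _ _ that])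
    let ?U = "of_real ` {0<..<T} :: complex set"
    show "connected ?S" by (rule convex_connected[OF convex_halfspace_Re_gt])
    show "?U \<subseteq> ?S" by auto
    show "complex_of_real (T / 2) \<in> ?S" using T by simp
    \<comment> \<open>The zeros known so far form a real segment; its midpoint is an accumulation
      point inside the half plane.\<close>
    have "(T / 2) islimpt {0<..<T}" using T by (intro open_imp_islimpt) auto
    then show "complex_of_real (T / 2) islimpt ?U"
    proof (rule islimpt_isCont_image)
      show "\<forall>\<^sub>F x in at (T / 2). complex_of_real x \<noteq> complex_of_real (T / 2)"
        unfolding eventually_at_filter of_real_eq_iff by simp
    qed simp
    show "F z = 0" if z: "z \<in> ?U" for z
    proof -
      obtain t where t: "z = of_real t" "0 < t" "t < T" using z by auto
      have "(\<Sum>n. a n * exp (- \<mu> n * t)) = 0" by (rule sums_unique[OF zero[OF t(2,3)], symmetric])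
      then show ?thesis using Fr[of t] t by simp
    qed
  qed
  have series: "(\<Sum>n. a n * exp (- \<mu> n * t)) = 0" if "t > 0" for t
    using F_zero[of "of_real t"] Fr[of t] that by simp
  show "a k = 0"
  proof (rule ccontr)
    assume k: "a k \<noteq> 0"
    \<comment> \<open>Restricting to exponents up to \<open>\<mu> k\<close> keeps the candidates
      finite, and \<open>k\<close> itself is one, so a minimum exists.\<close>
    define J where "J = {n. \<mu> n \<le> \<mu> k \<and> a n \<noteq> 0}"
    have finJ: "finite J" unfolding J_def by (rule finite_subset[OF _ fin[of "\<mu> k"]]) auto
    have kJ: "k \<in> J" using k by (simp add: J_def)
    obtain m where m: "m \<in> J" and min: "\<And>n. n \<in> J \<Longrightarrow> \<mu> m \<le> \<mu> n"
      using ex_min_if_finite[of "\<mu> ` J"] finJ kJ by (metis (no_types, lifting) empty_iff finite_imageI image_iff not_le)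
    have larger: "\<mu> m < \<mu> n" if "a n \<noteq> 0" "n \<noteq> m" for n
    proof -
      have "\<mu> m \<le> \<mu> n"
        using min[of n] that m by (cases "\<mu> n \<le> \<mu> k") (auto simp: J_def)
      moreover have "\<mu> m \<noteq> \<mu> n" using inj that by (auto dest: injD)
      ultimately show ?thesis by simp
    qed
    \<comment> \<open>The slowest decaying exponential is divided out. Every other nonzero term
      keeps a negative exponent, so it tends to 0 and is still dominated by
      \<open>\<bar>a n\<bar>\<close>; only \<open>a m\<close> remains in the limit.\<close>
    define g where "g n t = a n * exp (- (\<mu> n - \<mu> m) * t)" for n t
    have "((\<lambda>t. \<Sum>n. g n t) \<longlongrightarrow> (\<Sum>n. if n = m then a m else 0)) at_top"
    proof (intro conjunct2[OF conjunct2[OF tannerys_theorem]])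
      show "((\<lambda>t. g n t) \<longlongrightarrow> (if n = m then a m else 0)) at_top" for n
      proof (cases "n = m \<or> a n = 0")
        case True
        then show ?thesis by (auto simp: g_def)
      next
        case False
        then have p: "\<mu> n - \<mu> m > 0" using larger by simp
        have "filterlim (\<lambda>t. (\<mu> n - \<mu> m) * t) at_top at_top"
          by (rule filterlim_tendsto_pos_mult_at_top[OF tendsto_const p filterlim_ident])
        then have "filterlim (\<lambda>t. - (\<mu> n - \<mu> m) * t) at_bot at_top"
          unfolding filterlim_uminus_at_bot mult_minus_left minus_minus .
        from filterlim_compose[OF exp_at_bot this]
        have "((\<lambda>t. g n t) \<longlongrightarrow> 0) at_top" unfolding g_def by (rule tendsto_mult_right_zero)
        with False show ?thesis by simp
      qed
      have "\<forall>\<^sub>F t in at_top. \<forall>n. norm (g n t) \<le> \<bar>a n\<bar>"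
      proof (rule eventually_mono[OF eventually_ge_at_top[of 0]], intro allI)
        fix t :: real and n assume t: "0 \<le> t"
        show "norm (g n t) \<le> \<bar>a n\<bar>"
        proof (cases "a n = 0 \<or> n = m")
          case False
          then have "0 \<le> (\<mu> n - \<mu> m) * t" using larger[of n] t by simp
          then have "exp (- (\<mu> n - \<mu> m) * t) \<le> 1"
            by (simp only: exp_le_one_iff mult_minus_left neg_le_0_iff_le)
          then show ?thesis unfolding g_def by (simp add: abs_mult mult_left_le)
        qed (auto simp: g_def)
      qed
      then have "\<forall>\<^sub>F (n::nat, t) in at_top \<times>\<^sub>F at_top. \<forall>n. norm (g n t) \<le> \<bar>a n\<bar>"
        by (subst eventually_prod2) simp_all
      then show "\<forall>\<^sub>F (n, t) in at_top \<times>\<^sub>F at_top. norm (g n t) \<le> \<bar>a n\<bar>"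
        by eventually_elim auto
    qed (use a in auto)
    moreover have "(\<Sum>n. if n = m then a m else 0) = a m"
      using sums_unique[OF sums_single[of m "\<lambda>_. a m"]] by simp
    moreover have "\<forall>\<^sub>F t in at_top. (\<Sum>n. g n t) = 0"
    proof (rule eventually_mono[OF eventually_gt_at_top[of 0]])
      fix t :: real assume t: "0 < t"
      have "g n t = exp (\<mu> m * t) * (a n * exp (- \<mu> n * t))" for n
        by (simp add: g_def algebra_simps mult_exp_exp)
      then have "(\<Sum>n. g n t) = (\<Sum>n. exp (\<mu> m * t) * (a n * exp (- \<mu> n * t)))" by simp
      also have "\<dots> = exp (\<mu> m * t) * (\<Sum>n. a n * exp (- \<mu> n * t))"
        using t by (intro suminf_mult sm) simp
      finally show "(\<Sum>n. g n t) = 0" using series[OF t] by simp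
    qed
    ultimately have "((\<lambda>t::real. 0) \<longlongrightarrow> a m) at_top"
      using Lim_transform_eventually by fastforce
    then have "a m = 0" using tendsto_unique[OF trivial_limit_at_top_linorder tendsto_const] by metis
    then show False using m by (simp add: J_def)
  qed
qed

section \<open>The generator and its domain in terms of coefficients\<close>

context transport
begin

lemma X_norm_scale: "X_norm \<epsilon> L (\<lambda>x. k * \<phi> x) = \<bar>k\<bar> * X_norm \<epsilon> L \<phi>"
proof (rule power2_eq_imp_eq)
  show "(X_norm \<epsilon> L (\<lambda>x. k * \<phi> x))\<^sup>2 = (\<bar>k\<bar> * X_norm \<epsilon> L \<phi>)\<^sup>2"
    unfolding power_mult_distrib X_norm_sq by (simp add: algebra_simps)
qed (simp_all add: X_norm_nonneg)

lemma X_norm_wt_mult: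
  assumes g: "g \<in> X"
  shows "(X_norm \<epsilon> L (\<lambda>x. wt x * g x))\<^sup>2 \<le> wt (-L) * wip g g"
proof -
  have "(\<integral>x. (wt x * g x)\<^sup>2 \<partial>M) \<le> (\<integral>x. wt (-L) * (wt x * (g x * g x)) \<partial>M)"
  proof (rule integral_mono)
    have "(\<lambda>x. wt x * g x) \<in> X"
    proof (rule X_I)
      show "(\<lambda>x. wt x * g x) \<in> borel_measurable M" using X_measurable[OF g] by measurable
      have "integrable M (\<lambda>x. wt x * (wt x * (g x * g x)))" by (intro wt_integrable X_integrable_mult g)
      then show "integrable M (\<lambda>x. (wt x * g x)\<^sup>2)" by (simp add: power2_eq_square mult_ac)
    qed
    then show "integrable M (\<lambda>x. (wt x * g x)\<^sup>2)" by (rule X_integrable_square)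
    show "integrable M (\<lambda>x. wt (-L) * (wt x * (g x * g x)))" using wip_integrable[OF g g] by simp
    fix x assume "x \<in> space M"
    then have "wt x * (wt x * (g x * g x)) \<le> wt (-L) * (wt x * (g x * g x))"
      using wt_bounds(2)[of x] by (intro mult_right_mono) (auto simp: less_imp_le)
    then show "(wt x * g x)\<^sup>2 \<le> wt (-L) * (wt x * (g x * g x))" by (simp add: power2_eq_square mult_ac)
  qed
  moreover have "\<epsilon> * ((g 0)\<^sup>2 + (wt (-L) * g (-L))\<^sup>2) \<le> \<epsilon> * (wt (-L) * (g 0)\<^sup>2 + (wt (-L) * g (-L))\<^sup>2)"
    using eps_pos wt_bounds(2)[of 0] L_pos mult_right_mono[of 1 "wt (-L)" "(g 0)\<^sup>2"] by (intro mult_left_mono) auto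
  moreover have "(\<integral>x. wt (-L) * (wt x * (g x * g x)) \<partial>M) = wt (-L) * (\<integral>x. wt x * (g x * g x) \<partial>M)" by simp
  ultimately have "(X_norm \<epsilon> L (\<lambda>x. wt x * g x))\<^sup>2 \<le> wt (-L) * (\<integral>x. wt x * (g x * g x) \<partial>M)
      + \<epsilon> * (wt (-L) * (g 0)\<^sup>2 + (wt (-L) * g (-L))\<^sup>2)"
    unfolding X_norm_sq by simp
  also have "\<dots> = wt (-L) * wip g g" by (simp add: wip_def algebra_simps power2_eq_square)
  finally show ?thesis .
qed

lemma wip_div_wt:
  assumes \<phi>: "\<phi> \<in> C_infinity L"
  shows "X.nrm (\<lambda>x. \<phi> x / wt x) \<le> X_norm \<epsilon> L \<phi>"
proof (rule power2_le_imp_le)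
  have le: "(\<phi> x)\<^sup>2 / wt x \<le> (\<phi> x)\<^sup>2" if "x \<in> {-L..0}" for x
    using divide_left_mono[OF wt_bounds(1)[OF that], of "(\<phi> x)\<^sup>2"] by simp
  have eq: "wt x * (\<phi> x / wt x * (\<phi> x / wt x)) = (\<phi> x)\<^sup>2 / wt x" for x by (simp add: power2_eq_square)
  have "(\<integral>x. wt x * (\<phi> x / wt x * (\<phi> x / wt x)) \<partial>M) \<le> (\<integral>x. (\<phi> x)\<^sup>2 \<partial>M)"
    by (intro integral_mono wip_integrable div_wt_X \<phi> X_integrable_square C_infinity_X) (use le eq in auto)
  moreover have "\<epsilon> * ((\<phi> 0)\<^sup>2 / wt 0 + (\<phi> (-L))\<^sup>2 / wt (-L)) \<le> \<epsilon> * ((\<phi> 0)\<^sup>2 + (\<phi> (-L))\<^sup>2)"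
    using eps_pos le[of 0] le[of "-L"] L_pos by (intro mult_left_mono add_mono) auto
  ultimately show "(X.nrm (\<lambda>x. \<phi> x / wt x))\<^sup>2 \<le> (X_norm \<epsilon> L \<phi>)\<^sup>2"
    unfolding X.nrm_sq[OF div_wt_X[OF \<phi>]] X_norm_sq by (simp add: wip_def power2_eq_square)
qed (rule X_norm_nonneg)

lemma a_form_lin:
  assumes "u \<in> X" "\<phi> \<in> C_infinity L" "\<psi> \<in> C_infinity L"
  shows "a_form \<epsilon> L u (\<lambda>x. a * \<phi> x + b * \<psi> x) = a * a_form \<epsilon> L u \<phi> + b * a_form \<epsilon> L u \<psi>"
proof -
  have "wip u (psi (\<lambda>x. a * \<phi> x + b * \<psi> x)) = wip u (\<lambda>x. a * psi \<phi> x + b * psi \<psi> x)"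
  proof (rule wip_cong)
    fix x assume x: "x \<in> {-L..0}"
    have d: "dx L (\<lambda>x. a * \<phi> x + b * \<psi> x) y = a * dx L \<phi> y + b * dx L \<psi> y"
      "dx L (dx L (\<lambda>x. a * \<phi> x + b * \<psi> x)) y = a * dx L (dx L \<phi>) y + b * dx L (dx L \<psi>) y"
      if "y \<in> {-L..0}" for y
      using C_infinity_lin(2)[OF assms(2,3) that, of 1] C_infinity_lin(2)[OF assms(2,3) that, of "Suc 1"] by simp_all
    show "psi (\<lambda>x. a * \<phi> x + b * \<psi> x) x = a * psi \<phi> x + b * psi \<psi> x"
      unfolding psi_def using x L_pos by (simp add: d add_divide_distrib diff_divide_distrib algebra_simps)
  qed
  then show ?thesis
    unfolding a_form_eq_wip[OF assms(1,2)] a_form_eq_wip[OF assms(1,3)]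
      a_form_eq_wip[OF assms(1) C_infinity_lin(1)[OF assms(2,3)]]
    using X.ip_lin_right[OF psi_X[OF assms(2)] psi_X[OF assms(3)] assms(1)] by simp
qed

text \<open>Supplies admissible test functions on which the form is an explicit finite sum;
  boundedness of the form is then converted into square summability.\<close>

lemma wt_psum:
  assumes u: "u \<in> X"
  shows "(\<lambda>x. wt x * X.psum c N x) \<in> C_infinity L \<and>
    a_form \<epsilon> L u (\<lambda>x. wt x * X.psum c N x) = (\<Sum>n<N. c n * (ev n * X.coef u n))"
proof (induction N)
  case 0
  have z: "(\<lambda>x. 0) \<in> C_infinity L" by (rule C_infinity_chain(1)[of "\<lambda>_ _. 0"]) auto
  then have "a_form \<epsilon> L u (\<lambda>x. 0) = 0" using a_form_lin[OF u z z, of 0 0] by simp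
  with z show ?case by (simp add: X.psum_def)
next
  case (Suc N)
  note e = wt_eig[OF ef(1)[OF ev_mem[of N]]]
  have eq: "(\<lambda>x. wt x * X.psum c (Suc N) x) = (\<lambda>x. 1 * (wt x * X.psum c N x) + c N * (wt x * ef (ev N) x))"
    by (simp add: X.psum_def algebra_simps)
  show ?case
    unfolding eq using Suc C_infinity_lin(1)[of _ _ 1 "c N"] a_form_lin[OF u, of _ _ 1 "c N"] e u by simp
qed

text \<open>An element \<open>w\<close> bounds the form by Cauchy-Schwarz. Conversely, a bound on
  the form limits the square sums of \<open>ev n * X.coef u n\<close> uniformly, and Riesz-Fischer
  provides \<open>w\<close>.\<close>

lemma dom_A_iff:
  assumes u: "u \<in> X"
  shows "u \<in> dom_A \<epsilon> L \<longleftrightarrow> (\<exists>w\<in>X. \<forall>n. X.coef w n = - ev n * X.coef u n)"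
proof
  assume "\<exists>w\<in>X. \<forall>n. X.coef w n = - ev n * X.coef u n"
  then obtain w where w: "w \<in> X" and weak: "\<And>\<phi>. \<phi> \<in> C_infinity L \<Longrightarrow> X_inner \<epsilon> L (\<lambda>x. - w x) \<phi> = a_form \<epsilon> L u \<phi>"
    using weak_generator_iff[OF u] by blast
  have w': "(\<lambda>x. - w x) \<in> X" using X.scale_closed[OF w, of "-1"] by simp
  have "\<bar>a_form \<epsilon> L u \<phi>\<bar> \<le> X.nrm (\<lambda>x. - w x)" if \<phi>: "\<phi> \<in> C_infinity L" "X_norm \<epsilon> L \<phi> \<le> 1" for \<phi>
  proof -
    have "\<bar>a_form \<epsilon> L u \<phi>\<bar> = \<bar>wip (\<lambda>x. - w x) (\<lambda>x. \<phi> x / wt x)\<bar>"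
      unfolding weak[OF \<phi>(1), symmetric] X_inner_eq_wip ..
    also have "\<dots> \<le> X.nrm (\<lambda>x. - w x) * X.nrm (\<lambda>x. \<phi> x / wt x)" by (rule X.cauchy_schwarz[OF w' div_wt_X[OF \<phi>(1)]])
    also have "\<dots> \<le> X.nrm (\<lambda>x. - w x) * 1"
      using wip_div_wt[OF \<phi>(1)] \<phi>(2) by (intro mult_left_mono X.nrm_nonneg w') linarith
    finally show ?thesis by simp
  qed
  then have "bdd_above {\<bar>a_form \<epsilon> L u \<phi>\<bar> | \<phi>. \<phi> \<in> C_infinity L \<and> X_norm \<epsilon> L \<phi> \<le> 1}"
    by (intro bdd_aboveI[of _ "X.nrm (\<lambda>x. - w x)"]) auto
  then show "u \<in> dom_A \<epsilon> L" using u by (simp add: dom_A_def X_space_eq)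
next
  assume "u \<in> dom_A \<epsilon> L"
  then have "bdd_above {\<bar>a_form \<epsilon> L u \<phi>\<bar> | \<phi>. \<phi> \<in> C_infinity L \<and> X_norm \<epsilon> L \<phi> \<le> 1}" by (simp add: dom_A_def)
  then obtain B where B: "\<And>\<phi>. \<phi> \<in> C_infinity L \<Longrightarrow> X_norm \<epsilon> L \<phi> \<le> 1 \<Longrightarrow> \<bar>a_form \<epsilon> L u \<phi>\<bar> \<le> B"
    unfolding bdd_above_def by blast
  define c where "c n = ev n * X.coef u n" for n
  have bound: "(\<Sum>n<N. (c n)\<^sup>2) \<le> B\<^sup>2 * wt (-L)" for N
  proof -
    define Q where "Q = (\<Sum>n<N. (c n)\<^sup>2)"
    have Q: "0 \<le> Q" unfolding Q_def by (intro sum_nonneg) auto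
    \<comment> \<open>The duality choice of test function: the form takes the value \<open>Q\<close>
      on it, while its norm is at most \<open>sqrt (wt (-L) * Q)\<close>. Normalising gives
      \<open>Q \<le> B\<^sup>2 * wt (-L)\<close>.\<close>
    define \<phi> where "\<phi> x = wt x * X.psum c N x" for x
    have \<phi>: "\<phi> \<in> C_infinity L" "a_form \<epsilon> L u \<phi> = Q"
      using wt_psum[OF u, of c N] by (simp_all add: \<phi>_def[abs_def] Q_def c_def power2_eq_square)
    have "(X_norm \<epsilon> L \<phi>)\<^sup>2 \<le> wt (-L) * wip (X.psum c N) (X.psum c N)"
      unfolding \<phi>_def[abs_def] by (rule X_norm_wt_mult[OF X.psum_closed])
    also have "wip (X.psum c N) (X.psum c N) = Q"
      using X.nrm_psum[of c N] X.nrm_sq[OF X.psum_closed[of c N]] by (simp add: Q_def)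
    finally have n: "(X_norm \<epsilon> L \<phi>)\<^sup>2 \<le> wt (-L) * Q" .
    define R where "R = sqrt (wt (-L) * Q)"
    have R: "X_norm \<epsilon> L \<phi> \<le> R" "R\<^sup>2 = wt (-L) * Q" "0 \<le> R"
      using n Q by (auto simp: R_def real_le_rsqrt less_imp_le)
    show ?thesis
    proof (cases "Q = 0")
      case True then show ?thesis by (simp add: Q_def[symmetric] less_imp_le)
    next
      case False
      then have Rp: "R > 0" using Q by (simp add: R_def)
      have "(\<lambda>x. (1 / R) * \<phi> x + 0 * \<phi> x) \<in> C_infinity L" by (rule C_infinity_lin(1)[OF \<phi>(1) \<phi>(1)])
      moreover have "X_norm \<epsilon> L (\<lambda>x. (1 / R) * \<phi> x + 0 * \<phi> x) \<le> 1"
        using X_norm_scale[of "1 / R" \<phi>] R Rp by simp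
      ultimately have "\<bar>a_form \<epsilon> L u (\<lambda>x. (1 / R) * \<phi> x + 0 * \<phi> x)\<bar> \<le> B" by (rule B)
      then have "Q / R \<le> B" unfolding a_form_lin[OF u \<phi>(1) \<phi>(1)] \<phi>(2) using Q Rp by simp
      then have "(Q / R)\<^sup>2 \<le> B\<^sup>2" using Q Rp by (intro power_mono) auto
      moreover have "(Q / R)\<^sup>2 = Q / wt (-L)" using False R(2) by (simp add: power_divide power2_eq_square)
      ultimately show ?thesis unfolding Q_def[symmetric] by (simp add: divide_le_eq)
    qed
  qed
  have "summable (\<lambda>n. (- c n)\<^sup>2)"
  proof (rule bounded_imp_summable)
    show "(\<Sum>k\<le>n. (- c k)\<^sup>2) \<le> B\<^sup>2 * wt (-L)" for n
      using bound[of "Suc n"] by (simp only: power2_minus lessThan_Suc_atMost)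
  qed simp
  from X.psum_converges[OF this] obtain w where "w \<in> X" "\<And>n. X.coef w n = - c n" by blast
  then show "\<exists>w\<in>X. \<forall>n. X.coef w n = - ev n * X.coef u n" by (auto simp: c_def)
qed

text \<open>The arbitrary choice in \<open>op_A\<close> is harmless: a candidate exists on the
  domain, and every candidate has the same coefficients.\<close>

lemma op_A_iff:
  assumes u: "u \<in> dom_A \<epsilon> L" and w: "w \<in> X"
  shows "X_eq \<epsilon> L w (op_A \<epsilon> L u) \<longleftrightarrow> (\<forall>n. X.coef w n = - ev n * X.coef u n)"
proof -
  have uX: "u \<in> X" using u by (simp add: dom_A_def X_space_eq)
  have "\<exists>w. w \<in> X_space \<epsilon> L \<and> (\<forall>\<phi>\<in>C_infinity L. X_inner \<epsilon> L (\<lambda>x. - w x) \<phi> = a_form \<epsilon> L u \<phi>)"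
    using u weak_generator_iff[OF uX] unfolding dom_A_iff[OF uX] X_space_eq by blast
  from someI_ex[OF this] have A: "op_A \<epsilon> L u \<in> X" "\<And>n. X.coef (op_A \<epsilon> L u) n = - ev n * X.coef u n"
    using weak_generator_iff[OF uX, of "op_A \<epsilon> L u"] unfolding op_A_def X_space_eq by blast+
  show ?thesis
    unfolding X_eq_iff[OF w A(1)] A(2)[symmetric]
    using X.dst_coef[OF w A(1)] X.coef_null[OF w A(1)] by blast
qed

lemma generator_iff: "u \<in> X \<Longrightarrow> w \<in> X \<Longrightarrow>
    u \<in> dom_A \<epsilon> L \<and> X_eq \<epsilon> L w (op_A \<epsilon> L u) \<longleftrightarrow> (\<forall>n. X.coef w n = - ev n * X.coef u n)"
  using op_A_iff dom_A_iff by blast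

text \<open>The two norms are equivalent and have the same null differences, so the clauses carry
  over one by one; only the operator bounds change, by the factor
  \<open>sqrt (wt (-L))\<close>.\<close>

lemma c0_semigroup_transfer:
  "C0_semigroup \<epsilon> L S \<longleftrightarrow> c0_semigroup_space X wip S"
proof
  assume S: "C0_semigroup \<epsilon> L S"
  note S = S[unfolded C0_semigroup_def X_space_eq]
  note S_rest = S[THEN conjunct2]
  note cl = S[THEN conjunct1, rule_format]
    and lin = S_rest[THEN conjunct1, rule_format]
    and bdd = S_rest[THEN conjunct2, THEN conjunct1, rule_format]
    and zero = S_rest[THEN conjunct2, THEN conjunct2, THEN conjunct1, rule_format]
    and add = S_rest[THEN conjunct2, THEN conjunct2, THEN conjunct2, THEN conjunct1, rule_format]
    and cont = S_rest[THEN conjunct2, THEN conjunct2, THEN conjunct2, THEN conjunct2, rule_format]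
  show "c0_semigroup_space X wip S"
  proof
    show "S t u \<in> X" if "t \<ge> 0" "u \<in> X" for t u using that by (rule cl)
    show "X.dst (S t (\<lambda>x. a * u x + b * v x)) (\<lambda>x. a * S t u x + b * S t v x) = 0"
      if "t \<ge> 0" "u \<in> X" "v \<in> X" for t u v a b
      using lin[OF that] unfolding X_eq_iff[OF cl[OF that(1) X_lin[OF that(2,3)]] X_lin[OF cl[OF that(1,2)] cl[OF that(1,3)]]] .
    show "\<exists>M. \<forall>u\<in>X. X.nrm (S t u) \<le> M * X.nrm u" if t: "t \<ge> 0" for t
    proof -
      obtain B where B: "\<And>u. u \<in> X \<Longrightarrow> X_norm \<epsilon> L (S t u) \<le> B * X_norm \<epsilon> L u"
        using bdd[OF t] by blast
      have "X.nrm (S t u) \<le> (sqrt (wt (-L)) * \<bar>B\<bar>) * X.nrm u" if u: "u \<in> X" for u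
      proof -
        have "X.nrm (S t u) \<le> sqrt (wt (-L)) * X_norm \<epsilon> L (S t u)" by (rule nrm_le_X_norm[OF cl[OF t u]])
        also have "X_norm \<epsilon> L (S t u) \<le> B * X_norm \<epsilon> L u" by (rule B[OF u])
        also have "\<dots> \<le> \<bar>B\<bar> * X.nrm u" using X_norm_le_nrm[OF u] X_norm_nonneg[of u] by (intro mult_mono) auto
        finally show ?thesis by (simp add: mult.assoc mult_left_mono less_imp_le)
      qed
      then show ?thesis by blast
    qed
    show "X.dst (S 0 u) u = 0" if "u \<in> X" for u
      using zero[OF that] unfolding X_eq_iff[OF cl[OF order_refl that] that] .
    show "X.dst (S (s + t) u) (S s (S t u)) = 0" if "s \<ge> 0" "t \<ge> 0" "u \<in> X" for s t u
      using add[OF that]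
      unfolding X_eq_iff[OF cl[OF add_nonneg_nonneg[OF that(1,2)] that(3)] cl[OF that(1) cl[OF that(2,3)]]] .
    show "((\<lambda>t. X.dst (S t u) u) \<longlongrightarrow> 0) (at_right 0)" if u: "u \<in> X" for u
    proof -
      have "\<forall>\<^sub>F t in at_right 0. (\<lambda>x. S t u x - u x) \<in> X"
        by (rule eventually_at_right_less[THEN eventually_mono]) (intro X.diff_closed cl u, simp)
      from X_norm_tendsto_iff[OF this] show ?thesis using cont[OF u] unfolding X.dst_def by (rule iffD1)
    qed
  qed
next
  assume "c0_semigroup_space X wip S"
  then interpret S: c0_semigroup_space X wip S .
  show "C0_semigroup \<epsilon> L S"
    unfolding C0_semigroup_def X_space_eq
  proof (intro conjI allI ballI impI)
    show "S t u \<in> X" if "t \<ge> 0" "u \<in> X" for t u using that by (rule S.S_closed)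
    show "X_eq \<epsilon> L (S t (\<lambda>x. a * u x + b * v x)) (\<lambda>x. a * S t u x + b * S t v x)"
      if "t \<ge> 0" "u \<in> X" "v \<in> X" for t u v a b
      using S.S_lin[OF that] that by (subst X_eq_iff) (auto intro!: S.S_closed X_lin)
    show "\<exists>M. \<forall>u\<in>X. X_norm \<epsilon> L (S t u) \<le> M * X_norm \<epsilon> L u" if t: "t \<ge> 0" for t
    proof -
      obtain B where B: "\<And>u. u \<in> X \<Longrightarrow> X.nrm (S t u) \<le> B * X.nrm u" using S.S_bdd[OF t] by blast
      have "X_norm \<epsilon> L (S t u) \<le> (\<bar>B\<bar> * sqrt (wt (-L))) * X_norm \<epsilon> L u" if u: "u \<in> X" for u
      proof -
        have "X_norm \<epsilon> L (S t u) \<le> X.nrm (S t u)" by (rule X_norm_le_nrm[OF S.S_closed[OF t u]])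
        also have "\<dots> \<le> B * X.nrm u" by (rule B[OF u])
        also have "\<dots> \<le> \<bar>B\<bar> * (sqrt (wt (-L)) * X_norm \<epsilon> L u)" using nrm_le_X_norm[OF u] X.nrm_nonneg[OF u] by (intro mult_mono) auto
        finally show ?thesis by (simp add: mult.assoc)
      qed
      then show ?thesis by blast
    qed
    show "X_eq \<epsilon> L (S 0 u) u" if "u \<in> X" for u
      using S.S_zero[OF that] that by (subst X_eq_iff) (auto intro!: S.S_closed)
    show "X_eq \<epsilon> L (S (s + t) u) (S s (S t u))" if "s \<ge> 0" "t \<ge> 0" "u \<in> X" for s t u
      using S.S_add[OF that] that by (subst X_eq_iff) (auto intro!: S.S_closed)
    show "((\<lambda>t. X_norm \<epsilon> L (\<lambda>x. S t u x - u x)) \<longlongrightarrow> 0) (at_right 0)" if u: "u \<in> X" for u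
    proof -
      have "\<forall>\<^sub>F t in at_right 0. (\<lambda>x. S t u x - u x) \<in> X"
        by (rule eventually_at_right_less[THEN eventually_mono]) (intro X.diff_closed S.S_closed u, simp)
      from X_norm_tendsto_iff[OF this] show ?thesis using S.S_cont[OF u] unfolding X.dst_def by (rule iffD2)
    qed
  qed
qed

lemma quotient_limit_iff:
  assumes S: "c0_semigroup_space X wip S" and u: "u \<in> X" and w: "w \<in> X"
  shows "((\<lambda>h. X_norm \<epsilon> L (\<lambda>x. (S h u x - u x) / h - w x)) \<longlongrightarrow> 0) (at_right 0)
    \<longleftrightarrow> ((\<lambda>h. X.nrm (\<lambda>x. (S h u x - u x) / h - w x)) \<longlongrightarrow> 0) (at_right 0)"
proof (rule X_norm_tendsto_iff, rule eventually_at_right_less[THEN eventually_mono])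
  interpret S: c0_semigroup_space X wip S by (rule S)
  fix h :: real assume "0 < h"
  then have "(\<lambda>x. (1 / h) * (S h u x - u x) - w x) \<in> X"
    by (intro X.diff_closed X.scale_closed S.S_closed u w) simp
  then show "(\<lambda>x. (S h u x - u x) / h - w x) \<in> X" by simp
qed

text \<open>Existence of the semigroup. Without it \<open>is_solution\<close> could be empty, and
  the failure of the estimate could not be witnessed.\<close>

lemma generated_diag_exp: "generated_by_A \<epsilon> L X.diag_exp"
  unfolding generated_by_A_def c0_semigroup_transfer X_space_eq
proof (intro conjI ballI)
  show "c0_semigroup_space X wip X.diag_exp" by (rule X.c0_semigroup_diag_exp)
  fix u w assume u: "u \<in> X" and w: "w \<in> X"
  show "((\<lambda>h. X_norm \<epsilon> L (\<lambda>x. (X.diag_exp h u x - u x) / h - w x)) \<longlongrightarrow> 0) (at_right 0)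
      \<longleftrightarrow> u \<in> dom_A \<epsilon> L \<and> X_eq \<epsilon> L w (op_A \<epsilon> L u)"
    unfolding quotient_limit_iff[OF X.c0_semigroup_diag_exp u w] X.diag_exp_generator[OF u w]
      generator_iff[OF u w] ..
qed

text \<open>Uniqueness of the semigroup: the generator's action on eigenfunctions alone determines
  all coefficients of every orbit.\<close>

lemma generated_coef:
  assumes S: "generated_by_A \<epsilon> L S" and t: "t \<ge> 0" and u: "u \<in> X"
  shows "S t u \<in> X" "X.coef (S t u) n = exp (- ev n * t) * X.coef u n"
proof -
  have c0: "c0_semigroup_space X wip S" using S by (simp add: generated_by_A_def c0_semigroup_transfer)
  show "S t u \<in> X" using c0 t u by (rule c0_semigroup_space.S_closed)
  have "((\<lambda>h. X.nrm (\<lambda>x. (S h (ef (ev m)) x - ef (ev m) x) / h - (- ev m * ef (ev m) x))) \<longlongrightarrow> 0) (at_right 0)" for m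
  proof -
    let ?w = "\<lambda>x. - ev m * ef (ev m) x"
    have w: "?w \<in> X" by (intro X.scale_closed efX ev_mem)
    have "\<forall>n. X.coef ?w n = - ev n * X.coef (ef (ev m)) n"
      unfolding X.ip_scale_left[OF efX[OF ev_mem] efX[OF ev_mem]] X.b_orthonormal by simp
    then have "((\<lambda>h. X_norm \<epsilon> L (\<lambda>x. (S h (ef (ev m)) x - ef (ev m) x) / h - ?w x)) \<longlongrightarrow> 0) (at_right 0)"
      using S[unfolded generated_by_A_def X_space_eq, THEN conjunct2, rule_format, OF efX[OF ev_mem] w]
        generator_iff[OF efX[OF ev_mem] w] by (simp only: simp_thms)
    then show ?thesis by (simp only: quotient_limit_iff[OF c0 efX[OF ev_mem] w])
  qed
  then show "X.coef (S t u) n = exp (- ev n * t) * X.coef u n" by (rule X.semigroup_coef[OF c0 _ t u])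
qed

section \<open>Unique continuation and lack of observability\<close>

text \<open>The Riesz representer of evaluation at \<open>-L\<close>: a boundary value is a bounded
  functional on X since the norm contains it.\<close>

definition left_mass :: "real \<Rightarrow> real" where
  "left_mass x = (if x = -L then 1 / (\<epsilon> * wt (-L)) else 0)"

lemma left_mass:
  shows "left_mass \<in> X" "u \<in> X \<Longrightarrow> wip u left_mass = u (-L)"
proof -
  have z: "left_mass x = 0" if "x \<in> {-L<..<0}" for x using that by (simp add: left_mass_def)
  have m: "left_mass \<in> borel_measurable M" by (subst measurable_cong[of _ _ "\<lambda>_. 0"]) (auto simp: z)
  show "left_mass \<in> X" by (rule X_bounded[OF m, of 0]) (simp add: z)
  have "(\<integral>x. wt x * (u x * left_mass x) \<partial>M) = (\<integral>x. 0 \<partial>M)"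
    by (rule Bochner_Integration.integral_cong) (auto simp: z)
  then show "u \<in> X \<Longrightarrow> wip u left_mass = u (-L)"
    using L_pos eps_pos by (simp add: wip_def left_mass_def)
qed

text \<open>The observation pairs the orbit with \<open>left_mass\<close>, so each
  \<open>a n\<close> is a product of two square summable coefficients. The Dirichlet series is
  therefore absolutely summable already at time 0, as the analyticity argument requires.\<close>

lemma unique_continuation:
  assumes T: "T > 0" and u0: "u0 \<in> X" and sol: "is_solution \<epsilon> L T u0 u"
    and zero: "\<And>t. 0 < t \<Longrightarrow> t < T \<Longrightarrow> u t (-L) = 0"
  shows "X.nrm u0 = 0"
proof -
  obtain S where S: "generated_by_A \<epsilon> L S" and u: "\<And>t. t \<in> {0..T} \<Longrightarrow> u t \<in> X \<and> X_eq \<epsilon> L (u t) (S t u0)"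
    using sol unfolding is_solution_def X_space_eq by blast
  define a where "a n = X.coef u0 n * ef (ev n) (-L)" for n
  have aw: "a n = X.coef u0 n * wip (ef (ev n)) left_mass" for n
    unfolding a_def by (simp only: left_mass(2)[OF efX[OF ev_mem]])
  have "summable (\<lambda>n. \<bar>a n\<bar>)"
  proof (rule summable_comparison_test, intro exI allI impI)
    show "summable (\<lambda>n. (X.coef u0 n)\<^sup>2 + (X.coef left_mass n)\<^sup>2)"
      by (intro summable_add X.bessel u0 left_mass(1))
    fix n
    show "norm \<bar>a n\<bar> \<le> (X.coef u0 n)\<^sup>2 + (X.coef left_mass n)\<^sup>2"
      unfolding aw X.ip_commute[OF efX[OF ev_mem] left_mass(1)] using abs_mult_le_squares by simp
  qed
  then have "a n = 0" for n
  proof (rule dirichlet_series_zero[OF _ _ finite_ev_le _ T])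
    show "inj ev" using ev_inj by (auto simp: inj_def)
    show "0 \<le> ev n" for n using eigenvalue_pos[OF ev_mem[of n]] by simp
    fix t assume t: "0 < t" "t < T"
    then have ut: "u t \<in> X" "X_eq \<epsilon> L (u t) (S t u0)" using u by auto
    have SX: "S t u0 \<in> X" and Sc: "\<And>n. X.coef (S t u0) n = exp (- ev n * t) * X.coef u0 n"
      using generated_coef[OF S _ u0] t by auto
    \<comment> \<open>The solution agrees with the semigroup only as a class; the value at
      \<open>-L\<close> passes between representatives because it is a pairing with
      \<open>left_mass\<close>.\<close>
    have "X.dst (u t) (S t u0) = 0" using ut SX X_eq_iff by blast
    then have "wip (S t u0) left_mass = 0"
      using X.ip_null[OF ut(1) SX left_mass(1)] left_mass(2)[OF ut(1)] zero[OF t] by simp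
    then have "(\<lambda>n. X.coef (S t u0) n * wip (ef (ev n)) left_mass) sums 0"
      using X.parseval_ip[OF SX left_mass(1)] by simp
    then show "(\<lambda>n. a n * exp (- ev n * t)) sums 0" unfolding Sc aw by (simp add: mult_ac)
  qed
  then have "X.coef u0 n = 0" for n
    using eig_boundary_nonzero[OF ef(1) ef(2), OF ev_mem ev_mem] unfolding a_def by (metis mult_eq_0_iff)
  then show ?thesis by (rule X.b_total[OF u0])
qed

lemma eigenfunction_solution:
  "is_solution \<epsilon> L T (ef (ev n)) (\<lambda>t x. exp (- ev n * t) * ef (ev n) x)"
  unfolding is_solution_def X_space_eq
proof (intro exI conjI ballI)
  show "generated_by_A \<epsilon> L X.diag_exp" by (rule generated_diag_exp)
  note e = efX[OF ev_mem[of n]]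
  fix t assume "t \<in> {0..T}"
  then have t: "t \<ge> 0" by simp
  show V: "(\<lambda>x. exp (- ev n * t) * ef (ev n) x) \<in> X" by (rule X.scale_closed[OF e])
  show "X_eq \<epsilon> L (\<lambda>x. exp (- ev n * t) * ef (ev n) x) (X.diag_exp t (ef (ev n)))"
    unfolding X_eq_iff[OF V X.diag_exp(1)[OF t e]]
  proof (rule X.dst_coef[OF V X.diag_exp(1)[OF t e]])
    show "X.coef (\<lambda>x. exp (- ev n * t) * ef (ev n) x) m = X.coef (X.diag_exp t (ef (ev n))) m" for m
      unfolding X.ip_scale_left[OF e efX[OF ev_mem]] X.diag_exp(2)[OF t e] X.b_orthonormal by simp
  qed
qed

text \<open>For normalised eigenfunctions the estimate reads
  \<open>1 \<le> wt (-L) * C\<^sup>2 * I\<close> with \<open>I\<close> at most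
  \<open>1 / (2 * \<epsilon> * ev n)\<close>. All eigenvalues would then lie below one constant,
  where there are only finitely many.\<close>

lemma not_observable:
  assumes C: "C > 0" and est: "\<And>u0 u. u0 \<in> X \<Longrightarrow> is_solution \<epsilon> L T u0 u \<Longrightarrow>
      X_norm \<epsilon> L u0 \<le> C * L2_norm {0<..<T} (\<lambda>t. u t (-L))"
    and T: "T > 0"
  shows False
proof -
  have "ev n \<le> wt (-L) * C\<^sup>2 / (2 * \<epsilon>)" for n
  proof -
    let ?e = "ef (ev n)" and ?\<mu> = "ev n"
    note e = efX[OF ev_mem[of n]] and n1 = ef(2)[OF ev_mem[of n]]
    have \<mu>: "?\<mu> > 0" by (rule eigenvalue_pos[OF ev_mem])
    let ?b = "?e (-L)"
    \<comment> \<open>The boundary value enters the norm of X with factor \<epsilon>, so its size is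
      bounded independently of the eigenvalue.\<close>
    have b: "?b\<^sup>2 \<le> 1 / \<epsilon>"
    proof -
      have "(X_norm \<epsilon> L ?e)\<^sup>2 \<le> 1" using X_norm_le_wip[OF e] X.nrm_sq[OF e] n1 by simp
      moreover have "0 \<le> \<epsilon> * (?e 0)\<^sup>2" using eps_pos by simp
      ultimately have "\<epsilon> * ?b\<^sup>2 \<le> 1" using square_integral_nonneg[of ?e] unfolding X_norm_sq distrib_left by linarith
      then show ?thesis using eps_pos by (simp add: field_simps)
    qed
    define I where "I = (\<integral>t. (exp (- ?\<mu> * t) * ?b)\<^sup>2 \<partial>lebesgue_on {0<..<T})"
    have sq: "(exp (- ?\<mu> * t) * ?b)\<^sup>2 = exp (- 2 * ?\<mu> * t) * ?b\<^sup>2" for t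
      by (simp add: power_mult_distrib flip: exp_double)
    have I_le: "I \<le> ?b\<^sup>2 / (2 * ?\<mu>)"
    \<comment> \<open>A non-integrable function has integral 0 by convention, so the bound holds in
      either case.\<close>
    proof (cases "integrable (lebesgue_on {0<..<T}) (\<lambda>t. (exp (- ?\<mu> * t) * ?b)\<^sup>2)")
      case True
      define G where "G t = - (exp (- 2 * ?\<mu> * t) * ?b\<^sup>2) / (2 * ?\<mu>)" for t
      have "((\<lambda>t. exp (- 2 * ?\<mu> * t) * ?b\<^sup>2) has_integral (G T - G 0)) {0..T}"
      proof (rule fundamental_theorem_of_calculus)
        show "(G has_vector_derivative exp (- 2 * ?\<mu> * t) * ?b\<^sup>2) (at t within {0..T})" for t
          unfolding G_def using \<mu>
          by (auto intro!: derivative_eq_intros simp flip: has_real_derivative_iff_has_vector_derivative)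
      qed (use T in simp)
      moreover have "((\<lambda>t. exp (- 2 * ?\<mu> * t) * ?b\<^sup>2) has_integral I) {0..T}"
        using has_integral_integral_lebesgue_on[OF True] unfolding I_def[symmetric] unfolding sq
        by (simp add: has_integral_Icc_iff_Ioo)
      ultimately have "I = G T - G 0" by (rule has_integral_unique[symmetric])
      also have "\<dots> = ?b\<^sup>2 / (2 * ?\<mu>) - exp (- 2 * ?\<mu> * T) * ?b\<^sup>2 / (2 * ?\<mu>)" by (simp add: G_def)
      also have "\<dots> \<le> ?b\<^sup>2 / (2 * ?\<mu>)" using \<mu> by simp
      finally show ?thesis .
    next
      case False
      then show ?thesis unfolding I_def using \<mu> by (simp add: not_integrable_integral_eq)
    qed
    have I0: "0 \<le> I" unfolding I_def by (rule integral_nonneg_AE) simp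
    have "1 \<le> sqrt (wt (-L)) * X_norm \<epsilon> L ?e" using nrm_le_X_norm[OF e] n1 by simp
    also have "\<dots> \<le> sqrt (wt (-L)) * (C * sqrt I)"
      using est[OF e eigenfunction_solution] unfolding L2_norm_def I_def by (intro mult_left_mono) (auto simp: less_imp_le)
    finally have "1\<^sup>2 \<le> (sqrt (wt (-L)) * (C * sqrt I))\<^sup>2" by (intro power_mono) auto
    then have "1 \<le> wt (-L) * (C\<^sup>2 * I)" using I0 by (simp add: power_mult_distrib less_imp_le)
    also have "\<dots> \<le> wt (-L) * (C\<^sup>2 * (?b\<^sup>2 / (2 * ?\<mu>)))" using I_le by (intro mult_left_mono) (auto simp: less_imp_le)
    also have "\<dots> \<le> wt (-L) * (C\<^sup>2 * ((1 / \<epsilon>) / (2 * ?\<mu>)))"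
      using b \<mu> by (intro mult_left_mono divide_right_mono) (auto simp: less_imp_le)
    finally show ?thesis using \<mu> eps_pos by (simp add: field_simps)
  qed
  then have "{n. ev n \<le> wt (-L) * C\<^sup>2 / (2 * \<epsilon>)} = UNIV" by auto
  then show False using finite_ev_le[of "wt (-L) * C\<^sup>2 / (2 * \<epsilon>)"] by simp
qed

end

theorem proposition2:
  fixes L T \<epsilon> :: real
  assumes "L > 0" and "T > 0" and "\<epsilon> > 0"
  shows "(\<forall>u0\<in>X_space \<epsilon> L. \<forall>u. is_solution \<epsilon> L T u0 u \<longrightarrow>
            (\<forall>t\<in>{0<..<T}. u t (-L) = 0) \<longrightarrow> X_eq \<epsilon> L u0 (\<lambda>_. 0))
       \<and> \<not> (\<exists>C>0. \<forall>u0\<in>X_space \<epsilon> L. \<forall>u. is_solution \<epsilon> L T u0 u \<longrightarrow>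
            X_norm \<epsilon> L u0 \<le> C * L2_norm {0<..<T} (\<lambda>t. u t (-L)))"
proof -
  interpret transport L \<epsilon> by unfold_locales (use assms in auto)
  show ?thesis unfolding X_space_eq
  proof (intro conjI ballI allI impI notI)
    fix u0 u assume "u0 \<in> X" "is_solution \<epsilon> L T u0 u" "\<forall>t\<in>{0<..<T}. u t (-L) = 0"
    then show "X_eq \<epsilon> L u0 (\<lambda>_. 0)"
      using unique_continuation[OF assms(2)] by (simp add: X_eq_iff X.zero_closed X.dst_zero)
  next
    assume "\<exists>C>0. \<forall>u0\<in>X. \<forall>u. is_solution \<epsilon> L T u0 u \<longrightarrow>
        X_norm \<epsilon> L u0 \<le> C * L2_norm {0<..<T} (\<lambda>t. u t (-L))"
    then show False using not_observable[OF _ _ assms(2)] by blast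
  qed
qed

end
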